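(* Fix $\varepsilon>0$ and let $c\in\mathscr{K}$ satisfy the minimal amplitude hypothesis with respect to $\mathscr{A}^c_\varepsilon$. Consider the family $\{u_{\lambda,k}:\ (\mu_k,\lambda)\in\mathscr{A}^c_\varepsilon\}$ of normalized eigenfunctions. Then, for every nonempty interval $(a,b)\subseteq(0,H)$, there exist constants $d>0$, depending on $\varepsilon,c_M,c_m,b-a,\mathfrak{r}_{c,\varepsilon}$, and $\lambda_0>0$, depending on $\varepsilon,c_M,c_m,b-a$, such that for all $(\mu_k,\lambda)\in\mathscr{A}^c_\varepsilon$ $$\int_a^b u_{\lambda,k}(y)^2\,dy\ge d,\qquad\lambda>\lambda_0.$$ This estimate is equivalent to $\int_{\Omega'\times(a,b)}v_\lambda(x)^2\,dx\ge d$, where $v_\lambda(x',y)=\phi_k(x')u_{\lambda,k}(y)$ is the eigenfunction of $-\nabla\cdot c(y)\nabla$ associated with $\lambda$ and $u_{\lambda,k}$.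
   Context: $\Omega'\subset\mathbb{R}^d$ ($d\ge1$) is a fixed bounded smooth open domain, $H>0$ is fixed, $\Omega=\Omega'\times(0,H)$ with coordinates $x=(x',y)$. $\{(\mu_k^2,\phi_k)\}_{k\ge1}$ is the sequence of eigenvalues (nondecreasing, with multiplicity, $\mu_k>0$) and $L^2$-normalized eigenfunctions of the Dirichlet Laplacian $-\Delta_{x'}$ in $L^2(\Omega')$. Fix $0<c_m<c_M$; $\mathscr{K}$ is the set of all $c\in L^\infty([0,H])$ with $\operatorname{ess\,inf}c=c_m$ and $\operatorname{ess\,sup}c=c_M$. For $c\in\mathscr{K}$ and $k\ge1$, $$A_k=c(y)\mu_k^2-\frac{d}{dy}c(y)\frac{d}{dy}\ \text{ in }L^2(0,H),\qquad D(A_k)=\{u\in H^1_0(0,H):\ cu'\in H^1(0,H)\},$$ is self-adjoint with simple eigenvalues $\beta_{k,1}<\beta_{k,2}<\cdots$. If $\lambda=\beta_{k,\ell}$, $u_{\lambda,k}$ denotes the (real) eigenfunction of $A_k$ for $\lambda$, normalized in $L^2(0,H)$; it solves $(cu')'+(\lambda-c\mu_k^2)u=0$, $u(0)=u(H)=0$. $\mathscr{A}^c_\varepsilon=\bigcup_{k\ge1}\{(\mu_k,\lambda):\ \lambda=\beta_{k,\ell}\text{ for some }\ell\ge1,\ \lambda\ge(c_M+\varepsilon)\mu_k^2\}$. The function $c$ satisfies the minimal amplitude hypothesis with respect to $\mathscr{A}^c_\varepsilon$ if $\mathfrak{r}_{c,\varepsilon}>0$, where $\mathfrak{r}_{c,\varepsilon}\ge0$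 is defined by $$\mathfrak{r}_{c,\varepsilon}^2=\inf_{y\in[0,H],\ (\mu_k,\lambda)\in\mathscr{A}^c_\varepsilon}\big[u_{\lambda,k}(y)^2+(c(y)u_{\lambda,k}'(y))^2\big],$$ $cu_{\lambda,k}'$ being understood as its continuous representative. *)

theory Defs
  imports "HOL-Analysis.Analysis" "HOL-Probability.Essential_Supremum"
begin

subsection \<open>Smooth functions and smooth domains\<close>

text \<open>Used for open \<open>U\<close> only. The continuity required of every partial derivative up to
  order \<open>n\<close>, together with differentiability, makes this the usual class of \<open>C\<close>-\<open>n\<close> functions.\<close>

primrec Ck_on :: "nat \<Rightarrow> 'a::euclidean_space set \<Rightarrow> ('a \<Rightarrow> real) \<Rightarrow> bool" where
  "Ck_on 0 U f \<longleftrightarrow> continuous_on U f"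
| "Ck_on (Suc n) U f \<longleftrightarrow>
     (\<forall>x\<in>U. f differentiable (at x)) \<and>
     (\<forall>i\<in>Basis. Ck_on n U (\<lambda>x. frechet_derivative f (at x) i))"

definition smooth_on :: "'a::euclidean_space set \<Rightarrow> ('a \<Rightarrow> real) \<Rightarrow> bool" where
  "smooth_on U f \<longleftrightarrow> (\<forall>n. Ck_on n U f)"

definition gradient :: "('a::euclidean_space \<Rightarrow> real) \<Rightarrow> 'a \<Rightarrow> 'a" where
  "gradient f x = (\<Sum>i\<in>Basis. frechet_derivative f (at x) i *\<^sub>R i)"

text \<open>Smoothness of the boundary: near each boundary point the domain is the strict sublevel set
  of a smooth function with nonvanishing gradient.\<close>

definition smooth_bounded_domain :: "'a::euclidean_space set \<Rightarrow> bool" where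
  "smooth_bounded_domain U \<longleftrightarrow>
     open U \<and> connected U \<and> U \<noteq> {} \<and> bounded U \<and>
     (\<forall>p\<in>frontier U. \<exists>V \<rho>. open V \<and> p \<in> V \<and> smooth_on V \<rho> \<and> gradient \<rho> p \<noteq> 0 \<and>
        U \<inter> V = {x \<in> V. \<rho> x < 0})"

subsection \<open>Sobolev spaces\<close>

text \<open>Elements of Lebesgue and Sobolev spaces are represented by functions on the whole type, of
  which only the values almost everywhere on \<open>U\<close> matter. On the line, a gradient is a function
  with real values, so the same definitions serve for \<open>(0,H)\<close>.\<close>

definition L2 :: "'a::euclidean_space set \<Rightarrow> ('a \<Rightarrow> 'b::euclidean_space) \<Rightarrow> bool" where
  "L2 U f \<longleftrightarrow> f \<in> borel_measurable (lebesgue_on U) \<and>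
     integrable (lebesgue_on U) (\<lambda>x. (norm (f x))\<^sup>2)"

definition test_function :: "'a::euclidean_space set \<Rightarrow> ('a \<Rightarrow> real) \<Rightarrow> bool" where
  "test_function U \<psi> \<longleftrightarrow> smooth_on UNIV \<psi> \<and>
     compact (closure {x. \<psi> x \<noteq> 0}) \<and> closure {x. \<psi> x \<noteq> 0} \<subseteq> U"

text \<open>\<open>f \<in> H\<^sup>1(U)\<close> with weak gradient \<open>g\<close>.\<close>

definition H1_grad :: "'a::euclidean_space set \<Rightarrow> ('a \<Rightarrow> real) \<Rightarrow> ('a \<Rightarrow> 'a) \<Rightarrow> bool" where
  "H1_grad U f g \<longleftrightarrow> L2 U f \<and> L2 U g \<and>
     (\<forall>\<psi>. test_function U \<psi> \<longrightarrow>
        (LINT x|lebesgue_on U. f x *\<^sub>R gradient \<psi> x) = - (LINT x|lebesgue_on U. \<psi> x *\<^sub>R g x))"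

text \<open>\<open>H\<^sup>1\<^sub>0(U)\<close> is the closure of the test functions in \<open>H\<^sup>1(U)\<close>; again \<open>g\<close> is the weak gradient.\<close>

definition H10_grad :: "'a::euclidean_space set \<Rightarrow> ('a \<Rightarrow> real) \<Rightarrow> ('a \<Rightarrow> 'a) \<Rightarrow> bool" where
  "H10_grad U f g \<longleftrightarrow> H1_grad U f g \<and>
     (\<exists>\<psi> :: nat \<Rightarrow> 'a \<Rightarrow> real.
        (\<forall>n. test_function U (\<psi> n)) \<and>
        (\<lambda>n. LINT x|lebesgue_on U. (\<psi> n x - f x)\<^sup>2) \<longlonglongrightarrow> 0 \<and>
        (\<lambda>n. LINT x|lebesgue_on U. (norm (gradient (\<psi> n) x - g x))\<^sup>2) \<longlonglongrightarrow> 0)"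

subsection \<open>The operators \<open>-\<nabla>\<cdot>a\<nabla>\<close> with Dirichlet boundary condition\<close>

text \<open>\<open>w\<close> lies in the domain \<open>{w \<in> H\<^sup>1\<^sub>0(U). \<nabla>\<cdot>(a\<nabla>w) \<in> L\<^sup>2(U)}\<close> and \<open>-\<nabla>\<cdot>(a\<nabla>w) = h\<close>. The operator
  is the Dirichlet Laplacian when \<open>a = 1\<close>.\<close>

definition dirichlet_op ::
  "'a::euclidean_space set \<Rightarrow> ('a \<Rightarrow> real) \<Rightarrow> ('a \<Rightarrow> real) \<Rightarrow> ('a \<Rightarrow> real) \<Rightarrow> bool" where
  "dirichlet_op U a w h \<longleftrightarrow>
     (\<exists>g. H10_grad U w g \<and> L2 U h \<and>
        (\<forall>\<psi>. test_function U \<psi> \<longrightarrow>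
           (LINT x|lebesgue_on U. (a x *\<^sub>R g x) \<bullet> gradient \<psi> x) = (LINT x|lebesgue_on U. h x * \<psi> x)))"

definition dirichlet_eigenfunction ::
  "'a::euclidean_space set \<Rightarrow> ('a \<Rightarrow> real) \<Rightarrow> real \<Rightarrow> ('a \<Rightarrow> real) \<Rightarrow> bool" where
  "dirichlet_eigenfunction U a lam w \<longleftrightarrow>
     dirichlet_op U a w (\<lambda>x. lam * w x) \<and> \<not> (AE x in lebesgue_on U. w x = 0)"

text \<open>The sequence \<open>(\<mu>\<^sub>k\<^sup>2, \<phi>\<^sub>k)\<close>, \<open>k \<ge> 1\<close>, for the Dirichlet Laplacian on \<open>U\<close>. The last clause says
  that all eigenvalues are listed, each as often as its multiplicity: for every real \<open>\<nu>\<close> the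
  \<open>\<phi>\<^sub>k\<close> with \<open>\<mu>\<^sub>k\<^sup>2 = \<nu>\<close> form a basis of the (possibly trivial) space of solutions of \<open>-\<Delta>w = \<nu>w\<close>.\<close>

definition dirichlet_eigen_seq ::
  "'a::euclidean_space set \<Rightarrow> (nat \<Rightarrow> real) \<Rightarrow> (nat \<Rightarrow> 'a \<Rightarrow> real) \<Rightarrow> bool" where
  "dirichlet_eigen_seq U \<mu> \<phi> \<longleftrightarrow>
     (\<forall>k\<ge>1. 0 < \<mu> k \<and> \<mu> k \<le> \<mu> (Suc k)) \<and>
     (\<forall>k\<ge>1. dirichlet_eigenfunction U (\<lambda>_. 1) ((\<mu> k)\<^sup>2) (\<phi> k) \<and>
        (LINT x|lebesgue_on U. (\<phi> k x)\<^sup>2) = 1) \<and>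
     (\<forall>\<nu>. let J = {k. 1 \<le> k \<and> (\<mu> k)\<^sup>2 = \<nu>} in
        finite J \<and>
        (\<forall>\<alpha>. (AE x in lebesgue_on U. (\<Sum>k\<in>J. \<alpha> k * \<phi> k x) = 0) \<longrightarrow> (\<forall>k\<in>J. \<alpha> k = 0)) \<and>
        (\<forall>w. dirichlet_op U (\<lambda>_. 1) w (\<lambda>x. \<nu> * w x) \<longrightarrow>
           (\<exists>\<alpha>. AE x in lebesgue_on U. w x = (\<Sum>k\<in>J. \<alpha> k * \<phi> k x))))"

subsection \<open>The operators \<open>A\<^sub>k\<close> on \<open>(0,H)\<close>\<close>

text \<open>The class of admissible coefficients; finiteness of the two essential bounds contains
  \<open>c \<in> L\<^sup>\<infinity>\<close>.\<close>

definition coeff_class :: "real \<Rightarrow> real \<Rightarrow> real \<Rightarrow> (real \<Rightarrow> real) set" where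
  "coeff_class H c\<^sub>m c\<^sub>M =
     {c. c \<in> borel_measurable (lebesgue_on {0..H}) \<and>
         - esssup (lebesgue_on {0..H}) (\<lambda>y. - ereal (c y)) = ereal c\<^sub>m \<and>
         esssup (lebesgue_on {0..H}) (\<lambda>y. ereal (c y)) = ereal c\<^sub>M}"

text \<open>\<open>u \<in> D(A)\<close> and \<open>A u = w\<close> for \<open>A = c m\<^sup>2 - (d/dy) c (d/dy)\<close>, where
  \<open>D(A) = {u \<in> H\<^sup>1\<^sub>0(0,H). c u' \<in> H\<^sup>1(0,H)}\<close>.\<close>

definition A_op ::
  "real \<Rightarrow> (real \<Rightarrow> real) \<Rightarrow> real \<Rightarrow> (real \<Rightarrow> real) \<Rightarrow> (real \<Rightarrow> real) \<Rightarrow> bool" where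
  "A_op H c m u w \<longleftrightarrow>
     (\<exists>u' q. H10_grad {0<..<H} u u' \<and> H1_grad {0<..<H} (\<lambda>y. c y * u' y) q \<and>
        (AE y in lebesgue_on {0<..<H}. w y = c y * m\<^sup>2 * u y - q y))"

definition A_eigenfunction ::
  "real \<Rightarrow> (real \<Rightarrow> real) \<Rightarrow> real \<Rightarrow> real \<Rightarrow> (real \<Rightarrow> real) \<Rightarrow> bool" where
  "A_eigenfunction H c m lam u \<longleftrightarrow>
     A_op H c m u (\<lambda>y. lam * u y) \<and> \<not> (AE y in lebesgue_on {0<..<H}. u y = 0)"

definition A_eigenvalue :: "real \<Rightarrow> (real \<Rightarrow> real) \<Rightarrow> real \<Rightarrow> real \<Rightarrow> bool" where
  "A_eigenvalue H c m lam \<longleftrightarrow> (\<exists>u. A_eigenfunction H c m lam u)"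

text \<open>\<open>\<beta> 1 < \<beta> 2 < \<dots>\<close> are all the eigenvalues.\<close>

definition A_eigenvalue_seq :: "real \<Rightarrow> (real \<Rightarrow> real) \<Rightarrow> real \<Rightarrow> (nat \<Rightarrow> real) \<Rightarrow> bool" where
  "A_eigenvalue_seq H c m \<beta> \<longleftrightarrow>
     (\<forall>l\<ge>1. \<beta> l < \<beta> (Suc l)) \<and> \<beta> ` {1..} = {lam. A_eigenvalue H c m lam}"

text \<open>The values of \<open>u\<close> at all points of \<open>[0,H]\<close> enter the minimal amplitude below, so the
  continuous representative is taken.\<close>

definition normalized_A_eigenfunction ::
  "real \<Rightarrow> (real \<Rightarrow> real) \<Rightarrow> real \<Rightarrow> real \<Rightarrow> (real \<Rightarrow> real) \<Rightarrow> bool" where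
  "normalized_A_eigenfunction H c m lam u \<longleftrightarrow>
     A_eigenfunction H c m lam u \<and> continuous_on {0..H} u \<and>
     (LINT y|lebesgue_on {0<..<H}. (u y)\<^sup>2) = 1"

text \<open>The continuous representative of \<open>c u'\<close>, unique on \<open>[0,H]\<close>.\<close>

definition flux :: "real \<Rightarrow> (real \<Rightarrow> real) \<Rightarrow> (real \<Rightarrow> real) \<Rightarrow> real \<Rightarrow> real" where
  "flux H c u = (SOME p. continuous_on {0..H} p \<and>
     (\<exists>u'. H1_grad {0<..<H} u u' \<and> (AE y in lebesgue_on {0<..<H}. p y = c y * u' y)))"

subsection \<open>The minimal amplitude\<close>

definition spec_set ::
  "(nat \<Rightarrow> real) \<Rightarrow> (nat \<Rightarrow> nat \<Rightarrow> real) \<Rightarrow> real \<Rightarrow> real \<Rightarrow> (real \<times> real) set" where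
  "spec_set \<mu> \<beta> c\<^sub>M \<epsilon> =
     (\<Union>k\<in>{1..}. {(\<mu> k, lam) | lam. (\<exists>l\<ge>1. lam = \<beta> k l) \<and> (c\<^sub>M + \<epsilon>) * (\<mu> k)\<^sup>2 \<le> lam})"

text \<open>Here \<open>u lam k\<close> is the eigenfunction of \<open>A\<^sub>k\<close> for \<open>lam\<close>.\<close>

definition minimal_amplitude ::
  "real \<Rightarrow> (real \<Rightarrow> real) \<Rightarrow> real \<Rightarrow> real \<Rightarrow> (nat \<Rightarrow> real) \<Rightarrow> (nat \<Rightarrow> nat \<Rightarrow> real) \<Rightarrow>
   (real \<Rightarrow> nat \<Rightarrow> real \<Rightarrow> real) \<Rightarrow> real" where
  "minimal_amplitude H c c\<^sub>M \<epsilon> \<mu> \<beta> u =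
     sqrt (Inf {(u lam k y)\<^sup>2 + (flux H c (u lam k) y)\<^sup>2 | y k lam.
       y \<in> {0..H} \<and> k \<ge> 1 \<and> (\<mu> k, lam) \<in> spec_set \<mu> \<beta> c\<^sub>M \<epsilon>})"

end

theory Submission
  imports Defs
begin

text \<open>Let \<open>u\<close> be a normalized eigenfunction and \<open>p = c u'\<close> its flux. They solve the first order system
  \<open>u' = p / c\<close>, \<open>p' = - (\<lambda> - c \<mu>\<^sup>2) u\<close>, and \<open>\<lambda> \<ge> (c\<^sub>M + \<epsilon>) \<mu>\<^sup>2\<close> puts both coefficients between positive
  constants after rescaling: \<open>1 / c\<close> lies in \<open>[1 / c\<^sub>M, 1 / c\<^sub>m]\<close> and \<open>\<lambda> - c \<mu>\<^sup>2\<close> in \<open>[\<kappa> \<lambda>, \<lambda>]\<close> with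
  \<open>\<kappa> = \<epsilon> / (c\<^sub>M + \<epsilon>)\<close>. As \<open>c\<close> is only bounded and measurable, there is no energy that is nearly
  conserved over the whole interval; the argument is local, on windows whose length \<open>t\<close> is a fixed
  multiple of \<open>\<lambda>\<close> to the power \<open>-1/2\<close>.

  Such a solution rotates around the origin at a rate bounded below, so \<open>p\<close> vanishes somewhere in every
  window (\<open>flux_vanishes_in_window\<close>). At this point the minimal amplitude hypothesis reads \<open>u\<^sup>2 \<ge> r\<^sup>2\<close>.
  From there, two integrations of the system bound the oscillation of \<open>u\<close> over the window by
  \<open>\<lambda> t\<close> times the integral of \<open>\<bar>u\<bar>\<close>, up to the factor \<open>1 / c\<^sub>m\<close>, and since \<open>\<lambda> t\<^sup>2\<close> is bounded, the
  integral of \<open>u\<^sup>2\<close> over the window is at least a constant times \<open>r\<^sup>2 t\<close> (\<open>window_mass\<close>). An interval of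
  length \<open>L\<close> is a union of such windows once \<open>\<lambda> L\<^sup>2\<close> is large, and adding up the windows gives the bound
  (\<open>eigenfunction_mass\<close>).

  Two further arguments connect this with the definitions. First, \<open>u\<close> and \<open>p\<close> are only given through weak
  derivatives; the lemma of du Bois-Reymond (\<open>H1_grad_absolutely_continuous\<close>) and the uniqueness of weak
  derivatives show that they are the integrals of their derivatives and that \<open>flux\<close> is indeed \<open>c u'\<close>. This
  needs smooth approximations of the indicator function of an interval, obtained from \<open>exp (- 1 / x)\<close>.
  Second, \<open>v (x, y) = \<phi> x * u y\<close> is an eigenfunction on the product domain: slices of a test function are
  test functions, so testing with a function of both variables reduces by Fubini to the weak equations of
  \<open>\<phi>\<close> and \<open>u\<close> (\<open>dirichlet_op_tensor\<close>), and products of approximating test functions approximate \<open>v\<close>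
  (\<open>H10_grad_tensor\<close>). Finally the integral of \<open>v\<^sup>2\<close> is that of \<open>u\<^sup>2\<close>, because \<open>\<phi>\<close> is normalized.\<close>

section \<open>Smooth functions and plateau functions\<close>

lemma Ck_on_SucI:
  fixes f :: "'a::euclidean_space \<Rightarrow> real"
  assumes "\<And>x. (f has_derivative D x) (at x)"
    and "\<And>i. i \<in> Basis \<Longrightarrow> Ck_on n UNIV (\<lambda>x. D x i)"
  shows "Ck_on (Suc n) UNIV f"
proof -
  have "frechet_derivative f (at x) = D x" for x
    using frechet_derivative_at[OF assms(1)] by simp
  with assms show ?thesis by (auto simp: differentiable_def)
qed

lemma Ck_on_Suc_has_derivative:
  assumes "Ck_on (Suc n) UNIV f"
  shows "(f has_derivative frechet_derivative f (at x)) (at x)"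
  using assms by (simp add: frechet_derivative_works)

lemma Ck_on_Suc_imp: "Ck_on (Suc n) UNIV f \<Longrightarrow> Ck_on n UNIV f"
proof (induction n arbitrary: f)
  case 0
  then show ?case
    by (auto simp: continuous_on_eq_continuous_at differentiable_imp_continuous_within)
next
  case (Suc n)
  have "Ck_on n UNIV (\<lambda>x. frechet_derivative f (at x) i)" if "i \<in> Basis" for i
    by (rule Suc.IH) (use Suc.prems that in auto)
  with Suc.prems show ?case by simp
qed

lemma Ck_on_const: "Ck_on n UNIV (\<lambda>_. c)"
proof (induction n arbitrary: c)
  case (Suc n)
  show ?case by (rule Ck_on_SucI[where D = "\<lambda>_ _. 0"]) (auto intro: Suc)
qed auto

lemma Ck_on_add:
  "Ck_on n UNIV f \<Longrightarrow> Ck_on n UNIV g \<Longrightarrow> Ck_on n UNIV (\<lambda>x. f x + g x)"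
proof (induction n arbitrary: f g)
  case (Suc n)
  show ?case
    by (rule Ck_on_SucI[OF has_derivative_add
          [OF Suc.prems[THEN Ck_on_Suc_has_derivative]]], rule Suc.IH) (use Suc.prems in auto)
qed (auto intro: continuous_intros)

lemma Ck_on_mult:
  fixes f :: "'a::euclidean_space \<Rightarrow> real"
  shows "Ck_on n UNIV f \<Longrightarrow> Ck_on n UNIV g \<Longrightarrow> Ck_on n UNIV (\<lambda>x. f x * g x)"
proof (induction n arbitrary: f g)
  case (Suc n)
  show ?case
    by (rule Ck_on_SucI[OF has_derivative_mult
          [OF Suc.prems[THEN Ck_on_Suc_has_derivative]]], intro Ck_on_add Suc.IH)
       (use Suc.prems Ck_on_Suc_imp[OF Suc.prems(1)] Ck_on_Suc_imp[OF Suc.prems(2)] in auto)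
qed (auto intro: continuous_intros)

lemma Ck_on_sum:
  "(\<And>i. i \<in> I \<Longrightarrow> Ck_on n UNIV (f i)) \<Longrightarrow> Ck_on n UNIV (\<lambda>x. \<Sum>i\<in>I. f i x)"
  by (induction I rule: infinite_finite_induct) (auto intro: Ck_on_add Ck_on_const)

text \<open>Only the partial derivatives along basis vectors are controlled by the definition; the
  chain rule for a linear map needs all directions.\<close>

lemma Ck_on_directional_derivative:
  assumes "Ck_on (Suc n) UNIV f"
  shows "Ck_on n UNIV (\<lambda>x. frechet_derivative f (at x) v)"
proof -
  have "frechet_derivative f (at x) v =
      (\<Sum>j\<in>Basis. (v \<bullet> j) * frechet_derivative f (at x) j)" for x
  proof -
    interpret D: linear "frechet_derivative f (at x)"
      using Ck_on_Suc_has_derivative[OF assms] by (rule has_derivative_linear)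
    have "frechet_derivative f (at x) v = frechet_derivative f (at x) (\<Sum>j\<in>Basis. (v \<bullet> j) *\<^sub>R j)"
      by (simp add: euclidean_representation)
    then show ?thesis by (simp only: D.sum D.scale) simp
  qed
  then show ?thesis
    using assms by (auto intro!: Ck_on_sum Ck_on_mult Ck_on_const)
qed

text \<open>Covers the three substitutions that occur: affine changes of variable on the line,
  projections from a product, and slices of a function of two variables.\<close>

lemma Ck_on_compose_affine:
  fixes L :: "'b::euclidean_space \<Rightarrow> 'a::euclidean_space"
  assumes L: "bounded_linear L"
  shows "Ck_on n UNIV f \<Longrightarrow> Ck_on n UNIV (\<lambda>x. f (b + L x))"
proof (induction n arbitrary: f)
  case 0
  then show ?case
    by (auto intro!: continuous_on_compose2[of UNIV f] continuous_intros
        linear_continuous_on[OF L])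
next
  case (Suc n)
  have L': "((\<lambda>x. b + L x) has_derivative L) (at x)" for x
    using bounded_linear.has_derivative[OF L has_derivative_ident]
    by (auto intro!: derivative_eq_intros)
  have "((\<lambda>x. f (b + L x)) has_derivative
      (\<lambda>h. frechet_derivative f (at (b + L x)) (L h))) (at x)" for x
    using has_derivative_compose[OF L' Ck_on_Suc_has_derivative[OF Suc.prems]] .
  then show ?case
    by (rule Ck_on_SucI) (rule Suc.IH[OF Ck_on_directional_derivative[OF Suc.prems]])
qed

lemma smooth_on_mult:
  "smooth_on UNIV f \<Longrightarrow> smooth_on UNIV g \<Longrightarrow> smooth_on UNIV (\<lambda>x. f x * g x)"
  by (simp add: smooth_on_def Ck_on_mult)

lemma smooth_on_compose_affine:
  "bounded_linear L \<Longrightarrow> smooth_on UNIV f \<Longrightarrow> smooth_on UNIV (\<lambda>x. f (b + L x))"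
  by (simp add: smooth_on_def Ck_on_compose_affine)

lemma smooth_on_has_derivative:
  "smooth_on UNIV f \<Longrightarrow> (f has_derivative frechet_derivative f (at x)) (at x)"
  unfolding smooth_on_def by (rule Ck_on_Suc_has_derivative[of 0]) blast

lemma smooth_on_continuous: "smooth_on UNIV f \<Longrightarrow> continuous_on UNIV f"
  unfolding smooth_on_def by (metis Ck_on.simps(1))

lemma smooth_on_partial_continuous:
  assumes "smooth_on UNIV f"
  shows "continuous_on UNIV (\<lambda>x. frechet_derivative f (at x) v)"
  using Ck_on_directional_derivative[of 0 f v] assms unfolding smooth_on_def
  by (metis Ck_on.simps(1))

lemma smooth_on_gradient_continuous:
  assumes "smooth_on UNIV f"
  shows "continuous_on UNIV (gradient f)"
  unfolding gradient_def by (intro continuous_intros smooth_on_partial_continuous assms)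

lemma gradient_eq_derivative:
  fixes f :: "real \<Rightarrow> real"
  assumes "(f has_real_derivative D) (at x)"
  shows "gradient f x = D"
proof -
  have "frechet_derivative f (at x) = (*) D"
    using frechet_derivative_at[of f "(*) D" x] assms by (simp add: has_field_derivative_def)
  then show ?thesis by (simp add: gradient_def)
qed

lemma smooth_on_real_derivative:
  fixes f :: "real \<Rightarrow> real"
  assumes "smooth_on UNIV f"
  shows "(f has_real_derivative gradient f x) (at x)"
proof -
  interpret D: linear "frechet_derivative f (at x)"
    using smooth_on_has_derivative[OF assms] by (rule has_derivative_linear)
  have "frechet_derivative f (at x) = (*) (gradient f x)"
  proof
    fix h
    show "frechet_derivative f (at x) h = gradient f x * h"
      using D.scale[of h 1] by (simp add: gradient_def)
  qed
  then show ?thesis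
    using smooth_on_has_derivative[OF assms, of x] by (simp add: has_field_derivative_def)
qed

lemma smooth_on_primitive:
  fixes f :: "real \<Rightarrow> real"
  assumes "smooth_on UNIV g" and "\<And>x. (f has_real_derivative g x) (at x)"
  shows "smooth_on UNIV f"
  unfolding smooth_on_def
proof
  fix n
  have "Ck_on (Suc n) UNIV f"
  proof (rule Ck_on_SucI)
    show "(f has_derivative (*) (g x)) (at x)" for x
      using assms(2)[of x] by (simp add: has_field_derivative_def)
    show "Ck_on n UNIV (\<lambda>x. g x * i)" if "i \<in> Basis" for i
      using that assms(1) by (simp add: smooth_on_def)
  qed
  then show "Ck_on n UNIV f" by (rule Ck_on_Suc_imp)
qed

text \<open>The classical smooth function that is flat at the origin, together with its derivatives:
  each derivative has the same form with another polynomial.\<close>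

definition flat_exp :: "real poly \<Rightarrow> real \<Rightarrow> real" where
  "flat_exp P x = (if 0 < x then poly P (1 / x) * exp (- (1 / x)) else 0)"

lemma poly_mult_exp_tendsto_0:
  "((\<lambda>z::real. poly P z * exp (- z)) \<longlongrightarrow> 0) at_top"
proof -
  have "((\<lambda>z::real. \<Sum>i\<le>degree P. coeff P i * (z ^ i / exp z)) \<longlongrightarrow> (\<Sum>i\<le>degree P. coeff P i * 0)) at_top"
    by (intro tendsto_intros tendsto_power_div_exp_0)
  moreover have "(\<lambda>z::real. \<Sum>i\<le>degree P. coeff P i * (z ^ i / exp z)) = (\<lambda>z. poly P z * exp (- z))"
    by (auto simp: poly_altdef sum_distrib_right exp_minus inverse_eq_divide
        sum_divide_distrib)
  ultimately show ?thesis by simp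
qed

text \<open>The functions \<open>P(1/x) exp(-1/x)\<close> are closed under differentiation; at the
  origin this holds because the exponential beats every polynomial in \<open>1/x\<close>.\<close>

lemma flat_exp_has_derivative:
  "(flat_exp P has_real_derivative flat_exp ([:0,0,1:] * (P - pderiv P)) x) (at x)"
proof -
  consider "x > 0" | "x < 0" | "x = 0" by linarith
  then show ?thesis
  proof cases
    case 1
    have "((\<lambda>x. poly P (1 / x) * exp (- (1 / x))) has_real_derivative
        flat_exp ([:0,0,1:] * (P - pderiv P)) x) (at x)"
      using 1 by (auto intro!: derivative_eq_intros DERIV_chain'[of "\<lambda>x. 1 / x" _ _ _ "poly P"]
          simp: flat_exp_def field_simps power2_eq_square)
    then show ?thesis
      by (rule has_field_derivative_transform_within_open[where S = "{0<..}"])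
        (use 1 in \<open>auto simp: flat_exp_def\<close>)
  next
    case 2
    have "((\<lambda>x. 0) has_real_derivative flat_exp ([:0,0,1:] * (P - pderiv P)) x) (at x)"
      using 2 by (auto simp: flat_exp_def)
    then show ?thesis
      by (rule has_field_derivative_transform_within_open[where S = "{..<0}"])
        (use 2 in \<open>auto simp: flat_exp_def\<close>)
  next
    case 3
    have "((\<lambda>h. flat_exp P h / h) \<longlongrightarrow> 0) (at_right 0)"
    proof -
      have "((\<lambda>h::real. poly ([:0,1:] * P) (1 / h) * exp (- (1 / h))) \<longlongrightarrow> 0) (at_right 0)"
        using filterlim_compose[OF poly_mult_exp_tendsto_0[of "[:0,1:] * P"]
            filterlim_inverse_at_top_right]
        by (simp add: inverse_eq_divide)
      moreover have "\<forall>\<^sub>F h in at_right 0. poly ([:0,1:] * P) (1 / h) * exp (- (1 / h)) = flat_exp P h / h"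
        by (auto simp: eventually_at_right_field flat_exp_def intro!: exI[of _ 1])
      ultimately show ?thesis by (rule Lim_transform_eventually)
    qed
    moreover have "((\<lambda>h. flat_exp P h / h) \<longlongrightarrow> 0) (at_left 0)"
    proof -
      have "\<forall>\<^sub>F h in at_left 0. 0 = flat_exp P h / h"
        by (auto simp: eventually_at_left_field flat_exp_def intro!: exI[of _ "-1"])
      then show ?thesis by (rule Lim_transform_eventually[OF tendsto_const])
    qed
    ultimately have "((\<lambda>h. flat_exp P h / h) \<longlongrightarrow> 0) (at 0)"
      using filterlim_split_at by blast
    with 3 show ?thesis by (simp add: has_field_derivative_iff flat_exp_def)
  qed
qed

lemma smooth_on_flat_exp: "smooth_on UNIV (flat_exp P)"
proof -
  have "Ck_on n UNIV (flat_exp P)" for n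
  proof (induction n arbitrary: P)
    case 0
    show ?case
      using DERIV_continuous_on[of UNIV "flat_exp P"] flat_exp_has_derivative by auto
  next
    case (Suc n)
    show ?case
      by (rule Ck_on_SucI[OF flat_exp_has_derivative[unfolded has_field_derivative_def]])
        (use Suc.IH in \<open>auto\<close>)
  qed
  then show ?thesis by (simp add: smooth_on_def)
qed

text \<open>Smooth bumps supported in \<open>[\<alpha>,\<beta>]\<close> that increase to the
  indicator function of the open interval as \<open>n\<close> grows.\<close>

definition plateau :: "real \<Rightarrow> real \<Rightarrow> nat \<Rightarrow> real \<Rightarrow> real" where
  "plateau \<alpha> \<beta> n x = flat_exp 1 (real (Suc n) * (x - \<alpha>)) * flat_exp 1 (real (Suc n) * (\<beta> - x))"

lemma flat_exp_1_bounds: "0 \<le> flat_exp 1 x" "flat_exp 1 x \<le> 1"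
  by (auto simp: flat_exp_def)

lemma plateau_bounds: "0 \<le> plateau \<alpha> \<beta> n x" "plateau \<alpha> \<beta> n x \<le> 1"
  unfolding plateau_def using flat_exp_1_bounds by (auto intro!: mult_le_one)

lemma smooth_on_plateau: "smooth_on UNIV (plateau \<alpha> \<beta> n)"
proof -
  have "smooth_on UNIV (\<lambda>x. flat_exp 1 (- (real (Suc n) * \<alpha>) + (\<lambda>x. real (Suc n) * x) x))"
    "smooth_on UNIV (\<lambda>x. flat_exp 1 (real (Suc n) * \<beta> + (\<lambda>x. - (real (Suc n) * x)) x))"
    by (intro smooth_on_compose_affine smooth_on_flat_exp
        bounded_linear_minus bounded_linear_mult_right bounded_linear_ident)+
  from smooth_on_mult[OF this] show ?thesis
    by (simp add: plateau_def[abs_def] algebra_simps)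
qed

lemma flat_exp_eq_0: "x \<le> 0 \<Longrightarrow> flat_exp P x = 0"
  by (simp add: flat_exp_def)

lemma plateau_support: "x \<notin> {\<alpha><..<\<beta>} \<Longrightarrow> plateau \<alpha> \<beta> n x = 0"
  by (auto simp: plateau_def flat_exp_eq_0 mult_nonneg_nonpos not_less)

text \<open>\<open>exp (- 1 / (n x))\<close> is the \<open>n\<close>-th root of \<open>exp (- 1 /
  x)\<close>, hence tends to 1 for every \<open>x > 0\<close>.\<close>

lemma plateau_tendsto: "(\<lambda>n. plateau \<alpha> \<beta> n x) \<longlonglongrightarrow> indicator {\<alpha><..<\<beta>} x"
proof (cases "x \<in> {\<alpha><..<\<beta>}")
  case True
  have lim: "(\<lambda>n. flat_exp 1 (real (Suc n) * t)) \<longlonglongrightarrow> 1" if "t > 0" for t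
  proof -
    have "(\<lambda>n. exp (- (inverse (real (Suc n)) * inverse t))) \<longlonglongrightarrow> exp (- (0 * inverse t))"
      by (intro tendsto_intros LIMSEQ_inverse_real_of_nat)
    moreover have "flat_exp 1 (real (Suc n) * t) = exp (- (inverse (real (Suc n)) * inverse t))" for n
    proof -
      have "0 < real (Suc n) * t" using that by simp
      then show ?thesis by (simp add: flat_exp_def inverse_eq_divide)
    qed
    ultimately show ?thesis by simp
  qed
  show ?thesis
    using tendsto_mult[OF lim[of "x - \<alpha>"] lim[of "\<beta> - x"]] True by (simp add: plateau_def)
qed (simp add: plateau_support)

lemma test_functionI_real:
  fixes \<psi> :: "real \<Rightarrow> real"
  assumes "smooth_on UNIV \<psi>" and "0 < \<alpha>" "\<beta> < H" and "\<And>x. x \<notin> {\<alpha>..\<beta>} \<Longrightarrow> \<psi> x = 0"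
  shows "test_function {0<..<H} \<psi>"
proof -
  have "closure {x. \<psi> x \<noteq> 0} \<subseteq> {\<alpha>..\<beta>}"
    by (rule closure_minimal[OF _ closed_atLeastAtMost]) (use assms(4) in blast)
  moreover from this have "compact (closure {x. \<psi> x \<noteq> 0})"
    by (meson bounded_closed_interval bounded_subset compact_eq_bounded_closed closed_closure)
  ultimately show ?thesis
    using assms by (force simp: test_function_def)
qed

section \<open>Borel representatives and test functions\<close>

text \<open>Lebesgue measure on a product is only the completion of the product measure, so Fubini's
  theorem does not apply to Lebesgue measurable functions as they stand. Every function is therefore
  replaced by a Borel function, extended by 0 off the set.\<close>

lemma borel_representative:
  fixes f :: "'a::euclidean_space \<Rightarrow> 'b::euclidean_space"
  assumes "f \<in> borel_measurable (lebesgue_on A)" and A: "A \<in> sets lebesgue"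
  obtains F where "F \<in> borel_measurable borel" "AE x in lborel. F x = indicator A x *\<^sub>R f x"
proof -
  have f: "(\<lambda>x. indicator A x *\<^sub>R f x) \<in> borel_measurable lebesgue"
    using assms by (simp add: borel_measurable_restrict_space_iff)
  have "\<exists>F. F \<in> borel_measurable lborel \<and> (AE x in lborel. (indicator A x *\<^sub>R f x) \<bullet> i = F x)" for i
  proof -
    have "(\<lambda>x. (indicator A x *\<^sub>R f x) \<bullet> i) \<in> borel_measurable lebesgue"
      using f by (rule borel_measurable_inner) simp
    from completion_ex_borel_measurable_real[OF this] show ?thesis by blast
  qed
  then obtain F where F: "\<And>i. F i \<in> borel_measurable lborel"
    "\<And>i. AE x in lborel. (indicator A x *\<^sub>R f x) \<bullet> i = F i x"
    by metis
  have "AE x in lborel. \<forall>i\<in>Basis. (indicator A x *\<^sub>R f x) \<bullet> i = F i x"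
    by (subst AE_ball_countable) (use F in \<open>auto simp: countable_finite\<close>)
  then have "AE x in lborel. (\<Sum>i\<in>Basis. F i x *\<^sub>R i) = indicator A x *\<^sub>R f x"
  proof eventually_elim
    case (elim x)
    then have "(\<Sum>i\<in>Basis. F i x *\<^sub>R i) = (\<Sum>i\<in>Basis. ((indicator A x *\<^sub>R f x) \<bullet> i) *\<^sub>R i)"
      by (intro sum.cong) auto
    then show ?case by (simp only: euclidean_representation)
  qed
  moreover have "(\<lambda>x. \<Sum>i\<in>Basis. F i x *\<^sub>R i) \<in> borel_measurable borel"
    using F(1) by measurable
  ultimately show thesis using that by blast
qed

lemma
  fixes f :: "'a::euclidean_space \<Rightarrow> 'b::euclidean_space"
  assumes F: "F \<in> borel_measurable borel" "AE x in lborel. F x = indicator A x *\<^sub>R f x"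
    and A: "A \<in> sets lebesgue"
  shows representative_measurable: "f \<in> borel_measurable (lebesgue_on A)"
    and representative_integrable: "integrable (lebesgue_on A) f \<longleftrightarrow> integrable lborel F"
    and representative_integral: "(LINT x|lebesgue_on A. f x) = (LINT x|lborel. F x)"
proof -
  have AE: "AE x in lebesgue. F x = indicator A x *\<^sub>R f x"
    using F(2) by (rule AE_completion)
  have F': "F \<in> borel_measurable lebesgue"
    using F(1) by (simp add: measurable_completion)
  have f': "(\<lambda>x. indicator A x *\<^sub>R f x) \<in> borel_measurable lebesgue"
    using F' AE by (rule borel_measurable_AE)
  then show "f \<in> borel_measurable (lebesgue_on A)"
    using A by (simp add: borel_measurable_restrict_space_iff)
  have "integrable (lebesgue_on A) f \<longleftrightarrow> integrable lebesgue (\<lambda>x. indicator A x *\<^sub>R f x)"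
    using A by (simp add: integrable_restrict_space)
  also have "\<dots> \<longleftrightarrow> integrable lebesgue F"
    using AE by (intro integrable_cong_AE f' F') (auto simp: eq_commute)
  also have "\<dots> \<longleftrightarrow> integrable lborel F"
    using F(1) by (intro integrable_completion) simp
  finally show "integrable (lebesgue_on A) f \<longleftrightarrow> integrable lborel F" .
  have "(LINT x|lebesgue_on A. f x) = (LINT x|lebesgue. indicator A x *\<^sub>R f x)"
    using A by (simp add: integral_restrict_space)
  also have "\<dots> = (LINT x|lebesgue. F x)"
    using AE by (intro integral_cong_AE f' F') (auto simp: eq_commute)
  also have "\<dots> = (LINT x|lborel. F x)"
    using F(1) by (intro integral_completion) simp
  finally show "(LINT x|lebesgue_on A. f x) = (LINT x|lborel. F x)" .
qed

text \<open>The Borel sets over which the integral vanishes form a Dynkin system that contains the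
  open intervals.\<close>

lemma integrable_lborel_eq_0_AE:
  fixes f :: "real \<Rightarrow> real"
  assumes f: "integrable lborel f"
    and zero: "\<And>a b. a < b \<Longrightarrow> (LBINT x:{a<..<b}. f x) = 0"
  shows "AE x in lborel. f x = 0"
proof (rule density_unique_real[OF f integrable_zero])
  fix A :: "real set"
  let ?G = "range (\<lambda>(a, b). {a<..<b :: real})"
  have sf: "set_integrable lborel B f" if "B \<in> sets borel" for B
    using that f unfolding set_integrable_def by (intro integrable_mult_indicator) auto
  have all: "(LBINT x:UNIV. f x) = 0"
  proof -
    have "(\<lambda>n. LBINT x:{- real (Suc n)<..<real (Suc n)}. f x) \<longlonglongrightarrow> (LBINT x:UNIV. f x)"
      unfolding set_lebesgue_integral_def
    proof (rule integral_dominated_convergence[where w = "\<lambda>x. norm (f x)"])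
      show "AE x in lborel. (\<lambda>n. indicator {- real (Suc n)<..<real (Suc n)} x *\<^sub>R f x)
          \<longlonglongrightarrow> indicator UNIV x *\<^sub>R f x"
      proof (rule AE_I2)
        fix x
        obtain N where "\<bar>x\<bar> < real N" using reals_Archimedean2 by blast
        then have "\<forall>n\<ge>N. indicator {- real (Suc n)<..<real (Suc n)} x *\<^sub>R f x
            = indicator UNIV x *\<^sub>R f x"
          by (auto simp: indicator_def)
        then show "(\<lambda>n. indicator {- real (Suc n)<..<real (Suc n)} x *\<^sub>R f x)
          \<longlonglongrightarrow> indicator UNIV x *\<^sub>R f x"
          by (intro tendsto_eventually) (auto simp: eventually_sequentially)
      qed
    qed (use f in \<open>auto simp: indicator_def\<close>)
    moreover have "(LBINT x:{- real (Suc n)<..<real (Suc n)}. f x) = 0" for n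
      by (rule zero) simp
    ultimately show ?thesis
      by (simp add: LIMSEQ_const_iff)
  qed
  have borel: "borel = sigma UNIV ?G"
    using borel_eq_box[where 'a = real] by (simp add: box_real)
  have "Int_stable ?G"
  proof (rule Int_stableI_image)
    fix p q :: "real \<times> real"
    show "\<exists>r\<in>UNIV. (case p of (a, b) \<Rightarrow> {a<..<b}) \<inter> (case q of (a, b) \<Rightarrow> {a<..<b}) =
        (case r of (a, b) \<Rightarrow> {a<..<b})"
      by (rule bexI[of _ "(max (fst p) (fst q), min (snd p) (snd q))"]) (auto split: prod.splits)
  qed
  moreover have "?G \<subseteq> Pow UNIV" by simp
  moreover assume "A \<in> sets lborel"
  then have "A \<in> sigma_sets UNIV ?G"
    by (simp add: borel)
  ultimately have "(LBINT x:A. f x) = 0"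
  proof (induction rule: sigma_sets_induct_disjoint)
    case (basic A)
    then obtain a b where "A = {a<..<b}" by auto
    then show ?case
      using zero[of a b] by (cases "a < b") (simp_all add: set_lebesgue_integral_def)
  next
    case empty
    then show ?case by (simp add: set_lebesgue_integral_def)
  next
    case (compl A)
    then have A: "A \<in> sets borel" by (simp add: borel)
    have "(LBINT x:A \<union> (UNIV - A). f x) = (LBINT x:A. f x) + (LBINT x:UNIV - A. f x)"
      using A by (intro set_integral_Un sf) auto
    with all compl show ?case by simp
  next
    case (union A)
    then have A: "A i \<in> sets borel" for i by (auto simp: borel)
    have "(LBINT x:(\<Union>i. A i). f x) = (\<Sum>i. LBINT x:A i. f x)"
      using union(1) A by (intro lebesgue_integral_countable_add sf) (auto simp: disjoint_family_on_def)
    with union show ?case by simp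
  qed
  then show "(LBINT x:A. f x) = (LBINT x:A. 0)" by simp
qed

lemma test_function_smooth: "test_function U \<psi> \<Longrightarrow> smooth_on UNIV \<psi>"
  by (simp add: test_function_def)

lemma gradient_eq_0_outside:
  assumes "x \<notin> closure {x. \<psi> x \<noteq> 0}"
  shows "gradient \<psi> x = 0"
proof -
  have "(\<psi> has_derivative (\<lambda>_. 0)) (at x)"
    by (rule has_derivative_transform_within_open[of "\<lambda>_. 0" _ _ _ "- closure {x. \<psi> x \<noteq> 0}"])
      (use assms closure_subset[of "{x. \<psi> x \<noteq> 0}"] in auto)
  then have "frechet_derivative \<psi> (at x) = (\<lambda>_. 0)"
    by (rule frechet_derivative_at[symmetric])
  then show ?thesis
    by (simp add: gradient_def)
qed

lemma bounded_if_compact_support: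
  fixes f :: "'a::metric_space \<Rightarrow> 'b::real_normed_vector"
  assumes "continuous_on UNIV f" "compact K" "\<And>x. x \<notin> K \<Longrightarrow> f x = 0"
  obtains C where "0 \<le> C" "\<And>x. norm (f x) \<le> C"
proof -
  have "compact (f ` K)"
    using assms by (intro compact_continuous_image) (auto intro: continuous_on_subset)
  then obtain C where C: "C > 0" "\<And>x. x \<in> K \<Longrightarrow> norm (f x) \<le> C"
    by (auto dest!: compact_imp_bounded simp: bounded_pos)
  have "norm (f x) \<le> C" for x
    by (cases "x \<in> K") (use C assms(3) in auto)
  with C(1) show thesis by (intro that[of C]) auto
qed

lemma test_function_bounded:
  assumes "test_function U \<psi>"
  obtains C where "0 \<le> C" "\<And>x. norm (\<psi> x) \<le> C"
proof (rule bounded_if_compact_support)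
  show "continuous_on UNIV \<psi>" "compact (closure {x. \<psi> x \<noteq> 0})"
    using assms by (simp_all add: test_function_def smooth_on_continuous)
  show "\<psi> x = 0" if "x \<notin> closure {x. \<psi> x \<noteq> 0}" for x
    using that closure_subset[of "{x. \<psi> x \<noteq> 0}"] by blast
qed (rule that)

lemma test_function_gradient_bounded:
  assumes "test_function U \<psi>"
  obtains C where "0 \<le> C" "\<And>x. norm (gradient \<psi> x) \<le> C"
proof (rule bounded_if_compact_support)
  show "continuous_on UNIV (gradient \<psi>)" "compact (closure {x. \<psi> x \<noteq> 0})"
    using assms by (simp_all add: test_function_def smooth_on_gradient_continuous)
qed (rule gradient_eq_0_outside, assumption, rule that)

lemma L2_integrable:
  fixes f :: "'a::euclidean_space \<Rightarrow> 'b::euclidean_space"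
  assumes "L2 U f" "U \<in> lmeasurable"
  shows "integrable (lebesgue_on U) f"
proof -
  interpret finite_measure "lebesgue_on U"
    using assms(2) by (rule finite_measure_lebesgue_on)
  show ?thesis
  proof (rule Bochner_Integration.integrable_bound[where f = "\<lambda>x. 1 + (norm (f x))\<^sup>2"])
    show "AE x in lebesgue_on U. norm (f x) \<le> norm (1 + (norm (f x))\<^sup>2)"
    proof (rule AE_I2)
      fix x
      have "0 \<le> (norm (f x) - 1)\<^sup>2" by simp
      then show "norm (f x) \<le> norm (1 + (norm (f x))\<^sup>2)"
        by (simp add: power2_diff) (smt (verit) norm_ge_zero zero_le_power2)
    qed
  qed (use assms in \<open>auto simp: L2_def\<close>)
qed

lemma integrable_times_bounded_continuous:
  fixes f \<psi> :: "'a::euclidean_space \<Rightarrow> real"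
  assumes "integrable (lebesgue_on U) f" "continuous_on UNIV \<psi>" "\<And>x. norm (\<psi> x) \<le> C"
  shows "integrable (lebesgue_on U) (\<lambda>x. f x * \<psi> x)"
proof (rule Bochner_Integration.integrable_bound[where f = "\<lambda>x. C * f x"])
  have "\<psi> \<in> borel_measurable (lebesgue_on U)"
    using borel_measurable_continuous_onI[OF assms(2)]
    by (intro measurable_restrict_space1) (simp add: measurable_completion)
  with assms(1) show "(\<lambda>x. f x * \<psi> x) \<in> borel_measurable (lebesgue_on U)" by auto
  have "0 \<le> C" using assms(3) norm_ge_zero order_trans by blast
  then show "AE x in lebesgue_on U. norm (f x * \<psi> x) \<le> norm (C * f x)"
    using assms(3) by (auto simp: abs_mult intro!: AE_I2 mult_right_mono
        simp: mult.commute[of "\<bar>f _\<bar>"])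
qed (use assms(1) in simp)

section \<open>Absolute continuity of Sobolev functions on an interval\<close>

lemma test_function_plateau:
  "0 < \<alpha> \<Longrightarrow> \<beta> < H \<Longrightarrow> test_function {0<..<H} (plateau \<alpha> \<beta> n)"
  by (rule test_functionI_real[where \<alpha> = \<alpha> and \<beta> = \<beta>, OF smooth_on_plateau])
    (auto intro: plateau_support)

text \<open>Plateau functions approximate the indicator functions of the intervals compactly
  contained in \<open>(0,H)\<close>, so the integral of \<open>g\<close> over each of these
  vanishes.\<close>

lemma fundamental_lemma_interval:
  fixes g :: "real \<Rightarrow> real"
  assumes g: "integrable (lebesgue_on {0<..<H}) g"
    and zero: "\<And>\<psi>. test_function {0<..<H} \<psi> \<Longrightarrow> (LINT y|lebesgue_on {0<..<H}. g y * \<psi> y) = 0"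
  shows "AE y in lebesgue_on {0<..<H}. g y = 0"
proof -
  let ?M = "lebesgue_on {0<..<H}"
  have [measurable]: "g \<in> borel_measurable ?M" using g by auto
  have S: "{0<..<H} \<in> sets lebesgue" by simp
  obtain G where G: "G \<in> borel_measurable borel" "AE y in lborel. G y = indicator {0<..<H} y *\<^sub>R g y"
    by (rule borel_representative[OF borel_measurable_integrable[OF g] S])
  have Gi: "integrable lborel G"
    by (rule representative_integrable[OF G, THEN iffD1, OF S g])
  have inner: "(LINT y|?M. indicator {\<alpha><..<\<beta>} y * g y) = 0" if "0 < \<alpha>" "\<beta> < H" for \<alpha> \<beta>
  proof -
    have "(\<lambda>n. LINT y|?M. g y * plateau \<alpha> \<beta> n y) \<longlonglongrightarrow> (LINT y|?M. indicator {\<alpha><..<\<beta>} y * g y)"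
    proof (rule integral_dominated_convergence[where w = "\<lambda>y. norm (g y)"])
      have "plateau \<alpha> \<beta> n \<in> borel_measurable ?M" for n
        using borel_measurable_continuous_onI[OF smooth_on_continuous[OF smooth_on_plateau]]
        by (intro measurable_restrict_space1) (simp add: measurable_completion)
      then show "(\<lambda>y. g y * plateau \<alpha> \<beta> n y) \<in> borel_measurable ?M" for n by auto
      show "AE y in ?M. (\<lambda>n. g y * plateau \<alpha> \<beta> n y) \<longlonglongrightarrow> indicator {\<alpha><..<\<beta>} y * g y"
        using tendsto_mult_left[OF plateau_tendsto] by (simp add: mult.commute)
      show "AE y in ?M. norm (g y * plateau \<alpha> \<beta> n y) \<le> norm (g y)" for n
        using plateau_bounds by (auto simp: abs_mult intro!: mult_left_le)
      have "indicat_real {\<alpha><..<\<beta>} \<in> borel_measurable ?M"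
        by (intro measurable_restrict_space1) (simp add: measurable_completion)
      then show "(\<lambda>y. indicator {\<alpha><..<\<beta>} y * g y) \<in> borel_measurable ?M" by auto
    qed (use g in auto)
    moreover have "(LINT y|?M. g y * plateau \<alpha> \<beta> n y) = 0" for n
      by (rule zero[OF test_function_plateau[OF that]])
    ultimately show ?thesis by (simp add: LIMSEQ_const_iff)
  qed
  have "AE y in lborel. G y = 0"
  proof (rule integrable_lborel_eq_0_AE[OF Gi])
    fix a b :: real
    \<comment> \<open>intervals that touch 0 or \<open>H\<close> are exhausted by intervals compactly contained in \<open>(0,H)\<close>\<close>
    let ?J = "\<lambda>n. {max a (inverse (real (Suc n)))<..<min b (H - inverse (real (Suc n)))}"
    have "(\<lambda>n. LINT y|lborel. indicator (?J n) y *\<^sub>R G y) \<longlonglongrightarrow> (LINT y|lborel. indicator {a<..<b} y *\<^sub>R G y)"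
    proof (rule integral_dominated_convergence[where w = "\<lambda>y. norm (G y)"])
      show "AE y in lborel. (\<lambda>n. indicator (?J n) y *\<^sub>R G y) \<longlonglongrightarrow> indicator {a<..<b} y *\<^sub>R G y"
        using G(2)
      proof eventually_elim
        case (elim y)
        show ?case
        proof (cases "y \<in> {0<..<H} \<inter> {a<..<b}")
          case True
          then have "0 < min y (H - y)" by auto
          then have "\<forall>\<^sub>F n in sequentially. inverse (real (Suc n)) < min y (H - y)"
            by (rule order_tendstoD(2)[OF LIMSEQ_inverse_real_of_nat])
          then have "\<forall>\<^sub>F n in sequentially. indicator (?J n) y *\<^sub>R G y = indicator {a<..<b} y *\<^sub>R G y"
            by eventually_elim (use True in \<open>auto simp: indicator_def\<close>)
          then show ?thesis by (rule tendsto_eventually)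
        next
          case False
          have pos: "0 < inverse (real (Suc n))" for n by simp
          have "indicator (?J n) y *\<^sub>R G y = indicator {a<..<b} y *\<^sub>R G y" for n
          proof (cases "y \<in> {0<..<H}")
            case True
            with False show ?thesis by (auto simp: indicator_def)
          next
            case False
            with elim show ?thesis by simp
          qed
          then show ?thesis by (intro tendsto_eventually always_eventually allI)
        qed
      qed
    qed (use G(1) Gi in \<open>auto simp: indicator_def\<close>)
    moreover have "(LINT y|lborel. indicator (?J n) y *\<^sub>R G y) = 0" for n
    proof -
      have pos: "0 < inverse (real (Suc n))" by simp
      have "(LINT y|?M. indicator (?J n) y * g y) = (LINT y|lborel. indicator (?J n) y *\<^sub>R G y)"
        using G by (intro representative_integral) auto
      then show ?thesis
        using inner[of "max a (inverse (real (Suc n)))" "min b (H - inverse (real (Suc n)))"] pos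
        by (auto simp: min_less_iff_disj less_max_iff_disj)
    qed
    ultimately show "(LBINT x:{a<..<b}. G x) = 0"
      by (simp add: set_lebesgue_integral_def LIMSEQ_const_iff)
  qed
  with G(2) have "AE y in lborel. y \<in> {0<..<H} \<longrightarrow> g y = 0"
    by eventually_elim auto
  then show ?thesis
    by (simp add: AE_restrict_space_iff AE_completion)
qed

lemma Lebesgue_integral_continuous_interval:
  fixes f :: "real \<Rightarrow> real"
  assumes "continuous_on {a..b} f"
  shows "(LINT y|lebesgue_on {a<..<b}. f y) = integral {a..b} f"
    and "integrable (lebesgue_on {a<..<b}) f"
proof -
  have "f absolutely_integrable_on {a<..<b}"
    using absolutely_integrable_continuous_real[OF assms] by (simp add: absolutely_integrable_on_Icc_iff_Ioo)
  then show i: "integrable (lebesgue_on {a<..<b}) f"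
    by (rule absolutely_integrable_imp_integrable) simp
  then show "(LINT y|lebesgue_on {a<..<b}. f y) = integral {a..b} f"
    by (simp add: lebesgue_integral_eq_integral integral_open_interval_real)
qed

lemma integrable_interval_HK:
  fixes g :: "real \<Rightarrow> real"
  assumes "integrable (lebesgue_on {0<..<H}) g"
  shows "g absolutely_integrable_on {0..H}"
proof -
  have "g absolutely_integrable_on {0<..<H}"
    using assms integrable_restrict_space[of "{0<..<H}" lebesgue g] by (simp add: set_integrable_def)
  then show ?thesis by (simp only: absolutely_integrable_on_Icc_iff_Ioo)
qed

text \<open>The primitive of \<open>g\<close> is differentiable only almost everywhere, so the
  identity is read off from Fubini's theorem for \<open>g(y) \<psi>'(t)\<close> on the triangle
  \<open>t < y\<close>.\<close>

lemma integral_by_parts_test_function: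
  fixes g :: "real \<Rightarrow> real"
  assumes g: "integrable (lebesgue_on {0<..<H}) g" and \<psi>: "test_function {0<..<H} \<psi>" and "0 < H"
  shows "(LINT y|lebesgue_on {0<..<H}. g y * \<psi> y)
    = - (LINT y|lebesgue_on {0<..<H}. integral {0..y} g * gradient \<psi> y)"
proof -
  let ?M = "lebesgue_on {0<..<H}"
  have S: "{0<..<H} \<in> sets lebesgue" by simp
  obtain G where G: "G \<in> borel_measurable borel" "AE y in lborel. G y = indicator {0<..<H} y *\<^sub>R g y"
    by (rule borel_representative[OF borel_measurable_integrable[OF g] S])
  have Gi: "integrable lborel G"
    by (rule representative_integrable[OF G, THEN iffD1, OF S g])
  define D where "D = gradient \<psi>"
  have sm: "smooth_on UNIV \<psi>" using \<psi> by (rule test_function_smooth)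
  have Dcont: "continuous_on UNIV D" unfolding D_def by (rule smooth_on_gradient_continuous[OF sm])
  have deriv: "(\<psi> has_real_derivative D y) (at y)" for y
    unfolding D_def by (rule smooth_on_real_derivative[OF sm])
  have D0: "D y = 0" if "y \<notin> {0<..<H}" for y
    using \<psi> that gradient_eq_0_outside[of y \<psi>] unfolding D_def test_function_def by blast
  have \<psi>0: "\<psi> y = 0" if "y \<notin> {0<..<H}" for y
    using \<psi> that closure_subset[of "{x. \<psi> x \<noteq> 0}"] unfolding test_function_def by blast
  have [measurable]: "D \<in> borel_measurable borel" "G \<in> borel_measurable borel"
    using Dcont G(1) by (auto intro: borel_measurable_continuous_onI)
  have D: "integrable lborel D"
  proof -
    have "integrable ?M D"
      using continuous_on_subset[OF Dcont] by (intro Lebesgue_integral_continuous_interval) auto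
    moreover have "AE y in lborel. D y = indicator {0<..<H} y *\<^sub>R D y"
    proof (rule AE_I2)
      show "D y = indicator {0<..<H} y *\<^sub>R D y" for y
        using D0[of y] by (cases "y \<in> {0<..<H}") auto
    qed
    ultimately show ?thesis
      using representative_integrable[of D "{0<..<H}" D] S \<open>D \<in> borel_measurable borel\<close> by blast
  qed
  let ?\<Gamma> = "\<lambda>t. integral {0..t} g"
  have gi: "g integrable_on {0..H}"
    using integrable_interval_HK[OF g] absolutely_integrable_on_def by blast
  have FTC: "integral {0..y} D = \<psi> y" if "0 \<le> y" for y
    using fundamental_theorem_of_calculus[OF that, of \<psi> D] deriv \<psi>0[of 0]
    by (auto intro!: integral_unique
        simp: has_real_derivative_iff_has_vector_derivative has_vector_derivative_at_within)
  let ?K = "\<lambda>y t. G y * (if t < y then D t else 0)"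
  have K: "integrable (lborel \<Otimes>\<^sub>M lborel) (case_prod ?K)"
  proof (rule Bochner_Integration.integrable_bound[where f = "\<lambda>(y, t). G y * D t"])
    show "integrable (lborel \<Otimes>\<^sub>M lborel) (\<lambda>(y, t). G y * D t)"
      using Gi D by (intro lborel_pair.Fubini_integrable) (auto simp: abs_mult)
    show "case_prod ?K \<in> borel_measurable (lborel \<Otimes>\<^sub>M lborel)" by measurable
  qed auto
  have "(LINT y|?M. g y * \<psi> y) = (LINT y|lborel. LINT t|lborel. ?K y t)"
  proof (rule representative_integral)
    show "(\<lambda>y. LINT t|lborel. ?K y t) \<in> borel_measurable borel" by measurable
    have "(LINT t|lborel. (if t < y then D t else 0)) = \<psi> y" if "y \<in> {0<..<H}" for y
    proof -
      have "(LINT t|lebesgue_on {0<..<y}. D t) = (LINT t|lborel. (if t < y then D t else 0))"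
        using D0 by (intro representative_integral) (auto simp: indicator_def)
      then show ?thesis
        using that FTC[of y] Lebesgue_integral_continuous_interval(1)[of 0 y D]
          continuous_on_subset[OF Dcont] by auto
    qed
    then show "AE y in lborel. (LINT t|lborel. ?K y t) = indicator {0<..<H} y *\<^sub>R (g y * \<psi> y)"
      using G(2) by (auto simp: indicator_def elim!: eventually_mono)
  qed simp
  also have "\<dots> = (LINT t|lborel. LINT y|lborel. ?K y t)"
    by (rule lborel_pair.Fubini_integral[OF K, symmetric])
  also have "\<dots> = (LINT t|?M. (integral {0..H} g - ?\<Gamma> t) * D t)"
  proof (rule representative_integral[symmetric])
    show "(\<lambda>t. LINT y|lborel. ?K y t) \<in> borel_measurable borel" by measurable
    have "(LINT y|lborel. ?K y t) = (integral {0..H} g - ?\<Gamma> t) * D t" if t: "t \<in> {0<..<H}" for t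
    proof -
      let ?F = "\<lambda>y. if t < y then G y else 0"
      have F: "?F \<in> borel_measurable borel" "AE y in lborel. ?F y = indicator {t<..<H} y *\<^sub>R g y"
        using G(2) t by (auto simp: indicator_def elim!: eventually_mono)
      have "integrable lborel ?F"
        by (rule Bochner_Integration.integrable_bound[OF Gi]) auto
      then have "integrable (lebesgue_on {t<..<H}) g"
        using representative_integrable[OF F] by simp
      then have "(LINT y|lborel. ?F y) = integral {t..H} g"
        using representative_integral[OF F]
        by (simp add: lebesgue_integral_eq_integral integral_open_interval_real)
      also have "\<dots> = integral {0..H} g - ?\<Gamma> t"
        using Henstock_Kurzweil_Integration.integral_combine[of 0 t H g] gi t by auto
      moreover have "(LINT y|lborel. ?K y t) = (LINT y|lborel. ?F y * D t)"
        by (intro Bochner_Integration.integral_cong) auto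
      ultimately show ?thesis by simp
    qed
    moreover have "(LINT y|lborel. ?K y t) = 0" if "t \<notin> {0<..<H}" for t
      using D0[OF that] by (simp cong: if_cong)
    ultimately show "AE t in lborel. (LINT y|lborel. ?K y t) =
        indicator {0<..<H} t *\<^sub>R ((integral {0..H} g - ?\<Gamma> t) * D t)"
      by (intro AE_I2) (simp add: indicator_def)
  qed simp
  also have "\<dots> = (LINT t|?M. integral {0..H} g * D t - ?\<Gamma> t * D t)"
    by (simp add: algebra_simps)
  also have "\<dots> = (LINT t|?M. integral {0..H} g * D t) - (LINT t|?M. ?\<Gamma> t * D t)"
    using gi continuous_on_subset[OF Dcont]
    by (intro Bochner_Integration.integral_diff Lebesgue_integral_continuous_interval
        continuous_intros indefinite_integral_continuous_1) auto
  also have "(LINT t|?M. integral {0..H} g * D t) = 0"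
    using Lebesgue_integral_continuous_interval(1)[of 0 H D] continuous_on_subset[OF Dcont]
      FTC[of H] \<psi>0[of H] \<open>0 < H\<close> by simp
  finally show ?thesis by (simp add: D_def)
qed

text \<open>The primitive that vanishes at 0 also vanishes near \<open>H\<close>, because the total
  integral is 0.\<close>

lemma exists_test_primitive:
  assumes m: "test_function {0<..<H} m" and "0 < H" and zero: "(LINT y|lebesgue_on {0<..<H}. m y) = 0"
  obtains \<psi> where "test_function {0<..<H} \<psi>" "gradient \<psi> = m"
proof -
  let ?K = "closure {x. m x \<noteq> 0}"
  have sm: "smooth_on UNIV m" using m by (rule test_function_smooth)
  then have cont: "continuous_on UNIV m" by (rule smooth_on_continuous)
  then obtain F where F: "\<And>x. (F has_vector_derivative m x) (at x)"
    using einterval_antiderivative[of "-\<infinity>" "\<infinity>" m] by (auto simp: continuous_on_eq_continuous_at)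
  define \<psi> where "\<psi> x = F x - F 0" for x
  have deriv: "(\<psi> has_real_derivative m x) (at x)" for x
    unfolding \<psi>_def has_real_derivative_iff_has_vector_derivative
    using has_vector_derivative_diff[OF F has_vector_derivative_const] by simp
  have "compact ?K" "?K \<subseteq> {0<..<H}" using m by (auto simp: test_function_def)
  obtain \<alpha> \<beta> where ab: "0 < \<alpha>" "\<alpha> \<le> \<beta>" "\<beta> < H" "?K \<subseteq> {\<alpha>..\<beta>}"
  proof (cases "?K = {}")
    case True
    with \<open>0 < H\<close> show thesis by (intro that[of "H/2" "H/2"]) auto
  next
    case False
    then obtain a b where "a \<in> ?K" "b \<in> ?K" "\<And>x. x \<in> ?K \<Longrightarrow> a \<le> x \<and> x \<le> b"
      using compact_attains_inf[OF \<open>compact ?K\<close>] compact_attains_sup[OF \<open>compact ?K\<close>] by metis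
    with \<open>?K \<subseteq> {0<..<H}\<close> show thesis by (intro that[of a b]) (auto simp: subset_iff)
  qed
  have m0: "m x = 0" if "x \<notin> {\<alpha>..\<beta>}" for x
    using that ab(4) closure_subset[of "{x. m x \<noteq> 0}"] by blast
  have const: "\<psi> x = \<psi> y" if "x \<le> y" "\<And>z. z \<in> {x<..<y} \<Longrightarrow> m z = 0" for x y
  proof (cases "x < y")
    case True
    have "continuous_on {x..y} \<psi>"
      using deriv by (meson DERIV_isCont continuous_at_imp_continuous_on)
    moreover have "(\<psi> has_real_derivative 0) (at z)" if "x < z" "z < y" for z
      using deriv[of z] \<open>\<And>z. z \<in> {x<..<y} \<Longrightarrow> m z = 0\<close> that by simp
    ultimately show ?thesis
      using DERIV_isconst_end[OF True] by metis
  qed (use that in auto)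
  have "integral {0..H} m = \<psi> H"
    using fundamental_theorem_of_calculus[of 0 H \<psi> m] deriv \<open>0 < H\<close>
    by (auto intro!: integral_unique simp: \<psi>_def
        has_real_derivative_iff_has_vector_derivative has_vector_derivative_at_within)
  then have \<psi>H: "\<psi> H = 0"
    using zero Lebesgue_integral_continuous_interval(1)[of 0 H m] continuous_on_subset[OF cont] by auto
  have "\<psi> x = 0" if "x \<notin> {\<alpha>..\<beta>}" for x
  proof -
    have \<psi>0: "\<psi> 0 = 0" by (simp add: \<psi>_def)
    from that consider "x < \<alpha>" "x \<le> 0" | "x < \<alpha>" "0 \<le> x" | "x > \<beta>" "x \<le> H" | "x > \<beta>" "H \<le> x"
      by fastforce
    then show ?thesis
      by cases (use const[of x 0] const[of 0 x] const[of x H] const[of H x] m0 ab \<psi>0 \<psi>H in auto)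
  qed
  then have "test_function {0<..<H} \<psi>"
    using ab(1,3) by (intro test_functionI_real[of \<psi> \<alpha> \<beta>] smooth_on_primitive[OF sm deriv]) auto
  moreover have "gradient \<psi> = m"
    using gradient_eq_derivative[OF deriv] by auto
  ultimately show thesis by (rule that)
qed

lemma test_function_lincomb:
  assumes "test_function U f" "test_function U g"
  shows "test_function U (\<lambda>x. f x + c * g x)"
proof -
  have sub: "closure {x. f x + c * g x \<noteq> 0} \<subseteq> closure {x. f x \<noteq> 0} \<union> closure {x. g x \<noteq> 0}"
    unfolding closure_Un[symmetric] by (rule closure_mono) auto
  have "compact (closure {x. f x \<noteq> 0} \<union> closure {x. g x \<noteq> 0})"
    using assms by (auto simp: test_function_def)
  then have "compact (closure {x. f x + c * g x \<noteq> 0})"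
    using sub by (meson bounded_subset closed_closure compact_eq_bounded_closed)
  with assms sub show ?thesis
    by (auto simp: test_function_def smooth_on_def intro!: Ck_on_add Ck_on_mult Ck_on_const)
qed

text \<open>Subtracting from a test function \<open>\<eta>\<close> a multiple of a fixed plateau
  \<open>\<rho>\<close> gives integral 0, hence the derivative of a test function. Thus
  \<open>h\<close> minus its \<open>\<rho>\<close>-average is orthogonal to every
  \<open>\<eta>\<close>.\<close>

lemma weak_derivative_0_imp_const:
  fixes h :: "real \<Rightarrow> real"
  assumes h: "integrable (lebesgue_on {0<..<H}) h" and "0 < H"
    and zero: "\<And>\<psi>. test_function {0<..<H} \<psi> \<Longrightarrow> (LINT y|lebesgue_on {0<..<H}. h y * gradient \<psi> y) = 0"
  obtains C where "AE y in lebesgue_on {0<..<H}. h y = C"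
proof -
  let ?M = "lebesgue_on {0<..<H}"
  define \<rho> where "\<rho> = plateau (H/3) (2*H/3) 0"
  have \<rho>: "test_function {0<..<H} \<rho>"
    unfolding \<rho>_def using \<open>0 < H\<close> by (intro test_function_plateau) auto
  have tf: "integrable ?M \<eta>" "integrable ?M (\<lambda>y. h y * \<eta> y)"
    if \<eta>: "test_function {0<..<H} \<eta>" for \<eta>
  proof -
    have c: "continuous_on UNIV \<eta>" using \<eta> by (intro smooth_on_continuous test_function_smooth)
    then show "integrable ?M \<eta>"
      by (intro Lebesgue_integral_continuous_interval) (auto intro: continuous_on_subset)
    obtain B where "\<And>x. norm (\<eta> x) \<le> B" using test_function_bounded[OF \<eta>] by blast
    then show "integrable ?M (\<lambda>y. h y * \<eta> y)"
      using h c by (intro integrable_times_bounded_continuous)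
  qed
  define R where "R = (LINT y|?M. \<rho> y)"
  have "R > 0"
  proof -
    have "R \<noteq> 0"
    proof
      assume "R = 0"
      have "\<rho> (H/2) = 0"
      proof (rule has_integral_0_cbox_imp_0[of 0 H \<rho> "H/2"])
        have c: "continuous_on {0..H} \<rho>"
          using \<rho> by (meson continuous_on_subset smooth_on_continuous subset_UNIV test_function_smooth)
        then show "continuous_on (cbox 0 H) \<rho>" by simp
        show "(\<rho> has_integral 0) (cbox 0 H)"
          using \<open>R = 0\<close> Lebesgue_integral_continuous_interval(1)[OF c] integrable_continuous_real[OF c]
          by (simp add: R_def has_integral_iff)
      qed (use \<open>0 < H\<close> plateau_bounds in \<open>auto simp: \<rho>_def\<close>)
      then show False
        using \<open>0 < H\<close> by (auto simp: \<rho>_def plateau_def flat_exp_def)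
    qed
    moreover have "R \<ge> 0"
      unfolding R_def \<rho>_def by (intro integral_nonneg_AE AE_I2 plateau_bounds)
    ultimately show ?thesis by simp
  qed
  define C where "C = (LINT y|?M. h y * \<rho> y) / R"
  have "AE y in ?M. h y - C = 0"
  proof (rule fundamental_lemma_interval)
    show "integrable ?M (\<lambda>y. h y - C)"
      using h Lebesgue_integral_continuous_interval(2)[of 0 H "\<lambda>_. C"] by (auto simp del: integrable_const)
    fix \<eta> assume \<eta>: "test_function {0<..<H} \<eta>"
    define s where "s = (LINT y|?M. \<eta> y)"
    let ?m = "\<lambda>y. \<eta> y + (- (s / R)) * \<rho> y"
    have m: "test_function {0<..<H} ?m" by (rule test_function_lincomb[OF \<eta> \<rho>])
    have "(LINT y|?M. ?m y) = s + (- (s / R)) * R"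
      unfolding s_def R_def using tf(1)[OF \<eta>] tf(1)[OF \<rho>]
      by (subst Bochner_Integration.integral_add) auto
    then have "(LINT y|?M. ?m y) = 0" using \<open>R > 0\<close> by simp
    from exists_test_primitive[OF m \<open>0 < H\<close> this]
    obtain \<psi> where "test_function {0<..<H} \<psi>" "gradient \<psi> = ?m" by blast
    then have "0 = (LINT y|?M. h y * ?m y)" using zero by metis
    also have "\<dots> = (LINT y|?M. h y * \<eta> y + (- (s / R)) * (h y * \<rho> y))"
      by (simp add: algebra_simps)
    also have "\<dots> = (LINT y|?M. h y * \<eta> y) + (- (s / R)) * (LINT y|?M. h y * \<rho> y)"
      using tf(2)[OF \<eta>] tf(2)[OF \<rho>] by (subst Bochner_Integration.integral_add) auto
    also have "\<dots> = (LINT y|?M. h y * \<eta> y) - C * s" by (simp add: C_def)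
    also have "\<dots> = (LINT y|?M. h y * \<eta> y - C * \<eta> y)"
      unfolding s_def using tf[OF \<eta>] by (subst Bochner_Integration.integral_diff) auto
    finally show "(LINT y|?M. (h y - C) * \<eta> y) = 0" by (simp add: algebra_simps)
  qed
  then show thesis by (intro that[of C]) simp
qed

text \<open>The lemma of du Bois-Reymond: the primitive of \<open>g\<close> has weak derivative
  \<open>g\<close> by partial integration, so its difference from \<open>f\<close> has weak
  derivative 0.\<close>

lemma H1_grad_absolutely_continuous:
  fixes f g :: "real \<Rightarrow> real"
  assumes fg: "H1_grad {0<..<H} f g" and "0 < H"
  obtains C where "AE y in lebesgue_on {0<..<H}. f y = C + integral {0..y} g"
proof -
  let ?M = "lebesgue_on {0<..<H}" and ?\<Gamma> = "\<lambda>y. integral {0..y} g"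
  have f: "integrable ?M f" and g: "integrable ?M g"
    using fg by (auto simp: H1_grad_def intro!: L2_integrable)
  have "g integrable_on {0..H}"
    using integrable_interval_HK[OF g] absolutely_integrable_on_def by blast
  then have \<Gamma>: "integrable ?M ?\<Gamma>"
    by (intro Lebesgue_integral_continuous_interval indefinite_integral_continuous_1)
  have "(LINT y|?M. (f y - ?\<Gamma> y) * gradient \<psi> y) = 0" if \<psi>: "test_function {0<..<H} \<psi>" for \<psi>
  proof -
    obtain B where B: "\<And>x. norm (gradient \<psi> x) \<le> B"
      using test_function_gradient_bounded[OF \<psi>] by blast
    have c: "continuous_on UNIV (gradient \<psi>)"
      using \<psi> by (intro smooth_on_gradient_continuous test_function_smooth)
    have "(LINT y|?M. (f y - ?\<Gamma> y) * gradient \<psi> y) =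
        (LINT y|?M. f y * gradient \<psi> y) - (LINT y|?M. ?\<Gamma> y * gradient \<psi> y)"
      unfolding left_diff_distrib
      by (intro Bochner_Integration.integral_diff integrable_times_bounded_continuous[OF _ c B] f \<Gamma>)
    also have "(LINT y|?M. f y * gradient \<psi> y) = - (LINT y|?M. g y * \<psi> y)"
      using fg \<psi> by (simp add: H1_grad_def mult.commute)
    finally show ?thesis
      using integral_by_parts_test_function[OF g \<psi> \<open>0 < H\<close>] by simp
  qed
  then obtain C where "AE y in ?M. f y - ?\<Gamma> y = C"
    using weak_derivative_0_imp_const[of H "\<lambda>y. f y - ?\<Gamma> y"] f \<Gamma> \<open>0 < H\<close> by auto
  then show thesis by (intro that[of C]) (auto elim!: eventually_mono)
qed

lemma weak_derivative_unique:
  fixes f g :: "real \<Rightarrow> real"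
  assumes "H1_grad {0<..<H} f g" "H1_grad {0<..<H} f g'"
  shows "AE y in lebesgue_on {0<..<H}. g y = g' y"
proof -
  let ?M = "lebesgue_on {0<..<H}"
  have g: "integrable ?M g" "integrable ?M g'"
    using assms by (auto simp: H1_grad_def intro!: L2_integrable)
  have "AE y in ?M. g y - g' y = 0"
  proof (rule fundamental_lemma_interval)
    fix \<psi> assume \<psi>: "test_function {0<..<H} \<psi>"
    obtain B where B: "\<And>x. norm (\<psi> x) \<le> B"
      using test_function_bounded[OF \<psi>] by blast
    have c: "continuous_on UNIV \<psi>"
      using \<psi> by (intro smooth_on_continuous test_function_smooth)
    have "(LINT y|?M. (g y - g' y) * \<psi> y) = (LINT y|?M. g y * \<psi> y) - (LINT y|?M. g' y * \<psi> y)"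
      unfolding left_diff_distrib
      by (intro Bochner_Integration.integral_diff integrable_times_bounded_continuous[OF _ c B] g)
    also have "\<dots> = 0"
      using assms \<psi> by (simp add: H1_grad_def mult.commute)
    finally show "(LINT y|?M. (g y - g' y) * \<psi> y) = 0" .
  qed (use g in simp)
  then show ?thesis by simp
qed

lemma continuous_AE_eq:
  fixes f g :: "real \<Rightarrow> real"
  assumes f: "continuous_on {0..H} f" and g: "continuous_on {0..H} g" and "0 < H"
    and AE: "AE y in lebesgue_on {0<..<H}. f y = g y" and y: "y \<in> {0..H}"
  shows "f y = g y"
proof -
  let ?h = "\<lambda>y. \<bar>f y - g y\<bar>"
  have c: "continuous_on {0..H} ?h" using f g by (intro continuous_intros)
  have "(LINT y|lebesgue_on {0<..<H}. ?h y) = 0"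
    using AE by (intro integral_eq_zero_AE) auto
  then have "(?h has_integral 0) {0..H}"
    using Lebesgue_integral_continuous_interval(1)[OF c] integrable_continuous_real[OF c]
    by (simp add: has_integral_iff)
  then have "?h y = 0"
    using has_integral_0_cbox_imp_0[of 0 H ?h y] c y \<open>0 < H\<close> by auto
  then show ?thesis by simp
qed

section \<open>Mass of an oscillating solution\<close>

text \<open>A form of \<open>u' \<ge> A p\<close> on the set where \<open>p \<ge> 0\<close> that
  mentions no derivative: \<open>u\<close> need not be differentiable everywhere, and the condition
  carries over to the reflected and to the negated solution.\<close>

definition grows_with :: "real \<Rightarrow> (real \<Rightarrow> real) \<Rightarrow> (real \<Rightarrow> real) \<Rightarrow> real set \<Rightarrow> bool" where
  "grows_with A p u S \<longleftrightarrow> (\<forall>x y m. x \<le> y \<and> {x..y} \<subseteq> S \<and> 0 \<le> m \<and> (\<forall>z\<in>{x..y}. m \<le> p z) \<longrightarrow>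
     A * m * (y - x) \<le> u y - u x)"

lemma grows_withD:
  "\<lbrakk>grows_with A p u S; x \<le> y; {x..y} \<subseteq> S; 0 \<le> m; \<And>z. z \<in> {x..y} \<Longrightarrow> m \<le> p z\<rbrakk>
    \<Longrightarrow> A * m * (y - x) \<le> u y - u x"
  unfolding grows_with_def by blast

lemma grows_with_subset: "grows_with A p u S \<Longrightarrow> T \<subseteq> S \<Longrightarrow> grows_with A p u T"
  unfolding grows_with_def by (meson subset_trans)

text \<open>If \<open>p\<close> stayed positive, \<open>u\<close> would increase from a nonnegative
  value and \<open>p\<close> would decrease. In the first half \<open>u\<close> gains at least
  \<open>A h\<close> times the value of \<open>p\<close> at the midpoint; at this size it drives
  \<open>p\<close> down to 0 within the second half.\<close>

lemma flux_nonpos_after_nonneg: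
  assumes up: "grows_with A p u {\<alpha>..\<alpha> + 2 * h}"
    and pd: "grows_with B u (\<lambda>y. - p y) {\<alpha>..\<alpha> + 2 * h}"
    and u0: "0 \<le> u \<alpha>" and h: "0 < h" "1 \<le> A * B * h\<^sup>2" and AB: "0 < A" "0 < B"
  shows "\<exists>z\<in>{\<alpha>..\<alpha> + 2 * h}. p z \<le> 0"
proof (rule ccontr)
  assume "\<not> ?thesis"
  then have pos: "0 < p z" if "z \<in> {\<alpha>..\<alpha> + 2 * h}" for z
    using that by (auto simp: not_le)
  have umono: "u x \<le> u y" if "\<alpha> \<le> x" "x \<le> y" "y \<le> \<alpha> + 2 * h" for x y
    using grows_withD[OF up that(2), of 0] pos that by (force simp: less_imp_le)
  have panti: "p y \<le> p x" if "\<alpha> \<le> x" "x \<le> y" "y \<le> \<alpha> + 2 * h" for x y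
  proof -
    have "0 \<le> u z" if "z \<in> {x..y}" for z
      using u0 umono[of \<alpha> z] that \<open>\<alpha> \<le> x\<close> \<open>y \<le> \<alpha> + 2 * h\<close> by auto
    then show ?thesis
      using grows_withD[OF pd that(2), of 0] that by force
  qed
  let ?s = "\<alpha> + h"
  have ps: "0 < p ?s" using pos h by simp
  have "A * p ?s * (?s - \<alpha>) \<le> u ?s - u \<alpha>"
    by (rule grows_withD[OF up]) (use h ps panti in auto)
  then have us: "A * p ?s * h \<le> u ?s" using u0 by simp
  have "B * (A * p ?s * h) * (\<alpha> + 2 * h - ?s) \<le> - p (\<alpha> + 2 * h) - (- p ?s)"
  proof (rule grows_withD[OF pd])
    show "A * p ?s * h \<le> u z" if "z \<in> {?s..\<alpha> + 2 * h}" for z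
      using us umono[of ?s z] h that by auto
  qed (use h ps AB in auto)
  then have "(A * B * h\<^sup>2) * p ?s \<le> p ?s - p (\<alpha> + 2 * h)"
    by (simp add: power2_eq_square algebra_simps)
  moreover have "1 * p ?s \<le> (A * B * h\<^sup>2) * p ?s"
    using h ps by (intro mult_right_mono) auto
  moreover have "0 < p (\<alpha> + 2 * h)" using pos h by simp
  ultimately show False by simp
qed

text \<open>If \<open>u\<close> is negative at the midpoint of the window, reflecting the window
  there and changing the sign of \<open>u\<close> leads back to the nonnegative case.\<close>

lemma flux_nonpos_in_window:
  assumes up: "grows_with A p u {\<alpha>..\<alpha> + 4 * h}"
    and pd: "grows_with B u (\<lambda>y. - p y) {\<alpha>..\<alpha> + 4 * h}"
    and pu: "grows_with B (\<lambda>y. - u y) p {\<alpha>..\<alpha> + 4 * h}"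
    and h: "0 < h" "1 \<le> A * B * h\<^sup>2" and AB: "0 < A" "0 < B"
  shows "\<exists>z\<in>{\<alpha>..\<alpha> + 4 * h}. p z \<le> 0"
proof (cases "0 \<le> u (\<alpha> + 2 * h)")
  case True
  have "\<exists>z\<in>{\<alpha> + 2 * h..\<alpha> + 2 * h + 2 * h}. p z \<le> 0"
    by (rule flux_nonpos_after_nonneg[where u = u and A = A and B = B])
      (use True h AB in \<open>auto intro: grows_with_subset[OF up] grows_with_subset[OF pd]\<close>)
  then show ?thesis using h by force
next
  case False
  let ?u = "\<lambda>y. - u (- y)" and ?p = "\<lambda>y. p (- y)" and ?s = "- (\<alpha> + 2 * h)"
  have refl: "{- y..- x} \<subseteq> {\<alpha>..\<alpha> + 4 * h}" if "{x..y} \<subseteq> {?s..?s + 2 * h}" "x \<le> y" for x y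
    using that h by (auto simp: atLeastatMost_subset_iff)
  have refl2: "- z \<in> {x..y}" if "z \<in> {- y..- x}" for x y z :: real
    using that by auto
  have "\<exists>z\<in>{?s..?s + 2 * h}. ?p z \<le> 0"
  proof (rule flux_nonpos_after_nonneg[where u = ?u and A = A and B = B])
    show "grows_with A ?p ?u {?s..?s + 2 * h}"
      unfolding grows_with_def
    proof safe
      fix x y m assume *: "x \<le> y" "{x..y} \<subseteq> {?s..?s + 2 * h}" "0 \<le> m" "\<forall>z\<in>{x..y}. m \<le> p (- z)"
      have mz: "m \<le> p z" if "z \<in> {- y..- x}" for z
        using *(4) refl2[OF that] by force
      have "A * m * (- x - - y) \<le> u (- x) - u (- y)"
        by (rule grows_withD[OF up _ refl[OF *(2,1)] *(3) mz]) (use *(1) in auto)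
      then show "A * m * (y - x) \<le> - u (- y) - - u (- x)" by simp
    qed
    show "grows_with B ?u (\<lambda>y. - ?p y) {?s..?s + 2 * h}"
      unfolding grows_with_def
    proof safe
      fix x y m assume *: "x \<le> y" "{x..y} \<subseteq> {?s..?s + 2 * h}" "0 \<le> m" "\<forall>z\<in>{x..y}. m \<le> - u (- z)"
      have mz: "m \<le> - u z" if "z \<in> {- y..- x}" for z
        using *(4) refl2[OF that] by force
      have "B * m * (- x - - y) \<le> p (- x) - p (- y)"
        by (rule grows_withD[OF pu _ refl[OF *(2,1)] *(3) mz]) (use *(1) in auto)
      then show "B * m * (y - x) \<le> - p (- y) - - p (- x)" by simp
    qed
    show "0 \<le> - u (- ?s)"
      unfolding minus_minus using False by linarith
  qed (use h AB in auto)
  then obtain z where "z \<in> {?s..?s + 2 * h}" "p (- z) \<le> 0" by blast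
  then show ?thesis using h by (intro bexI[of _ "- z"]) auto
qed

text \<open>The system is odd, so the same argument for \<open>(- u, - p)\<close> shows that
  \<open>p\<close> cannot stay negative either.\<close>

lemma flux_vanishes_in_window:
  assumes up: "grows_with A p u {\<alpha>..\<alpha> + 4 * h}"
    and un: "grows_with A (\<lambda>y. - p y) (\<lambda>y. - u y) {\<alpha>..\<alpha> + 4 * h}"
    and pd: "grows_with B u (\<lambda>y. - p y) {\<alpha>..\<alpha> + 4 * h}"
    and pu: "grows_with B (\<lambda>y. - u y) p {\<alpha>..\<alpha> + 4 * h}"
    and h: "0 < h" "1 \<le> A * B * h\<^sup>2" and AB: "0 < A" "0 < B"
    and cont: "continuous_on {\<alpha>..\<alpha> + 4 * h} p"
  shows "\<exists>z\<in>{\<alpha>..\<alpha> + 4 * h}. p z = 0"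
proof -
  obtain z1 where z1: "z1 \<in> {\<alpha>..\<alpha> + 4 * h}" "p z1 \<le> 0"
    using flux_nonpos_in_window[OF up pd pu h AB] by blast
  obtain z2 where z2: "z2 \<in> {\<alpha>..\<alpha> + 4 * h}" "0 \<le> p z2"
    using flux_nonpos_in_window[of A "\<lambda>y. - p y" "\<lambda>y. - u y" \<alpha> h B] un pd pu h AB by auto
  have "connected (p ` {\<alpha>..\<alpha> + 4 * h})"
    using cont by (intro connected_continuous_image) auto
  then have "0 \<in> p ` {\<alpha>..\<alpha> + 4 * h}"
    using z1 z2 connectedD_interval[of "p ` {\<alpha>..\<alpha> + 4 * h}" "p z1" "p z2" 0] by blast
  then show ?thesis by auto
qed

lemma AE_interval_negligible:
  fixes H :: real
  assumes "AE y in lebesgue_on {0<..<H}. P y"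
  obtains N where "negligible N" "\<And>y. y \<in> {0..H} - N \<Longrightarrow> P y"
proof -
  have "AE y in lebesgue. y \<in> {0<..<H} \<longrightarrow> P y"
    using assms AE_restrict_space_iff[of "{0<..<H}" lebesgue P] by simp
  then obtain N where N: "N \<in> null_sets lebesgue" "{y. \<not> (y \<in> {0<..<H} \<longrightarrow> P y)} \<subseteq> N"
    by (auto simp: eventually_ae_filter)
  then have "negligible (N \<union> {0, H})"
    by (auto simp: negligible_iff_null_sets[symmetric])
  moreover have "P y" if "y \<in> {0..H} - (N \<union> {0, H})" for y
  proof -
    have "y \<in> {0<..<H}" using that by auto
    with N(2) that show ?thesis by blast
  qed
  ultimately show thesis by (rule that)
qed

lemma integral_mono_AE_interval:
  fixes f g :: "real \<Rightarrow> real"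
  assumes f: "f integrable_on {x..y}" and g: "g integrable_on {x..y}"
    and AE: "AE z in lebesgue_on {0<..<H}. f z \<le> g z" and sub: "0 \<le> x" "y \<le> H"
  shows "integral {x..y} f \<le> integral {x..y} g"
proof -
  obtain N where N: "negligible N" "\<And>z. z \<in> {0..H} - N \<Longrightarrow> f z \<le> g z"
    using AE_interval_negligible[OF AE] by blast
  \<comment> \<open>changes \<open>g\<close> only on \<open>N\<close> and lies above \<open>f\<close> everywhere\<close>
  let ?g = "\<lambda>z. max (f z) (g z)"
  have eq: "?g z = g z" if "z \<in> {x..y} - N" for z
    using N(2)[of z] that sub by auto
  have "integral {x..y} f \<le> integral {x..y} ?g"
    by (rule integral_le[OF f integrable_spike[OF g N(1) eq]]) auto
  also have "\<dots> = integral {x..y} g"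
    by (rule integral_spike[OF N(1)]) (simp add: eq)
  finally show ?thesis .
qed

lemma abs_integral_le_AE_interval:
  fixes f g :: "real \<Rightarrow> real"
  assumes f: "f integrable_on {x..y}" and g: "g integrable_on {x..y}"
    and AE: "AE z in lebesgue_on {0<..<H}. \<bar>f z\<bar> \<le> g z" and sub: "0 \<le> x" "y \<le> H"
  shows "\<bar>integral {x..y} f\<bar> \<le> integral {x..y} g"
proof -
  have "integral {x..y} f \<le> integral {x..y} g"
    using AE by (intro integral_mono_AE_interval[OF f g _ sub]) (auto elim!: eventually_mono)
  moreover have "integral {x..y} (\<lambda>z. - f z) \<le> integral {x..y} g"
    using AE by (intro integral_mono_AE_interval[OF integrable_neg[OF f] g _ sub])
      (auto elim!: eventually_mono)
  ultimately show ?thesis by (simp add: abs_le_iff)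
qed

text \<open>The differential inequality is required only almost everywhere and is integrated over
  the intervals on which \<open>p\<close> has a nonnegative lower bound.\<close>

lemma grows_with_integral:
  fixes U :: "real \<Rightarrow> real"
  assumes U: "U integrable_on {0..H}"
    and u: "\<And>x y. 0 \<le> x \<Longrightarrow> x \<le> y \<Longrightarrow> y \<le> H \<Longrightarrow> u y - u x = integral {x..y} U"
    and AE: "AE y in lebesgue_on {0<..<H}. 0 \<le> p y \<longrightarrow> A * p y \<le> U y" and "0 \<le> A"
  shows "grows_with A p u {0..H}"
  unfolding grows_with_def
proof (intro allI impI, elim conjE)
  fix x y m assume xy: "x \<le> y" "{x..y} \<subseteq> {0..H}" and m: "0 \<le> m" "\<forall>z\<in>{x..y}. m \<le> p z"
  then have sub: "0 \<le> x" "y \<le> H" by auto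
  have Ui: "U integrable_on {x..y}"
    using U xy(2) by (rule integrable_on_subinterval)
  let ?f = "\<lambda>z. if z \<in> {x..y} then A * m else U z"
  have fi: "?f integrable_on {x..y}"
    using integrable_const_ivl[of "A * m" x y] by (rule integrable_eq) auto
  have "integral {x..y} ?f \<le> integral {x..y} U"
  proof (rule integral_mono_AE_interval[OF fi Ui _ sub])
    show "AE z in lebesgue_on {0<..<H}. ?f z \<le> U z"
      using AE
    proof eventually_elim
      case (elim z)
      have "A * m \<le> A * p z" if "z \<in> {x..y}"
        using m that \<open>0 \<le> A\<close> by (intro mult_left_mono) auto
      moreover have "0 \<le> p z" if "z \<in> {x..y}" using order_trans[OF m(1)] m(2) that by blast
      ultimately show ?case using elim by force
    qed
  qed
  moreover have "integral {x..y} ?f = integral {x..y} (\<lambda>_. A * m)"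
    by (rule integral_cong) auto
  ultimately show "A * m * (y - x) \<le> u y - u x"
    using u[OF sub(1) xy(1) sub(2)] xy(1) by (simp add: algebra_simps)
qed

text \<open>The Cauchy-Schwarz inequality against the constant function 1.\<close>

lemma integral_abs_sq_le:
  fixes u :: "real \<Rightarrow> real"
  assumes u: "continuous_on {x..y} u" and "x < y"
  shows "(integral {x..y} (\<lambda>z. \<bar>u z\<bar>))\<^sup>2 \<le> (y - x) * integral {x..y} (\<lambda>z. (u z)\<^sup>2)"
proof -
  let ?t = "y - x"
  define S where "S = integral {x..y} (\<lambda>z. \<bar>u z\<bar>)"
  define J where "J = integral {x..y} (\<lambda>z. (u z)\<^sup>2)"
  have "0 \<le> integral {x..y} (\<lambda>z. (u z)\<^sup>2 - (2 * S / ?t) * \<bar>u z\<bar> + (S / ?t)\<^sup>2)"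
  proof (rule integral_nonneg)
    show "(\<lambda>z. (u z)\<^sup>2 - (2 * S / ?t) * \<bar>u z\<bar> + (S / ?t)\<^sup>2) integrable_on {x..y}"
      using u by (intro integrable_continuous_real continuous_intros)
    fix z
    have "0 \<le> (\<bar>u z\<bar> - S / ?t)\<^sup>2" by simp
    then show "0 \<le> (u z)\<^sup>2 - (2 * S / ?t) * \<bar>u z\<bar> + (S / ?t)\<^sup>2"
      by (simp add: power2_diff algebra_simps)
  qed
  also have "\<dots> = integral {x..y} (\<lambda>z. (u z)\<^sup>2 - (2 * S / ?t) * \<bar>u z\<bar>) + integral {x..y} (\<lambda>z. (S / ?t)\<^sup>2)"
    using u by (intro Henstock_Kurzweil_Integration.integral_add integrable_continuous_real continuous_intros)
  also have "integral {x..y} (\<lambda>z. (u z)\<^sup>2 - (2 * S / ?t) * \<bar>u z\<bar>)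
      = J - integral {x..y} (\<lambda>z. (2 * S / ?t) * \<bar>u z\<bar>)"
    unfolding J_def using u
    by (intro Henstock_Kurzweil_Integration.integral_diff integrable_continuous_real continuous_intros)
  also have "integral {x..y} (\<lambda>z. (2 * S / ?t) * \<bar>u z\<bar>) = (2 * S / ?t) * S"
    unfolding S_def by (rule integral_mult_right)
  also have "integral {x..y} (\<lambda>z. (S / ?t)\<^sup>2) = ?t * (S / ?t)\<^sup>2"
    using \<open>x < y\<close> by simp
  finally have "0 \<le> J - 2 * S / ?t * S + ?t * (S / ?t)\<^sup>2" .
  also have "\<dots> = J - S\<^sup>2 / ?t"
  proof -
    have "J - 2 * S / t * S + t * (S / t)\<^sup>2 = J - S\<^sup>2 / t" if "0 < t" for t
      using that by (simp add: power2_eq_square field_simps)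
    then show ?thesis using \<open>x < y\<close> by simp
  qed
  finally show ?thesis
    using \<open>x < y\<close> by (simp add: field_simps S_def J_def)
qed

text \<open>Let \<open>S\<close> be the integral of \<open>\<bar>u\<bar>\<close> over the window, of
  length \<open>t\<close>. As \<open>p\<close> vanishes at \<open>z0\<close>, it is bounded by
  \<open>lam S\<close>, so that \<open>u\<close> deviates from \<open>u z0\<close> by at most
  \<open>K lam S t\<close>. Hence \<open>r\<^sup>2 \<le> 2 u\<^sup>2 + 2 (K lam S t)\<^sup>2\<close>
  throughout the window; it remains to integrate and to bound \<open>S\<^sup>2\<close> by
  \<open>t\<close> times the integral of \<open>u\<^sup>2\<close>.\<close>

lemma window_mass:
  fixes u p :: "real \<Rightarrow> real"
  assumes u: "continuous_on {x..y} u" and p: "continuous_on {x..y} p" and "x < y"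
    and pv: "\<And>v w. x \<le> v \<Longrightarrow> v \<le> w \<Longrightarrow> w \<le> y \<Longrightarrow> \<bar>p w - p v\<bar> \<le> lam * integral {v..w} (\<lambda>z. \<bar>u z\<bar>)"
    and uv: "\<And>v w. x \<le> v \<Longrightarrow> v \<le> w \<Longrightarrow> w \<le> y \<Longrightarrow> \<bar>u w - u v\<bar> \<le> K * integral {v..w} (\<lambda>z. \<bar>p z\<bar>)"
    and "0 \<le> lam" "0 \<le> K"
    and z0: "z0 \<in> {x..y}" "p z0 = 0" and r: "r\<^sup>2 \<le> (u z0)\<^sup>2"
  shows "r\<^sup>2 * (y - x) \<le> (2 + 2 * K\<^sup>2 * (lam * (y - x)\<^sup>2)\<^sup>2) * integral {x..y} (\<lambda>z. (u z)\<^sup>2)"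
proof -
  let ?t = "y - x"
  define S where "S = integral {x..y} (\<lambda>z. \<bar>u z\<bar>)"
  define J where "J = integral {x..y} (\<lambda>z. (u z)\<^sup>2)"
  have S0: "0 \<le> S" unfolding S_def using u
    by (intro integral_nonneg integrable_continuous_real continuous_intros) auto
  have SJ: "S\<^sup>2 \<le> ?t * J" unfolding S_def J_def by (rule integral_abs_sq_le[OF u \<open>x < y\<close>])
  have sub_S: "integral {v..w} (\<lambda>z. \<bar>u z\<bar>) \<le> S" if "x \<le> v" "w \<le> y" for v w
    unfolding S_def using that u
    by (intro integral_subset_le integrable_continuous_real continuous_intros)
      (auto intro: continuous_on_subset)
  have p_bound: "\<bar>p z\<bar> \<le> lam * S" if "z \<in> {x..y}" for z
  proof -
    have "lam * integral {v..w} (\<lambda>z. \<bar>u z\<bar>) \<le> lam * S" if "x \<le> v" "w \<le> y" for v w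
      using sub_S[OF that] \<open>0 \<le> lam\<close> by (rule mult_left_mono)
    then show ?thesis
      using pv[of z z0] pv[of z0 z] z0 that by (cases "z \<le> z0") force+
  qed
  have p_int: "integral {v..w} (\<lambda>z. \<bar>p z\<bar>) \<le> lam * S * ?t" if "x \<le> v" "v \<le> w" "w \<le> y" for v w
  proof -
    have "integral {v..w} (\<lambda>z. \<bar>p z\<bar>) \<le> integral {v..w} (\<lambda>z. lam * S)"
      using that p_bound p
      by (intro integral_le integrable_continuous_real continuous_intros)
        (auto intro: continuous_on_subset)
    also have "\<dots> = (w - v) * (lam * S)" using that by simp
    also have "\<dots> \<le> ?t * (lam * S)"
      using that \<open>0 \<le> lam\<close> S0 by (intro mult_right_mono) auto
    finally show ?thesis by (simp add: mult.commute)
  qed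
  have u_bound: "\<bar>u z0 - u z\<bar> \<le> K * (lam * S * ?t)" if "z \<in> {x..y}" for z
  proof -
    have "\<bar>u w - u v\<bar> \<le> K * (lam * S * ?t)" if "x \<le> v" "v \<le> w" "w \<le> y" for v w
      using uv[OF that] mult_left_mono[OF p_int[OF that] \<open>0 \<le> K\<close>] by (rule order_trans)
    from this[of z z0] this[of z0 z] show ?thesis
      using z0 that abs_minus_commute[of "u z0" "u z"] by (cases "z \<le> z0") auto
  qed
  have pt: "r\<^sup>2 \<le> 2 * (u z)\<^sup>2 + 2 * (K * (lam * S * ?t))\<^sup>2" if "z \<in> {x..y}" for z
  proof -
    have "(u z0 - u z)\<^sup>2 \<le> (K * (lam * S * ?t))\<^sup>2"
      using u_bound[OF that] by (rule abs_le_square_iff[THEN iffD1, OF order_trans]) simp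
    moreover have "(u z0)\<^sup>2 \<le> 2 * (u z)\<^sup>2 + 2 * (u z0 - u z)\<^sup>2"
    proof -
      have "0 \<le> (u z0 - 2 * u z)\<^sup>2" by simp
      then show ?thesis by (simp add: power2_eq_square algebra_simps)
    qed
    ultimately show ?thesis using r by linarith
  qed
  have "r\<^sup>2 * ?t = integral {x..y} (\<lambda>_. r\<^sup>2)" using \<open>x < y\<close> by simp
  also have "\<dots> \<le> integral {x..y} (\<lambda>z. 2 * (u z)\<^sup>2 + 2 * (K * (lam * S * ?t))\<^sup>2)"
    using pt u by (intro integral_le integrable_continuous_real continuous_intros) auto
  also have "\<dots> = integral {x..y} (\<lambda>z. 2 * (u z)\<^sup>2) + integral {x..y} (\<lambda>z. 2 * (K * (lam * S * ?t))\<^sup>2)"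
    using u by (intro Henstock_Kurzweil_Integration.integral_add integrable_continuous_real continuous_intros)
  also have "\<dots> = 2 * J + ?t * (2 * (K * (lam * S * ?t))\<^sup>2)"
    using \<open>x < y\<close> by (simp add: J_def)
  also have "\<dots> = 2 * J + (2 * K\<^sup>2 * lam\<^sup>2 * ?t ^ 3) * S\<^sup>2"
    by (simp add: power_mult_distrib power2_eq_square power3_eq_cube)
  also have "\<dots> \<le> 2 * J + (2 * K\<^sup>2 * lam\<^sup>2 * ?t ^ 3) * (?t * J)"
    using SJ \<open>x < y\<close> by (intro add_left_mono mult_left_mono) auto
  also have "\<dots> = (2 + 2 * K\<^sup>2 * (lam * ?t\<^sup>2)\<^sup>2) * J"
    by (simp add: power_mult_distrib power2_eq_square power3_eq_cube algebra_simps)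
  finally show ?thesis by (simp add: J_def)
qed

lemma integral_ge_of_windows:
  fixes f :: "real \<Rightarrow> real"
  assumes f: "f integrable_on {a..a + real n * t}" and "0 \<le> t"
    and win: "\<And>i. i < n \<Longrightarrow> \<kappa> \<le> integral {a + real i * t..a + real (Suc i) * t} f"
  shows "real n * \<kappa> \<le> integral {a..a + real n * t} f"
  using f win
proof (induction n)
  case (Suc n)
  have le: "a \<le> a + real n * t" "a + real n * t \<le> a + real (Suc n) * t"
    using \<open>0 \<le> t\<close> by (auto intro: mult_right_mono)
  have "f integrable_on {a..a + real n * t}"
    using Suc.prems(1) le by (auto intro: integrable_on_subinterval)
  then have "real n * \<kappa> \<le> integral {a..a + real n * t} f"
    using Suc by auto
  moreover have "\<kappa> \<le> integral {a + real n * t..a + real (Suc n) * t} f"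
    by (rule Suc.prems(2)) simp
  ultimately show ?case
    using Henstock_Kurzweil_Integration.integral_combine[OF le Suc.prems(1)] by (simp add: algebra_simps)
qed simp

text \<open>With \<open>\<kappa> = \<epsilon> / (c\<^sub>M + \<epsilon>)\<close> the growth rates
  are \<open>1 / c\<^sub>M\<close> and \<open>\<kappa> lam\<close>, so a window of length \<open>W =
  4 h\<close> with \<open>h\<^sup>2 = c\<^sub>M / (\<kappa> lam)\<close> contains a zero of the
  flux, and \<open>lam W\<^sup>2 = \<theta>\<close>. The condition on \<open>lam\<close> says that
  \<open>W\<close> is shorter than \<open>b - a\<close>; the interval then splits into windows of
  equal length between \<open>W\<close> and \<open>2 W\<close>.\<close>

lemma eigenfunction_mass:
  fixes u p U q c :: "real \<Rightarrow> real"
  assumes pos: "0 < c\<^sub>m" "c\<^sub>m \<le> c\<^sub>M" "0 < \<epsilon>" "0 < lam"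
    and lam: "(c\<^sub>M + \<epsilon>) * \<mu>\<^sup>2 \<le> lam"
    and c: "AE y in lebesgue_on {0<..<H}. c\<^sub>m \<le> c y \<and> c y \<le> c\<^sub>M"
    and U: "U integrable_on {0..H}" "AE y in lebesgue_on {0<..<H}. p y = c y * U y"
    and q: "q integrable_on {0..H}" "AE y in lebesgue_on {0<..<H}. lam * u y = c y * \<mu>\<^sup>2 * u y - q y"
    and u: "continuous_on {0..H} u"
      "\<And>x y. 0 \<le> x \<Longrightarrow> x \<le> y \<Longrightarrow> y \<le> H \<Longrightarrow> u y - u x = integral {x..y} U"
    and p: "continuous_on {0..H} p"
      "\<And>x y. 0 \<le> x \<Longrightarrow> x \<le> y \<Longrightarrow> y \<le> H \<Longrightarrow> p y - p x = integral {x..y} q"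
    and amp: "\<And>y. y \<in> {0..H} \<Longrightarrow> r\<^sup>2 \<le> (u y)\<^sup>2 + (p y)\<^sup>2"
    and ab: "0 \<le> a" "a < b" "b \<le> H"
    and \<theta>: "\<theta> = 16 * c\<^sub>M * (c\<^sub>M + \<epsilon>) / \<epsilon>" and large: "\<theta> / (b - a)\<^sup>2 < lam"
  shows "r\<^sup>2 * (b - a) / (2 + 32 * \<theta>\<^sup>2 / c\<^sub>m\<^sup>2) \<le> integral {a..b} (\<lambda>y. (u y)\<^sup>2)"
proof -
  let ?M = "lebesgue_on {0<..<H}"
  define \<kappa> where "\<kappa> = \<epsilon> / (c\<^sub>M + \<epsilon>)"
  have cM: "0 < c\<^sub>M" and \<kappa>: "0 < \<kappa>" using pos by (auto simp: \<kappa>_def)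
  have \<theta>': "\<theta> = 16 * c\<^sub>M / \<kappa>" "0 < \<theta>" using pos cM by (auto simp: \<theta> \<kappa>_def)
  have rate: "\<kappa> * lam \<le> lam - c y * \<mu>\<^sup>2 \<and> lam - c y * \<mu>\<^sup>2 \<le> lam" if "c\<^sub>m \<le> c y \<and> c y \<le> c\<^sub>M" for y
  proof -
    have "c y * \<mu>\<^sup>2 \<le> c\<^sub>M * \<mu>\<^sup>2" using that by (intro mult_right_mono) auto
    also have "c\<^sub>M * \<mu>\<^sup>2 = c\<^sub>M / (c\<^sub>M + \<epsilon>) * ((c\<^sub>M + \<epsilon>) * \<mu>\<^sup>2)" using cM pos by simp
    also have "\<dots> \<le> c\<^sub>M / (c\<^sub>M + \<epsilon>) * lam" using lam cM pos by (intro mult_left_mono) auto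
    also have "\<dots> = lam - \<kappa> * lam" using cM pos by (simp add: \<kappa>_def field_simps)
    finally have "\<kappa> * lam \<le> lam - c y * \<mu>\<^sup>2" by simp
    moreover have "0 \<le> c y * \<mu>\<^sup>2" using that pos by auto
    ultimately show ?thesis by simp
  qed
  have AE_U: "AE y in ?M. c\<^sub>m \<le> c y \<and> c y \<le> c\<^sub>M \<and> U y = p y / c y"
    using c U(2) by eventually_elim (use pos in auto)
  have AE_q: "AE y in ?M. c\<^sub>m \<le> c y \<and> c y \<le> c\<^sub>M \<and> - q y = (lam - c y * \<mu>\<^sup>2) * u y"
    using c q(2) by eventually_elim (auto simp: algebra_simps)
  have U_ge: "p y / c\<^sub>M \<le> U y" if "c\<^sub>m \<le> c y \<and> c y \<le> c\<^sub>M \<and> U y = p y / c y" "0 \<le> p y" for y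
    using that pos by (auto intro!: divide_left_mono)
  have g1: "grows_with (1 / c\<^sub>M) p u {0..H}"
  proof (rule grows_with_integral[OF U(1) u(2)])
    show "AE y in ?M. 0 \<le> p y \<longrightarrow> 1 / c\<^sub>M * p y \<le> U y"
      using AE_U
    proof eventually_elim
      case (elim y)
      with U_ge[of y] show ?case by simp
    qed
  qed (use cM in simp_all)
  have g2: "grows_with (1 / c\<^sub>M) (\<lambda>y. - p y) (\<lambda>y. - u y) {0..H}"
  proof (rule grows_with_integral)
    show "(\<lambda>y. - U y) integrable_on {0..H}" using U(1) by (rule integrable_neg)
    show "- u y - - u x = integral {x..y} (\<lambda>y. - U y)" if "0 \<le> x" "x \<le> y" "y \<le> H" for x y
      using u(2)[OF that] by simp
    show "AE y in ?M. 0 \<le> - p y \<longrightarrow> 1 / c\<^sub>M * - p y \<le> - U y"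
      using AE_U
    proof eventually_elim
      case (elim y)
      have "- p y / c\<^sub>M \<le> - p y / c y" if "0 \<le> - p y"
        using elim that pos by (intro divide_left_mono) auto
      with elim show ?case by simp
    qed
  qed (use cM in simp)
  have g3: "grows_with (\<kappa> * lam) u (\<lambda>y. - p y) {0..H}"
  proof (rule grows_with_integral)
    show "(\<lambda>y. - q y) integrable_on {0..H}" using q(1) by (rule integrable_neg)
    show "- p y - - p x = integral {x..y} (\<lambda>y. - q y)" if "0 \<le> x" "x \<le> y" "y \<le> H" for x y
      using p(2)[OF that] by simp
    show "AE y in ?M. 0 \<le> u y \<longrightarrow> \<kappa> * lam * u y \<le> - q y"
      using AE_q by eventually_elim (use rate in \<open>auto intro!: mult_right_mono\<close>)
  qed (use \<kappa> pos in simp)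
  have g4: "grows_with (\<kappa> * lam) (\<lambda>y. - u y) p {0..H}"
  proof (rule grows_with_integral[OF q(1) p(2)])
    show "AE y in ?M. 0 \<le> - u y \<longrightarrow> \<kappa> * lam * - u y \<le> q y"
      using AE_q
    proof eventually_elim
      case (elim y)
      have "\<kappa> * lam * - u y \<le> (lam - c y * \<mu>\<^sup>2) * - u y" if "0 \<le> - u y"
        using rate[of y] elim that by (intro mult_right_mono) auto
      with elim show ?case by (auto simp: algebra_simps)
    qed
  qed (use \<kappa> pos in simp_all)
  have sub_int: "f integrable_on {x..y}"
    if "f integrable_on {0..H}" "0 \<le> x" "y \<le> H" for f :: "real \<Rightarrow> real" and x y
    using that by (auto intro: integrable_on_subinterval)
  have sub_cont: "continuous_on {x..y} f"
    if "continuous_on {0..H} f" "0 \<le> x" "y \<le> H" for f :: "real \<Rightarrow> real" and x y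
    using that by (auto intro: continuous_on_subset)
  have pv: "\<bar>p w - p v\<bar> \<le> lam * integral {v..w} (\<lambda>z. \<bar>u z\<bar>)" if "0 \<le> v" "v \<le> w" "w \<le> H" for v w
  proof -
    have "\<bar>integral {v..w} q\<bar> \<le> integral {v..w} (\<lambda>z. lam * \<bar>u z\<bar>)"
    proof (rule abs_integral_le_AE_interval[OF sub_int[OF q(1)] _ _ that(1,3)])
      show "(\<lambda>z. lam * \<bar>u z\<bar>) integrable_on {v..w}"
        using sub_cont[OF u(1)] that by (intro integrable_continuous_real continuous_intros) auto
      show "AE z in ?M. \<bar>q z\<bar> \<le> lam * \<bar>u z\<bar>"
        using AE_q
      proof eventually_elim
        case (elim z)
        have "\<bar>q z\<bar> = \<bar>lam - c z * \<mu>\<^sup>2\<bar> * \<bar>u z\<bar>"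
          using elim by (metis abs_minus_cancel abs_mult)
        also have "\<bar>lam - c z * \<mu>\<^sup>2\<bar> \<le> lam"
        proof -
          have "0 \<le> \<kappa> * lam" using \<kappa> pos by simp
          with rate[of z] elim show ?thesis by (simp add: abs_le_iff)
        qed
        finally show ?case by (simp add: mult_right_mono)
      qed
    qed (use that in auto)
    then show ?thesis using p(2)[OF that] by simp
  qed
  have uv: "\<bar>u w - u v\<bar> \<le> 1 / c\<^sub>m * integral {v..w} (\<lambda>z. \<bar>p z\<bar>)" if "0 \<le> v" "v \<le> w" "w \<le> H" for v w
  proof -
    have "\<bar>integral {v..w} U\<bar> \<le> integral {v..w} (\<lambda>z. 1 / c\<^sub>m * \<bar>p z\<bar>)"
    proof (rule abs_integral_le_AE_interval[OF sub_int[OF U(1)] _ _ that(1,3)])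
      show "(\<lambda>z. 1 / c\<^sub>m * \<bar>p z\<bar>) integrable_on {v..w}"
        using sub_cont[OF p(1)] that by (intro integrable_continuous_real continuous_intros) auto
      show "AE z in ?M. \<bar>U z\<bar> \<le> 1 / c\<^sub>m * \<bar>p z\<bar>"
        using AE_U
      proof eventually_elim
        case (elim z)
        have "\<bar>p z\<bar> / c z \<le> \<bar>p z\<bar> / c\<^sub>m" using elim pos by (intro divide_left_mono) auto
        with elim pos show ?case by (simp add: abs_divide)
      qed
    qed (use that in auto)
    then show ?thesis using u(2)[OF that] by simp
  qed
  define h where "h = sqrt (c\<^sub>M / (\<kappa> * lam))"
  have h: "0 < h" "h\<^sup>2 = c\<^sub>M / (\<kappa> * lam)" using cM \<kappa> pos by (auto simp: h_def)
  define W where "W = 4 * h"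
  have W: "0 < W" "lam * W\<^sup>2 = \<theta>"
    using h pos \<kappa> by (auto simp: W_def \<theta>' power_mult_distrib)
  have "W\<^sup>2 < (b - a)\<^sup>2"
  proof -
    have "\<theta> < lam * (b - a)\<^sup>2" using large ab by (simp add: field_simps)
    then have "lam * W\<^sup>2 < lam * (b - a)\<^sup>2" using W by simp
    then show ?thesis using pos by simp
  qed
  then have "W < b - a" using ab by (simp add: power2_less_imp_less)
  define n where "n = nat \<lfloor>(b - a) / W\<rfloor>"
  have "1 \<le> (b - a) / W" using \<open>W < b - a\<close> W(1) by simp
  then have n1: "1 \<le> n" unfolding n_def by (simp add: le_nat_iff)
  have n_le: "real n \<le> (b - a) / W" and n_ge: "(b - a) / W < real n + 1"
    using \<open>1 \<le> (b - a) / W\<close> unfolding n_def by linarith+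
  define t where "t = (b - a) / real n"
  have t: "W \<le> t" "t < 2 * W"
  proof -
    show "W \<le> t" using n_le n1 W(1) by (simp add: t_def field_simps)
    have "(b - a) / W < 2 * real n" using n_ge n1 by simp
    then show "t < 2 * W" using n1 W(1) by (simp add: t_def field_simps)
  qed
  have nt: "real n * t = b - a" using n1 by (simp add: t_def)
  \<comment> \<open>the factor in \<open>window_mass\<close> for \<open>K = 1 / c\<^sub>m\<close> and \<open>lam t\<^sup>2 \<le> lam (2 W)\<^sup>2 = 4 \<theta>\<close>\<close>
  define Q where "Q = 2 + 32 * \<theta>\<^sup>2 / c\<^sub>m\<^sup>2"
  have Q: "0 < Q" unfolding Q_def using pos by (intro add_pos_nonneg) auto
  have win: "r\<^sup>2 * t / Q \<le> integral {x..x + t} (\<lambda>z. (u z)\<^sup>2)" if x: "0 \<le> x" "x + t \<le> H" for x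
  proof -
    have sub: "{x..x + 4 * h} \<subseteq> {0..H}" using x t(1) by (auto simp: W_def)
    have "\<exists>z\<in>{x..x + 4 * h}. p z = 0"
    proof (rule flux_vanishes_in_window)
      show "1 \<le> 1 / c\<^sub>M * (\<kappa> * lam) * h\<^sup>2" using h cM \<kappa> pos by simp
    qed (use g1 g2 g3 g4 grows_with_subset[OF _ sub] continuous_on_subset[OF p(1) sub] h cM \<kappa> pos in auto)
    then obtain z0 where "z0 \<in> {x..x + 4 * h}" "p z0 = 0" by blast
    with t(1) have z0: "z0 \<in> {x..x + t}" "p z0 = 0" by (auto simp: W_def)
    have t0: "0 < t" using t(1) W(1) by simp
    have r0: "r\<^sup>2 \<le> (u z0)\<^sup>2" using amp[of z0] z0 x by auto
    have "r\<^sup>2 * (x + t - x) \<le>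
        (2 + 2 * (1 / c\<^sub>m)\<^sup>2 * (lam * (x + t - x)\<^sup>2)\<^sup>2) * integral {x..x + t} (\<lambda>z. (u z)\<^sup>2)"
    proof (rule window_mass[where p = p and ?z0.0 = z0])
      show "continuous_on {x..x + t} u" "continuous_on {x..x + t} p"
        using sub_cont u(1) p(1) x by auto
    qed (use x t0 pv uv pos z0 r0 in auto)
    also have "\<dots> \<le> Q * integral {x..x + t} (\<lambda>z. (u z)\<^sup>2)"
    proof (rule mult_right_mono)
      have "lam * t\<^sup>2 \<le> lam * (2 * W)\<^sup>2"
        using t t0 pos by (intro mult_left_mono power_mono) auto
      also have "\<dots> = 4 * \<theta>" using W(2) by (simp add: power_mult_distrib)
      finally have "(lam * t\<^sup>2)\<^sup>2 \<le> (4 * \<theta>)\<^sup>2" using pos by (intro power_mono) auto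
      then have "2 * (1 / c\<^sub>m)\<^sup>2 * (lam * t\<^sup>2)\<^sup>2 \<le> 2 * (1 / c\<^sub>m)\<^sup>2 * (4 * \<theta>)\<^sup>2"
        by (intro mult_left_mono) auto
      then show "2 + 2 * (1 / c\<^sub>m)\<^sup>2 * (lam * (x + t - x)\<^sup>2)\<^sup>2 \<le> Q"
        by (simp add: Q_def power_mult_distrib power_divide)
      show "0 \<le> integral {x..x + t} (\<lambda>z. (u z)\<^sup>2)"
        using sub_cont[OF u(1)] x
        by (intro integral_nonneg integrable_continuous_real continuous_intros) auto
    qed
    finally show ?thesis using Q by (simp add: field_simps)
  qed
  have mass: "real n * (r\<^sup>2 * t / Q) \<le> integral {a..a + real n * t} (\<lambda>z. (u z)\<^sup>2)"
  proof (rule integral_ge_of_windows)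
    show "(\<lambda>z. (u z)\<^sup>2) integrable_on {a..a + real n * t}"
      using sub_cont[OF u(1)] ab by (intro integrable_continuous_real continuous_intros) (simp add: nt)
    fix i assume "i < n"
    have "real (Suc i) * t \<le> real n * t"
      using \<open>i < n\<close> t(1) W(1) by (intro mult_right_mono) auto
    moreover have "0 \<le> real i * t" using t(1) W(1) by simp
    ultimately show "r\<^sup>2 * t / Q \<le> integral {a + real i * t..a + real (Suc i) * t} (\<lambda>z. (u z)\<^sup>2)"
      using win[of "a + real i * t"] ab nt by (simp add: algebra_simps)
  qed (use t(1) W(1) in simp)
  have total: "real n * (r\<^sup>2 * t / Q) = r\<^sup>2 * (b - a) / Q"
    using nt by (metis mult.assoc mult.left_commute times_divide_eq_right)
  show ?thesis using mass unfolding total nt by (simp add: Q_def)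
qed

section \<open>Lebesgue integrals over product sets\<close>

lemma AE_lborel_fst:
  fixes P :: "'a::euclidean_space \<Rightarrow> bool"
  assumes "AE x in lborel. P x"
  shows "AE z in (lborel :: ('a \<times> 'b::euclidean_space) measure). P (fst z)"
proof -
  obtain N where N: "N \<in> null_sets lborel" "{x. \<not> P x} \<subseteq> N"
    using assms by (auto simp: eventually_ae_filter)
  have "emeasure lborel N = 0" "N \<in> sets lborel"
    using N(1) by (rule null_setsD1, rule null_setsD2)
  then have "N \<times> UNIV \<in> null_sets (lborel \<Otimes>\<^sub>M (lborel :: 'b measure))"
    by (intro null_setsI pair_measureI) (simp_all add: lborel.emeasure_pair_measure_Times)
  then show ?thesis
    unfolding lborel_prod using N(2) by (intro AE_I'[of "N \<times> UNIV"]) auto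
qed

lemma AE_lborel_snd:
  fixes P :: "'b::euclidean_space \<Rightarrow> bool"
  assumes "AE x in lborel. P x"
  shows "AE z in (lborel :: ('a::euclidean_space \<times> 'b) measure). P (snd z)"
proof -
  obtain N where N: "N \<in> null_sets lborel" "{x. \<not> P x} \<subseteq> N"
    using assms by (auto simp: eventually_ae_filter)
  have "emeasure lborel N = 0" "N \<in> sets lborel"
    using N(1) by (rule null_setsD1, rule null_setsD2)
  then have "UNIV \<times> N \<in> null_sets ((lborel :: 'a measure) \<Otimes>\<^sub>M lborel)"
    by (intro null_setsI pair_measureI) (simp_all add: lborel.emeasure_pair_measure_Times)
  then show ?thesis
    unfolding lborel_prod using N(2) by (intro AE_I'[of "UNIV \<times> N"]) auto
qed

lemma Times_sets_lebesgue:
  "A \<in> sets borel \<Longrightarrow> B \<in> sets borel \<Longrightarrow>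
    (A :: 'a::euclidean_space set) \<times> (B :: 'b::euclidean_space set) \<in> sets lebesgue"
proof -
  assume "A \<in> sets borel" "B \<in> sets borel"
  then have "A \<times> B \<in> sets (borel \<Otimes>\<^sub>M borel)" by (rule pair_measureI)
  then have "A \<times> B \<in> sets borel" unfolding borel_prod .
  then show "A \<times> B \<in> sets lebesgue" by simp
qed

lemma tensor_measurable:
  fixes f :: "'a::euclidean_space \<Rightarrow> 'c::euclidean_space" and g :: "'b::euclidean_space \<Rightarrow> real"
  assumes "A \<in> sets borel" "B \<in> sets borel"
    and f: "f \<in> borel_measurable (lebesgue_on A)" and g: "g \<in> borel_measurable (lebesgue_on B)"
  shows "(\<lambda>z. g (snd z) *\<^sub>R f (fst z)) \<in> borel_measurable (lebesgue_on (A \<times> B))"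
proof -
  have A: "A \<in> sets lebesgue" and B: "B \<in> sets lebesgue" using assms by auto
  obtain F where F: "F \<in> borel_measurable borel" "AE x in lborel. F x = indicator A x *\<^sub>R f x"
    by (rule borel_representative[OF f A])
  obtain G where G: "G \<in> borel_measurable borel" "AE y in lborel. G y = indicator B y *\<^sub>R g y"
    by (rule borel_representative[OF g B])
  show ?thesis
  proof (rule representative_measurable)
    show "(\<lambda>z. G (snd z) *\<^sub>R F (fst z)) \<in> borel_measurable borel"
      using F(1) G(1) unfolding borel_prod[symmetric] by measurable
    show "AE z in lborel. G (snd z) *\<^sub>R F (fst z) = indicator (A \<times> B) z *\<^sub>R g (snd z) *\<^sub>R f (fst z)"
      using AE_lborel_fst[OF F(2)] AE_lborel_snd[OF G(2)]
      by eventually_elim (auto simp: indicator_def)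
  qed (rule Times_sets_lebesgue[OF assms(1,2)])
qed

text \<open>One Fubini theorem for a separated function against a bounded continuous one. The
  bilinear map stands for the three pairings that are needed: product of scalars, scalar times
  vector, and inner product of gradients.\<close>

lemma
  fixes f :: "'a::euclidean_space \<Rightarrow> 'c::euclidean_space" and g :: "'b::euclidean_space \<Rightarrow> real"
    and bl :: "'c \<Rightarrow> 'e::euclidean_space \<Rightarrow> 'd::euclidean_space"
  assumes AB: "A \<in> sets borel" "B \<in> sets borel"
    and f: "integrable (lebesgue_on A) f" and g: "integrable (lebesgue_on B) g"
    and bl: "bounded_bilinear bl"
    and \<Psi>: "continuous_on UNIV \<Psi>" "\<And>z. norm (\<Psi> z) \<le> C"
  shows integrable_tensor:
      "integrable (lebesgue_on (A \<times> B)) (\<lambda>z. g (snd z) *\<^sub>R bl (f (fst z)) (\<Psi> z))"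
    and integral_tensor_fst:
      "(LINT z|lebesgue_on (A \<times> B). g (snd z) *\<^sub>R bl (f (fst z)) (\<Psi> z)) =
       (LINT y|lebesgue_on B. g y *\<^sub>R (LINT x|lebesgue_on A. bl (f x) (\<Psi> (x, y))))"
    and integral_tensor_snd:
      "(LINT z|lebesgue_on (A \<times> B). g (snd z) *\<^sub>R bl (f (fst z)) (\<Psi> z)) =
       (LINT x|lebesgue_on A. bl (f x) (LINT y|lebesgue_on B. g y *\<^sub>R \<Psi> (x, y)))"
proof -
  interpret bl: bounded_bilinear bl by (rule bl)
  have A: "A \<in> sets lebesgue" and B: "B \<in> sets lebesgue" using AB by auto
  obtain F where F: "F \<in> borel_measurable borel" "AE x in lborel. F x = indicator A x *\<^sub>R f x"
    by (rule borel_representative[OF borel_measurable_integrable[OF f] A])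
  obtain G where G: "G \<in> borel_measurable borel" "AE y in lborel. G y = indicator B y *\<^sub>R g y"
    by (rule borel_representative[OF borel_measurable_integrable[OF g] B])
  have Fi: "integrable lborel F" by (rule representative_integrable[OF F A, THEN iffD1, OF f])
  have Gi: "integrable lborel G" by (rule representative_integrable[OF G B, THEN iffD1, OF g])
  have \<Psi>m: "\<Psi> \<in> borel_measurable (borel \<Otimes>\<^sub>M borel)"
    using \<Psi>(1) unfolding borel_prod by (rule borel_measurable_continuous_onI)
  note [measurable] = F(1) G(1) \<Psi>m
  have blm[measurable (raw)]: "(\<lambda>x. bl (h x) (k x)) \<in> borel_measurable M"
    if "h \<in> borel_measurable M" "k \<in> borel_measurable M" for h k and M :: "'z measure"
  proof -
    have "(\<lambda>p. bl (fst p) (snd p)) \<in> borel_measurable (borel \<Otimes>\<^sub>M borel)"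
      unfolding borel_prod
      by (intro borel_measurable_continuous_onI bl.continuous_on continuous_intros)
    from measurable_compose[OF measurable_Pair[OF that] this] show ?thesis by simp
  qed
  obtain K where K: "0 \<le> K" "\<And>c e. norm (bl c e) \<le> norm c * norm e * K"
    using bl.nonneg_bounded by blast
  have "0 \<le> C" using \<Psi>(2)[of undefined] norm_ge_zero order_trans by blast
  define T where "T = (\<lambda>(x, y). G y *\<^sub>R bl (F x) (\<Psi> (x, y)))"
  have Tm: "T \<in> borel_measurable (borel \<Otimes>\<^sub>M borel)"
    unfolding T_def by measurable
  have Tint: "integrable (lborel \<Otimes>\<^sub>M lborel) T"
  proof (rule Bochner_Integration.integrable_bound[where f = "\<lambda>(x, y). (C * K) * (norm (F x) * norm (G y))"])
    have "integrable (lborel \<Otimes>\<^sub>M lborel) (\<lambda>(x, y). norm (F x) * norm (G y))"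
      using Fi Gi by (intro lborel_pair.Fubini_integrable) auto
    then show "integrable (lborel \<Otimes>\<^sub>M lborel) (\<lambda>(x, y). (C * K) * (norm (F x) * norm (G y)))"
      by (simp add: case_prod_unfold)
    show "AE z in lborel \<Otimes>\<^sub>M lborel. norm (T z) \<le> norm (case z of (x, y) \<Rightarrow> (C * K) * (norm (F x) * norm (G y)))"
    proof (rule AE_I2)
      fix z :: "'a \<times> 'b"
      obtain x y where z: "z = (x, y)" by fastforce
      have "norm (bl (F x) (\<Psi> (x, y))) \<le> norm (F x) * norm (\<Psi> (x, y)) * K" by (rule K(2))
      also have "\<dots> \<le> norm (F x) * C * K"
        using \<Psi>(2) K(1) by (intro mult_right_mono mult_left_mono) auto
      finally have "\<bar>G y\<bar> * norm (bl (F x) (\<Psi> (x, y))) \<le> \<bar>G y\<bar> * (norm (F x) * C * K)"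
        by (rule mult_left_mono) simp
      then show "norm (T z) \<le> norm (case z of (x, y) \<Rightarrow> (C * K) * (norm (F x) * norm (G y)))"
        using \<open>0 \<le> C\<close> K(1) by (simp add: T_def z abs_mult algebra_simps)
    qed
  qed (use Tm in simp)
  have T': "T \<in> borel_measurable borel" "AE z in lborel. T z = indicator (A \<times> B) z *\<^sub>R (g (snd z) *\<^sub>R bl (f (fst z)) (\<Psi> z))"
  proof -
    show "T \<in> borel_measurable borel" using Tm by (simp add: borel_prod)
    show "AE z in lborel. T z = indicator (A \<times> B) z *\<^sub>R (g (snd z) *\<^sub>R bl (f (fst z)) (\<Psi> z))"
      using AE_lborel_fst[OF F(2)] AE_lborel_snd[OF G(2)]
      by eventually_elim (auto simp: indicator_def T_def bl.zero_left split: prod.splits)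
  qed
  have ABl: "A \<times> B \<in> sets lebesgue" by (rule Times_sets_lebesgue[OF AB])
  show "integrable (lebesgue_on (A \<times> B)) (\<lambda>z. g (snd z) *\<^sub>R bl (f (fst z)) (\<Psi> z))"
    using Tint unfolding lborel_prod by (rule representative_integrable[OF T' ABl, THEN iffD2])
  have total: "(LINT z|lebesgue_on (A \<times> B). g (snd z) *\<^sub>R bl (f (fst z)) (\<Psi> z)) = (LINT z|(lborel \<Otimes>\<^sub>M lborel). T z)"
    unfolding lborel_prod by (rule representative_integral[OF T' ABl])
  show "(LINT z|lebesgue_on (A \<times> B). g (snd z) *\<^sub>R bl (f (fst z)) (\<Psi> z)) =
       (LINT y|lebesgue_on B. g y *\<^sub>R (LINT x|lebesgue_on A. bl (f x) (\<Psi> (x, y))))"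
  proof -
    have inner: "(LINT x|lborel. bl (F x) (\<Psi> (x, y))) = (LINT x|lebesgue_on A. bl (f x) (\<Psi> (x, y)))" for y
    proof (rule representative_integral[symmetric])
      show "AE x in lborel. bl (F x) (\<Psi> (x, y)) = indicator A x *\<^sub>R bl (f x) (\<Psi> (x, y))"
        using F(2) by eventually_elim (simp add: bl.scaleR_left)
    qed (use A in \<open>measurable\<close>)
    have "(LINT z|(lborel \<Otimes>\<^sub>M lborel). T z) = (LINT y|lborel. LINT x|lborel. T (x, y))"
      using lborel_pair.integral_snd[of "\<lambda>x y. T (x, y)"] Tint by simp
    also have "\<dots> = (LINT y|lborel. G y *\<^sub>R (LINT x|lborel. bl (F x) (\<Psi> (x, y))))"
      by (simp add: T_def)
    also have "\<dots> = (LINT y|lebesgue_on B. g y *\<^sub>R (LINT x|lebesgue_on A. bl (f x) (\<Psi> (x, y))))"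
    proof (rule representative_integral[symmetric])
      show "AE y in lborel. G y *\<^sub>R (LINT x|lborel. bl (F x) (\<Psi> (x, y))) =
          indicator B y *\<^sub>R (g y *\<^sub>R (LINT x|lebesgue_on A. bl (f x) (\<Psi> (x, y))))"
        using G(2) by eventually_elim (simp add: inner)
    qed (use B in \<open>measurable\<close>)
    finally show ?thesis using total by simp
  qed
  show "(LINT z|lebesgue_on (A \<times> B). g (snd z) *\<^sub>R bl (f (fst z)) (\<Psi> z)) =
       (LINT x|lebesgue_on A. bl (f x) (LINT y|lebesgue_on B. g y *\<^sub>R \<Psi> (x, y)))"
  proof -
    have inner: "(LINT y|lborel. G y *\<^sub>R \<Psi> (x, y)) = (LINT y|lebesgue_on B. g y *\<^sub>R \<Psi> (x, y))" for x
    proof (rule representative_integral[symmetric])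
      show "AE y in lborel. G y *\<^sub>R \<Psi> (x, y) = indicator B y *\<^sub>R (g y *\<^sub>R \<Psi> (x, y))"
        using G(2) by eventually_elim simp
    qed (use B in \<open>measurable\<close>)
    have G\<Psi>: "integrable lborel (\<lambda>y. G y *\<^sub>R \<Psi> (x, y))" for x
    proof (rule Bochner_Integration.integrable_bound[where f = "\<lambda>y. C * G y"])
      show "AE y in lborel. norm (G y *\<^sub>R \<Psi> (x, y)) \<le> norm (C * G y)"
        using \<Psi>(2) \<open>0 \<le> C\<close> by (intro AE_I2) (simp add: abs_mult mult.commute[of C] mult_left_mono)
    qed (use Gi in auto)
    have "(LINT z|(lborel \<Otimes>\<^sub>M lborel). T z) = (LINT x|lborel. LINT y|lborel. T (x, y))"
      using lborel_pair.integral_fst[of "\<lambda>x y. T (x, y)"] Tint by simp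
    also have "\<dots> = (LINT x|lborel. bl (F x) (LINT y|lborel. G y *\<^sub>R \<Psi> (x, y)))"
    proof -
      have "(LINT y|lborel. G y *\<^sub>R bl (F x) (\<Psi> (x, y))) = bl (F x) (LINT y|lborel. G y *\<^sub>R \<Psi> (x, y))" for x
        using integral_bounded_linear[OF bl.bounded_linear_right[of "F x"] G\<Psi>[of x]]
        by (simp add: bl.scaleR_right)
      then show ?thesis by (simp add: T_def)
    qed
    also have "\<dots> = (LINT x|lebesgue_on A. bl (f x) (LINT y|lebesgue_on B. g y *\<^sub>R \<Psi> (x, y)))"
    proof (rule representative_integral[symmetric])
      show "AE x in lborel. bl (F x) (LINT y|lborel. G y *\<^sub>R \<Psi> (x, y)) =
          indicator A x *\<^sub>R bl (f x) (LINT y|lebesgue_on B. g y *\<^sub>R \<Psi> (x, y))"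
        using F(2) by eventually_elim (simp add: inner bl.scaleR_left)
    qed (use A in \<open>measurable\<close>)
    finally show ?thesis using total by simp
  qed
qed

lemma
  fixes f :: "'a::euclidean_space \<Rightarrow> 'c::euclidean_space" and g :: "'b::euclidean_space \<Rightarrow> real"
  assumes AB: "A \<in> sets borel" "B \<in> sets borel" and f: "L2 A f" and g: "L2 B g"
  shows L2_tensor: "L2 (A \<times> B) (\<lambda>z. g (snd z) *\<^sub>R f (fst z))"
    and L2_tensor_norm: "(LINT z|lebesgue_on (A \<times> B). (norm (g (snd z) *\<^sub>R f (fst z)))\<^sup>2)
      = (LINT x|lebesgue_on A. (norm (f x))\<^sup>2) * (LINT y|lebesgue_on B. (g y)\<^sup>2)"
proof -
  have f2: "integrable (lebesgue_on A) (\<lambda>x. (norm (f x))\<^sup>2)"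
    and g2: "integrable (lebesgue_on B) (\<lambda>y. (g y)\<^sup>2)"
    using f g by (auto simp: L2_def)
  have eq: "(norm (g (snd z) *\<^sub>R f (fst z)))\<^sup>2 = (g (snd z))\<^sup>2 *\<^sub>R ((norm (f (fst z)))\<^sup>2 * 1)" for z
    by (simp add: power_mult_distrib)
  have "integrable (lebesgue_on (A \<times> B)) (\<lambda>z. (norm (g (snd z) *\<^sub>R f (fst z)))\<^sup>2)"
    unfolding eq by (rule integrable_tensor[OF AB f2 g2 bounded_bilinear_mult, of "\<lambda>_. 1" 1]) auto
  then show "L2 (A \<times> B) (\<lambda>z. g (snd z) *\<^sub>R f (fst z))"
    using tensor_measurable[OF AB, of f g] f g unfolding L2_def by blast
  have "(LINT z|lebesgue_on (A \<times> B). (norm (g (snd z) *\<^sub>R f (fst z)))\<^sup>2)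
      = (LINT y|lebesgue_on B. (g y)\<^sup>2 *\<^sub>R (LINT x|lebesgue_on A. (norm (f x))\<^sup>2 * 1))"
    unfolding eq by (rule integral_tensor_fst[OF AB f2 g2 bounded_bilinear_mult, of "\<lambda>_. 1" 1]) auto
  then show "(LINT z|lebesgue_on (A \<times> B). (norm (g (snd z) *\<^sub>R f (fst z)))\<^sup>2)
      = (LINT x|lebesgue_on A. (norm (f x))\<^sup>2) * (LINT y|lebesgue_on B. (g y)\<^sup>2)"
    by simp
qed

section \<open>Tensor products of square integrable functions and of test functions\<close>

lemma norm_diff_sq_le: "(norm (x - y))\<^sup>2 \<le> 2 * (norm x)\<^sup>2 + 2 * (norm y)\<^sup>2" for x y :: "'a::real_normed_vector"
proof -
  have "(norm (x - y))\<^sup>2 \<le> (norm x + norm y)\<^sup>2"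
    by (intro power_mono norm_triangle_ineq4) auto
  also have "\<dots> \<le> 2 * (norm x)\<^sup>2 + 2 * (norm y)\<^sup>2"
    using zero_le_power2[of "norm x - norm y"] by (simp add: power2_eq_square algebra_simps)
  finally show ?thesis .
qed

lemma L2_diff:
  assumes f: "L2 U f" and g: "L2 U g"
  shows "L2 U (\<lambda>x. f x - g x)"
proof -
  have "integrable (lebesgue_on U) (\<lambda>x. (norm (f x - g x))\<^sup>2)"
  proof (rule Bochner_Integration.integrable_bound[where f = "\<lambda>x. 2 * (norm (f x))\<^sup>2 + 2 * (norm (g x))\<^sup>2"])
    show "AE x in lebesgue_on U. norm ((norm (f x - g x))\<^sup>2) \<le> norm (2 * (norm (f x))\<^sup>2 + 2 * (norm (g x))\<^sup>2)"
    proof (rule AE_I2)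
      fix x
      have "0 \<le> 2 * (norm (f x))\<^sup>2 + 2 * (norm (g x))\<^sup>2" by simp
      then show "norm ((norm (f x - g x))\<^sup>2) \<le> norm (2 * (norm (f x))\<^sup>2 + 2 * (norm (g x))\<^sup>2)"
        using norm_diff_sq_le[of "f x" "g x"] by (simp only: real_norm_def abs_of_nonneg zero_le_power2)
    qed
  qed (use f g in \<open>auto simp: L2_def\<close>)
  then show ?thesis using f g by (auto simp: L2_def)
qed

lemma L2_cmult: "L2 U f \<Longrightarrow> L2 U (\<lambda>x. c * f x)" for f :: "'a::euclidean_space \<Rightarrow> real"
  by (auto simp: L2_def power_mult_distrib)

lemma continuous_measurable_lebesgue_on:
  fixes f :: "'a::euclidean_space \<Rightarrow> 'b::euclidean_space"
  assumes "continuous_on UNIV f"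
  shows "f \<in> borel_measurable (lebesgue_on U)"
  using borel_measurable_continuous_onI[OF assms]
  by (intro measurable_restrict_space1) (simp add: measurable_completion)

lemma L2_bounded_continuous:
  fixes f :: "'a::euclidean_space \<Rightarrow> 'b::euclidean_space"
  assumes f: "continuous_on UNIV f" "\<And>x. norm (f x) \<le> C" and U: "U \<in> lmeasurable"
  shows "L2 U f"
proof -
  interpret finite_measure "lebesgue_on U" using U by (rule finite_measure_lebesgue_on)
  have [measurable]: "f \<in> borel_measurable (lebesgue_on U)"
    using f(1) by (rule continuous_measurable_lebesgue_on)
  have "(norm (f x))\<^sup>2 \<le> C\<^sup>2" for x
    using f(2)[of x] by (intro power_mono) auto
  then have "integrable (lebesgue_on U) (\<lambda>x. (norm (f x))\<^sup>2)"
    by (intro integrable_const_bound[where B = "C\<^sup>2"]) auto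
  then show ?thesis by (simp add: L2_def)
qed

lemma L2_test_function:
  assumes "test_function U' \<psi>" "U \<in> lmeasurable"
  shows "L2 U \<psi>" "L2 U (gradient \<psi>)"
proof -
  have sm: "smooth_on UNIV \<psi>" using assms(1) by (rule test_function_smooth)
  obtain C where "\<And>x. norm (\<psi> x) \<le> C" using test_function_bounded[OF assms(1)] by blast
  then show "L2 U \<psi>"
    by (rule L2_bounded_continuous[OF smooth_on_continuous[OF sm] _ assms(2)])
  obtain C where "\<And>x. norm (gradient \<psi> x) \<le> C" using test_function_gradient_bounded[OF assms(1)] by blast
  then show "L2 U (gradient \<psi>)"
    by (rule L2_bounded_continuous[OF smooth_on_gradient_continuous[OF sm] _ assms(2)])
qed

text \<open>Expands the difference as \<open>(g\<^sub>n - g) (f\<^sub>n - f) + g (f\<^sub>n - f) +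
  (g\<^sub>n - g) f\<close>, whose terms have product norms.\<close>

lemma tensor_L2_limit:
  fixes f :: "'a::euclidean_space \<Rightarrow> 'c::euclidean_space" and g :: "'b::euclidean_space \<Rightarrow> real"
  assumes AB: "A \<in> sets borel" "B \<in> sets borel" and f: "L2 A f" and g: "L2 B g"
    and fn: "\<And>n. L2 A (fn n)" and gn: "\<And>n. L2 B (gn n)"
    and limf: "(\<lambda>n. LINT x|lebesgue_on A. (norm (fn n x - f x))\<^sup>2) \<longlonglongrightarrow> 0"
    and limg: "(\<lambda>n. LINT y|lebesgue_on B. (gn n y - g y)\<^sup>2) \<longlonglongrightarrow> 0"
  shows "(\<lambda>n. LINT z|lebesgue_on (A \<times> B).
      (norm (gn n (snd z) *\<^sub>R fn n (fst z) - g (snd z) *\<^sub>R f (fst z)))\<^sup>2) \<longlonglongrightarrow> 0"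
proof -
  let ?M = "lebesgue_on (A \<times> B)"
  let ?F = "\<lambda>n. LINT x|lebesgue_on A. (norm (fn n x - f x))\<^sup>2"
  let ?G = "\<lambda>n. LINT y|lebesgue_on B. (gn n y - g y)\<^sup>2"
  let ?a = "LINT x|lebesgue_on A. (norm (f x))\<^sup>2" and ?b = "LINT y|lebesgue_on B. (g y)\<^sup>2"
  let ?t1 = "\<lambda>n z. (gn n (snd z) - g (snd z)) *\<^sub>R (fn n (fst z) - f (fst z))"
  let ?t2 = "\<lambda>n z. g (snd z) *\<^sub>R (fn n (fst z) - f (fst z))"
  let ?t3 = "\<lambda>n z. (gn n (snd z) - g (snd z)) *\<^sub>R f (fst z)"
  have df: "L2 A (\<lambda>x. fn n x - f x)" and dg: "L2 B (\<lambda>y. gn n y - g y)" for n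
    using L2_diff fn f gn g by blast+
  have t: "L2 (A \<times> B) (?t1 n)" "L2 (A \<times> B) (?t2 n)" "L2 (A \<times> B) (?t3 n)" for n
    using L2_tensor[OF AB df dg] L2_tensor[OF AB df g] L2_tensor[OF AB f dg] by blast+
  then have ti: "integrable ?M (\<lambda>z. (norm (?t1 n z))\<^sup>2)" "integrable ?M (\<lambda>z. (norm (?t2 n z))\<^sup>2)"
    "integrable ?M (\<lambda>z. (norm (?t3 n z))\<^sup>2)" for n
    unfolding L2_def by blast+
  have l: "L2 (A \<times> B) (\<lambda>z. gn n (snd z) *\<^sub>R fn n (fst z) - g (snd z) *\<^sub>R f (fst z))" for n
    by (intro L2_diff L2_tensor AB fn gn f g)
  have bound: "(LINT z|?M. (norm (gn n (snd z) *\<^sub>R fn n (fst z) - g (snd z) *\<^sub>R f (fst z)))\<^sup>2)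
      \<le> 4 * (?F n * ?G n) + 4 * (?F n * ?b) + 2 * (?a * ?G n)" for n
  proof -
    have "(LINT z|?M. (norm (gn n (snd z) *\<^sub>R fn n (fst z) - g (snd z) *\<^sub>R f (fst z)))\<^sup>2)
      \<le> (LINT z|?M. 4 * (norm (?t1 n z))\<^sup>2 + 4 * (norm (?t2 n z))\<^sup>2 + 2 * (norm (?t3 n z))\<^sup>2)"
    proof (rule integral_mono)
      show "integrable ?M (\<lambda>z. (norm (gn n (snd z) *\<^sub>R fn n (fst z) - g (snd z) *\<^sub>R f (fst z)))\<^sup>2)"
        using l unfolding L2_def by blast
      show "integrable ?M (\<lambda>z. 4 * (norm (?t1 n z))\<^sup>2 + 4 * (norm (?t2 n z))\<^sup>2 + 2 * (norm (?t3 n z))\<^sup>2)"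
        using ti by (intro Bochner_Integration.integrable_add integrable_mult_right)
      fix z
      have "gn n (snd z) *\<^sub>R fn n (fst z) - g (snd z) *\<^sub>R f (fst z) = (?t1 n z - (- ?t2 n z)) - (- ?t3 n z)"
        by (simp add: algebra_simps)
      then show "(norm (gn n (snd z) *\<^sub>R fn n (fst z) - g (snd z) *\<^sub>R f (fst z)))\<^sup>2
          \<le> 4 * (norm (?t1 n z))\<^sup>2 + 4 * (norm (?t2 n z))\<^sup>2 + 2 * (norm (?t3 n z))\<^sup>2"
        using norm_diff_sq_le[of "?t1 n z - (- ?t2 n z)" "- ?t3 n z"] norm_diff_sq_le[of "?t1 n z" "- ?t2 n z"]
        by (simp only: norm_minus_cancel)
    qed
    also have "\<dots> = 4 * (LINT z|?M. (norm (?t1 n z))\<^sup>2) + 4 * (LINT z|?M. (norm (?t2 n z))\<^sup>2)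
        + 2 * (LINT z|?M. (norm (?t3 n z))\<^sup>2)"
      using ti[of n]
      by (simp only: Bochner_Integration.integral_add Bochner_Integration.integrable_add integrable_mult_right
          integral_mult_right_zero)
    also have "\<dots> = 4 * (?F n * ?G n) + 4 * (?F n * ?b) + 2 * (?a * ?G n)"
      by (simp only: L2_tensor_norm[OF AB df dg] L2_tensor_norm[OF AB df g] L2_tensor_norm[OF AB f dg])
    finally show ?thesis .
  qed
  have "(\<lambda>n. 4 * (?F n * ?G n) + 4 * (?F n * ?b) + 2 * (?a * ?G n)) \<longlonglongrightarrow>
      4 * (0 * 0) + 4 * (0 * ?b) + 2 * (?a * 0)"
    by (intro tendsto_intros limf limg)
  then have lim: "(\<lambda>n. 4 * (?F n * ?G n) + 4 * (?F n * ?b) + 2 * (?a * ?G n)) \<longlonglongrightarrow> 0" by simp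
  show ?thesis
    by (rule tendsto_sandwich[OF _ _ tendsto_const lim]) (auto intro!: always_eventually bound)
qed

text \<open>The support of a slice lies in the projection of the support, which is again
  compact.\<close>

lemma test_function_slice_fst:
  fixes \<psi> :: "'a::euclidean_space \<times> 'b::euclidean_space \<Rightarrow> real"
  assumes "test_function (A \<times> B) \<psi>"
  shows "test_function A (\<lambda>x. \<psi> (x, y))"
proof -
  let ?K = "closure {z. \<psi> z \<noteq> 0}"
  have K: "compact ?K" "?K \<subseteq> A \<times> B" using assms by (auto simp: test_function_def)
  have "compact (fst ` ?K)" using K(1) by (intro compact_continuous_image continuous_intros)
  have sub: "closure {x. \<psi> (x, y) \<noteq> 0} \<subseteq> fst ` ?K"
    by (rule closure_minimal) (use closure_subset[of "{z. \<psi> z \<noteq> 0}"] \<open>compact (fst ` ?K)\<close>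
        in \<open>force intro: compact_imp_closed\<close>)+
  then have "compact (closure {x. \<psi> (x, y) \<noteq> 0})"
    using \<open>compact (fst ` ?K)\<close> by (meson bounded_subset closed_closure compact_eq_bounded_closed)
  moreover have "fst ` ?K \<subseteq> A" using K(2) by auto
  moreover have "smooth_on UNIV (\<lambda>x. \<psi> ((0, y) + (\<lambda>x. (x, 0)) x))"
    using test_function_smooth[OF assms]
    by (intro smooth_on_compose_affine bounded_linear_Pair bounded_linear_ident bounded_linear_zero)
  ultimately show ?thesis using sub by (auto simp: test_function_def)
qed

lemma test_function_slice_snd:
  fixes \<psi> :: "'a::euclidean_space \<times> 'b::euclidean_space \<Rightarrow> real"
  assumes "test_function (A \<times> B) \<psi>"
  shows "test_function B (\<lambda>y. \<psi> (x, y))"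
proof -
  let ?K = "closure {z. \<psi> z \<noteq> 0}"
  have K: "compact ?K" "?K \<subseteq> A \<times> B" using assms by (auto simp: test_function_def)
  have "compact (snd ` ?K)" using K(1) by (intro compact_continuous_image continuous_intros)
  have sub: "closure {y. \<psi> (x, y) \<noteq> 0} \<subseteq> snd ` ?K"
    by (rule closure_minimal) (use closure_subset[of "{z. \<psi> z \<noteq> 0}"] \<open>compact (snd ` ?K)\<close>
        in \<open>force intro: compact_imp_closed\<close>)+
  then have "compact (closure {y. \<psi> (x, y) \<noteq> 0})"
    using \<open>compact (snd ` ?K)\<close> by (meson bounded_subset closed_closure compact_eq_bounded_closed)
  moreover have "snd ` ?K \<subseteq> B" using K(2) by auto
  moreover have "smooth_on UNIV (\<lambda>y. \<psi> ((x, 0) + (\<lambda>y. (0, y)) y))"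
    using test_function_smooth[OF assms]
    by (intro smooth_on_compose_affine bounded_linear_Pair bounded_linear_ident bounded_linear_zero)
  ultimately show ?thesis using sub by (auto simp: test_function_def)
qed

lemma test_function_tensor:
  fixes f :: "'a::euclidean_space \<Rightarrow> real" and g :: "'b::euclidean_space \<Rightarrow> real"
  assumes f: "test_function A f" and g: "test_function B g"
  shows "test_function (A \<times> B) (\<lambda>z. f (fst z) * g (snd z))"
proof -
  let ?K = "closure {x. f x \<noteq> 0} \<times> closure {y. g y \<noteq> 0}"
  have K: "compact ?K" "?K \<subseteq> A \<times> B"
    using f g by (auto simp: test_function_def intro: compact_Times)
  have sub: "closure {z. f (fst z) * g (snd z) \<noteq> 0} \<subseteq> ?K"
    unfolding closure_Times[symmetric] by (rule closure_mono) auto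
  then have "compact (closure {z. f (fst z) * g (snd z) \<noteq> 0})"
    using K(1) by (meson bounded_subset closed_closure compact_eq_bounded_closed)
  moreover have "smooth_on UNIV (\<lambda>z. f (0 + fst z) * g (0 + snd z))"
    using f g
    by (intro smooth_on_mult smooth_on_compose_affine bounded_linear_fst bounded_linear_snd test_function_smooth)
  ultimately show ?thesis using sub K(2) by (auto simp: test_function_def)
qed

lemma gradient_Pair:
  fixes \<psi> :: "'a::euclidean_space \<times> 'b::euclidean_space \<Rightarrow> real"
  assumes "smooth_on UNIV \<psi>"
  shows "gradient \<psi> (x, y) = (gradient (\<lambda>x. \<psi> (x, y)) x, gradient (\<lambda>y. \<psi> (x, y)) y)"
proof -
  let ?D = "frechet_derivative \<psi> (at (x, y))"
  have D: "(\<psi> has_derivative ?D) (at (x, y))"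
    using assms by (rule smooth_on_has_derivative)
  have "((\<lambda>x. \<psi> (x, y)) has_derivative (\<lambda>h. ?D (h, 0))) (at x)"
    by (rule has_derivative_compose[of "\<lambda>x. (x, y)" _ _ _ \<psi>, OF _ D]) (auto intro!: derivative_eq_intros)
  then have 1: "frechet_derivative (\<lambda>x. \<psi> (x, y)) (at x) = (\<lambda>h. ?D (h, 0))"
    by (rule frechet_derivative_at[symmetric])
  have "((\<lambda>y. \<psi> (x, y)) has_derivative (\<lambda>h. ?D (0, h))) (at y)"
    by (rule has_derivative_compose[of "\<lambda>y. (x, y)" _ _ _ \<psi>, OF _ D]) (auto intro!: derivative_eq_intros)
  then have 2: "frechet_derivative (\<lambda>y. \<psi> (x, y)) (at y) = (\<lambda>h. ?D (0, h))"
    by (rule frechet_derivative_at[symmetric])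
  show ?thesis
    unfolding gradient_def 1 2 sum_Basis_prod_eq by (simp add: prod_eq_iff fst_sum snd_sum)
qed

lemma gradient_mult_const:
  assumes "smooth_on UNIV f"
  shows "gradient (\<lambda>x. f x * k) x = k *\<^sub>R gradient f x"
    and "gradient (\<lambda>x. k * f x) x = k *\<^sub>R gradient f x"
proof -
  have "((\<lambda>x. f x * k) has_derivative (\<lambda>h. frechet_derivative f (at x) h * k)) (at x)"
    by (intro has_derivative_mult_left smooth_on_has_derivative assms)
  from frechet_derivative_at[OF this, symmetric]
  show "gradient (\<lambda>x. f x * k) x = k *\<^sub>R gradient f x"
    by (simp add: gradient_def scaleR_sum_right mult.commute)
  then show "gradient (\<lambda>x. k * f x) x = k *\<^sub>R gradient f x"
    by (simp add: mult.commute)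
qed

lemma gradient_tensor:
  fixes f :: "'a::euclidean_space \<Rightarrow> real" and g :: "'b::euclidean_space \<Rightarrow> real"
  assumes f: "smooth_on UNIV f" and g: "smooth_on UNIV g"
  shows "gradient (\<lambda>z. f (fst z) * g (snd z)) (x, y) = (g y *\<^sub>R gradient f x, f x *\<^sub>R gradient g y)"
proof -
  have "smooth_on UNIV (\<lambda>z. f (0 + fst z) * g (0 + snd z))"
    by (intro smooth_on_mult smooth_on_compose_affine bounded_linear_fst bounded_linear_snd f g)
  then have "smooth_on UNIV (\<lambda>z. f (fst z) * g (snd z))" by simp
  from gradient_Pair[OF this] show ?thesis
    by (simp add: gradient_mult_const f g)
qed

lemma
  fixes a :: "_ \<Rightarrow> 'a::euclidean_space" and b :: "_ \<Rightarrow> 'b::euclidean_space"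
  assumes a: "integrable M a" and b: "integrable M b"
  shows integrable_Pair: "integrable M (\<lambda>z. (a z, b z))"
    and integral_Pair: "(LINT z|M. (a z, b z)) = (LINT z|M. a z, LINT z|M. b z)"
proof -
  have L: "bounded_linear (\<lambda>a :: 'a. (a, 0 :: 'b))" "bounded_linear (\<lambda>b :: 'b. (0 :: 'a, b))"
    by (auto intro: bounded_linear_Pair bounded_linear_ident bounded_linear_zero)
  have eq: "(\<lambda>z. (a z, b z)) = (\<lambda>z. (a z, 0) + (0, b z))" by simp
  have i: "integrable M (\<lambda>z. (a z, 0 :: 'b))" "integrable M (\<lambda>z. (0 :: 'a, b z))"
    using integrable_bounded_linear[OF L(1) a] integrable_bounded_linear[OF L(2) b] by auto
  then show "integrable M (\<lambda>z. (a z, b z))"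
    unfolding eq by (rule Bochner_Integration.integrable_add)
  show "(LINT z|M. (a z, b z)) = (LINT z|M. a z, LINT z|M. b z)"
    unfolding eq Bochner_Integration.integral_add[OF i]
    using integral_bounded_linear[OF L(1) a] integral_bounded_linear[OF L(2) b] by simp
qed

lemma norm_Pair_sq: "(norm (a, b))\<^sup>2 = (norm a)\<^sup>2 + (norm b)\<^sup>2"
  by (simp add: norm_Pair)

lemma L2_Pair:
  fixes f :: "'a::euclidean_space \<Rightarrow> 'b::euclidean_space" and g :: "'a \<Rightarrow> 'c::euclidean_space"
  assumes "L2 U f" "L2 U g"
  shows "L2 U (\<lambda>x. (f x, g x))"
  using assms by (auto simp: L2_def norm_Pair_sq intro: borel_measurable_Pair)

section \<open>Separated Sobolev functions on product domains\<close>

lemma test_function_partials_bounded: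
  fixes \<psi> :: "'a::euclidean_space \<times> real \<Rightarrow> real"
  assumes "test_function U \<psi>"
  obtains C where
    "continuous_on UNIV \<psi>" "continuous_on UNIV (\<lambda>z. fst (gradient \<psi> z))"
    "continuous_on UNIV (\<lambda>z. snd (gradient \<psi> z))"
    "\<And>z. norm (\<psi> z) \<le> C" "\<And>z. norm (fst (gradient \<psi> z)) \<le> C" "\<And>z. norm (snd (gradient \<psi> z)) \<le> C"
proof -
  have sm: "smooth_on UNIV \<psi>" using assms by (rule test_function_smooth)
  obtain C1 where C1: "\<And>z. norm (\<psi> z) \<le> C1" using test_function_bounded[OF assms] by blast
  obtain C2 where C2: "\<And>z. norm (gradient \<psi> z) \<le> C2" using test_function_gradient_bounded[OF assms] by blast
  show thesis
  proof (rule that[of "max C1 C2"])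
    show "continuous_on UNIV \<psi>" by (rule smooth_on_continuous[OF sm])
    show "continuous_on UNIV (\<lambda>z. fst (gradient \<psi> z))" "continuous_on UNIV (\<lambda>z. snd (gradient \<psi> z))"
      by (intro continuous_intros smooth_on_gradient_continuous[OF sm])+
    show "norm (\<psi> z) \<le> max C1 C2" for z using C1[of z] by simp
    show "norm (fst (gradient \<psi> z)) \<le> max C1 C2" for z
      using order_trans[OF norm_fst_le[of "fst (gradient \<psi> z)" "snd (gradient \<psi> z)"]] C2[of z] by force
    show "norm (snd (gradient \<psi> z)) \<le> max C1 C2" for z
      using order_trans[OF norm_snd_le[of "snd (gradient \<psi> z)" "fst (gradient \<psi> z)"]] C2[of z] by force
  qed
qed

text \<open>Each component of the gradient is tested in its own variable first: slices of
  \<open>\<psi>\<close> are test functions for \<open>f\<close> or for \<open>g\<close>.\<close>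

lemma H1_grad_tensor:
  fixes f :: "'a::euclidean_space \<Rightarrow> real" and g :: "real \<Rightarrow> real"
  assumes A: "A \<in> sets borel" "A \<in> lmeasurable" and B: "B \<in> sets borel" "B \<in> lmeasurable"
    and f: "H1_grad A f Df" and g: "H1_grad B g Dg"
  shows "H1_grad (A \<times> B) (\<lambda>z. f (fst z) * g (snd z))
    (\<lambda>z. (g (snd z) *\<^sub>R Df (fst z), f (fst z) * Dg (snd z)))"
  unfolding H1_grad_def
proof (intro conjI allI impI)
  have L2s: "L2 A f" "L2 A Df" "L2 B g" "L2 B Dg" using f g by (auto simp: H1_grad_def)
  note ints = L2s(1)[THEN L2_integrable, OF A(2)] L2s(2)[THEN L2_integrable, OF A(2)]
    L2s(3)[THEN L2_integrable, OF B(2)] L2s(4)[THEN L2_integrable, OF B(2)]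
  show "L2 (A \<times> B) (\<lambda>z. f (fst z) * g (snd z))"
    using L2_tensor[OF A(1) B(1) L2s(1,3)] by (simp add: mult.commute)
  have "L2 (A \<times> B) (\<lambda>z. f (fst z) * Dg (snd z))"
    using L2_tensor[OF A(1) B(1) L2s(1,4)] by (simp add: mult.commute)
  then show "L2 (A \<times> B) (\<lambda>z. (g (snd z) *\<^sub>R Df (fst z), f (fst z) * Dg (snd z)))"
    by (intro L2_Pair L2_tensor A B L2s)
  fix \<psi> assume \<psi>: "test_function (A \<times> B) \<psi>"
  let ?M = "lebesgue_on (A \<times> B)"
  let ?D1 = "\<lambda>z. fst (gradient \<psi> z)" and ?D2 = "\<lambda>z. snd (gradient \<psi> z)"
  obtain C where C: "continuous_on UNIV \<psi>" "continuous_on UNIV ?D1" "continuous_on UNIV ?D2"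
    "\<And>z. norm (\<psi> z) \<le> C" "\<And>z. norm (?D1 z) \<le> C" "\<And>z. norm (?D2 z) \<le> C"
    by (rule test_function_partials_bounded[OF \<psi>]) blast
  have D1: "?D1 (x, y) = gradient (\<lambda>x. \<psi> (x, y)) x" and D2: "?D2 (x, y) = gradient (\<lambda>y. \<psi> (x, y)) y" for x y
    by (simp_all add: gradient_Pair[OF test_function_smooth[OF \<psi>]])
  note bb = bounded_bilinear_scaleR bounded_bilinear_mult bounded_bilinear.flip[OF bounded_bilinear_scaleR]
  note i1 = integrable_tensor[OF A(1) B(1) ints(1,3) bb(1) C(2,5)]
  note i2 = integrable_tensor[OF A(1) B(1) ints(1,3) bb(2) C(3,6)]
  note i3 = integrable_tensor[OF A(1) B(1) ints(2,3) bb(3) C(1,4)]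
  note i4 = integrable_tensor[OF A(1) B(1) ints(1,4) bb(2) C(1,4)]
  have 1: "(LINT z|?M. g (snd z) *\<^sub>R (f (fst z) *\<^sub>R ?D1 z)) = - (LINT z|?M. g (snd z) *\<^sub>R (\<psi> z *\<^sub>R Df (fst z)))"
  proof -
    have "(LINT z|?M. g (snd z) *\<^sub>R (f (fst z) *\<^sub>R ?D1 z))
        = (LINT y|lebesgue_on B. g y *\<^sub>R (LINT x|lebesgue_on A. f x *\<^sub>R ?D1 (x, y)))"
      by (rule integral_tensor_fst[OF A(1) B(1) ints(1,3) bb(1) C(2,5)])
    also have "\<dots> = (LINT y|lebesgue_on B. - (g y *\<^sub>R (LINT x|lebesgue_on A. \<psi> (x, y) *\<^sub>R Df x)))"
      using f test_function_slice_fst[OF \<psi>] unfolding D1 H1_grad_def by simp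
    also have "\<dots> = - (LINT z|?M. g (snd z) *\<^sub>R (\<psi> z *\<^sub>R Df (fst z)))"
      using integral_tensor_fst[OF A(1) B(1) ints(2,3) bb(3) C(1,4)] by simp
    finally show ?thesis .
  qed
  have 2: "(LINT z|?M. g (snd z) *\<^sub>R (f (fst z) * ?D2 z)) = - (LINT z|?M. Dg (snd z) *\<^sub>R (f (fst z) * \<psi> z))"
  proof -
    have "(LINT z|?M. g (snd z) *\<^sub>R (f (fst z) * ?D2 z))
        = (LINT x|lebesgue_on A. f x * (LINT y|lebesgue_on B. g y *\<^sub>R ?D2 (x, y)))"
      by (rule integral_tensor_snd[OF A(1) B(1) ints(1,3) bb(2) C(3,6)])
    also have "\<dots> = (LINT x|lebesgue_on A. - (f x * (LINT y|lebesgue_on B. Dg y *\<^sub>R \<psi> (x, y))))"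
      using g test_function_slice_snd[OF \<psi>] unfolding D2 H1_grad_def by (simp add: mult.commute)
    also have "\<dots> = - (LINT z|?M. Dg (snd z) *\<^sub>R (f (fst z) * \<psi> z))"
      using integral_tensor_snd[OF A(1) B(1) ints(1,4) bb(2) C(1,4)] by simp
    finally show ?thesis .
  qed
  have "(LINT z|?M. (f (fst z) * g (snd z)) *\<^sub>R gradient \<psi> z)
      = (LINT z|?M. (g (snd z) *\<^sub>R (f (fst z) *\<^sub>R ?D1 z), g (snd z) *\<^sub>R (f (fst z) * ?D2 z)))"
    by (intro Bochner_Integration.integral_cong) (auto simp: prod_eq_iff mult.commute)
  also have "\<dots> = (LINT z|?M. g (snd z) *\<^sub>R (f (fst z) *\<^sub>R ?D1 z), LINT z|?M. g (snd z) *\<^sub>R (f (fst z) * ?D2 z))"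
    by (rule integral_Pair[OF i1 i2])
  also have "\<dots> = - (LINT z|?M. g (snd z) *\<^sub>R (\<psi> z *\<^sub>R Df (fst z)), LINT z|?M. Dg (snd z) *\<^sub>R (f (fst z) * \<psi> z))"
    unfolding 1 2 by simp
  also have "(LINT z|?M. g (snd z) *\<^sub>R (\<psi> z *\<^sub>R Df (fst z)), LINT z|?M. Dg (snd z) *\<^sub>R (f (fst z) * \<psi> z))
      = (LINT z|?M. (g (snd z) *\<^sub>R (\<psi> z *\<^sub>R Df (fst z)), Dg (snd z) *\<^sub>R (f (fst z) * \<psi> z)))"
    by (rule integral_Pair[OF i3 i4, symmetric])
  also have "\<dots> = (LINT z|?M. \<psi> z *\<^sub>R (g (snd z) *\<^sub>R Df (fst z), f (fst z) * Dg (snd z)))"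
    by (intro Bochner_Integration.integral_cong) (auto simp: algebra_simps)
  finally show "(LINT z|?M. (f (fst z) * g (snd z)) *\<^sub>R gradient \<psi> z)
      = - (LINT z|?M. \<psi> z *\<^sub>R (g (snd z) *\<^sub>R Df (fst z), f (fst z) * Dg (snd z)))" .
qed

text \<open>The products of the approximating test functions approximate the product.\<close>

lemma H10_grad_tensor:
  fixes f :: "'a::euclidean_space \<Rightarrow> real" and g :: "real \<Rightarrow> real"
  assumes A: "A \<in> sets borel" "A \<in> lmeasurable" and B: "B \<in> sets borel" "B \<in> lmeasurable"
    and f: "H10_grad A f Df" and g: "H10_grad B g Dg"
  shows "H10_grad (A \<times> B) (\<lambda>z. f (fst z) * g (snd z))
    (\<lambda>z. (g (snd z) *\<^sub>R Df (fst z), f (fst z) * Dg (snd z)))"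
proof -
  have f1: "H1_grad A f Df" and g1: "H1_grad B g Dg" using f g by (auto simp: H10_grad_def)
  then have L2s: "L2 A f" "L2 A Df" "L2 B g" "L2 B Dg" by (auto simp: H1_grad_def)
  obtain fn where fn: "\<And>n. test_function A (fn n)"
    "(\<lambda>n. LINT x|lebesgue_on A. (fn n x - f x)\<^sup>2) \<longlonglongrightarrow> 0"
    "(\<lambda>n. LINT x|lebesgue_on A. (norm (gradient (fn n) x - Df x))\<^sup>2) \<longlonglongrightarrow> 0"
    using f unfolding H10_grad_def by blast
  obtain gn where gn: "\<And>n. test_function B (gn n)"
    "(\<lambda>n. LINT x|lebesgue_on B. (gn n x - g x)\<^sup>2) \<longlonglongrightarrow> 0"
    "(\<lambda>n. LINT x|lebesgue_on B. (norm (gradient (gn n) x - Dg x))\<^sup>2) \<longlonglongrightarrow> 0"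
    using g unfolding H10_grad_def by blast
  have Lf: "L2 A (fn n)" "L2 A (gradient (fn n))" for n by (rule L2_test_function[OF fn(1) A(2)])+
  have Lg: "L2 B (gn n)" "L2 B (gradient (gn n))" for n by (rule L2_test_function[OF gn(1) B(2)])+
  let ?M = "lebesgue_on (A \<times> B)"
  let ?T = "\<lambda>n z. fn n (fst z) * gn n (snd z)"
  have fn2: "(\<lambda>n. LINT x|lebesgue_on A. (norm (fn n x - f x))\<^sup>2) \<longlonglongrightarrow> 0" using fn(2) by simp
  have gn3: "(\<lambda>n. LINT x|lebesgue_on B. (gradient (gn n) x - Dg x)\<^sup>2) \<longlonglongrightarrow> 0" using gn(3) by simp
  have lim0: "(\<lambda>n. LINT z|?M. (?T n z - f (fst z) * g (snd z))\<^sup>2) \<longlonglongrightarrow> 0"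
    using tensor_L2_limit[OF A(1) B(1) L2s(1,3) Lf(1) Lg(1) fn2 gn(2)] by (simp add: mult.commute)
  let ?x = "\<lambda>n z. gn n (snd z) *\<^sub>R gradient (fn n) (fst z) - g (snd z) *\<^sub>R Df (fst z)"
  let ?y = "\<lambda>n z. gradient (gn n) (snd z) *\<^sub>R fn n (fst z) - Dg (snd z) *\<^sub>R f (fst z)"
  have limx: "(\<lambda>n. LINT z|?M. (norm (?x n z))\<^sup>2) \<longlonglongrightarrow> 0"
    by (rule tensor_L2_limit[OF A(1) B(1) L2s(2,3) Lf(2) Lg(1) fn(3) gn(2)])
  have limy: "(\<lambda>n. LINT z|?M. (norm (?y n z))\<^sup>2) \<longlonglongrightarrow> 0"
    by (rule tensor_L2_limit[OF A(1) B(1) L2s(1,4) Lf(1) Lg(2) fn2 gn3])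
  have ix: "integrable ?M (\<lambda>z. (norm (?x n z))\<^sup>2)" for n
  proof -
    have "L2 (A \<times> B) (?x n)" by (intro L2_diff L2_tensor A B L2s Lf Lg)
    then show ?thesis by (simp only: L2_def)
  qed
  have iy: "integrable ?M (\<lambda>z. (norm (?y n z))\<^sup>2)" for n
  proof -
    have "L2 (A \<times> B) (?y n)" by (intro L2_diff L2_tensor A B L2s Lf Lg)
    then show ?thesis by (simp only: L2_def)
  qed
  have split: "(norm (gradient (?T n) z - (g (snd z) *\<^sub>R Df (fst z), f (fst z) * Dg (snd z))))\<^sup>2
      = (norm (?x n z))\<^sup>2 + (norm (?y n z))\<^sup>2" for n z
  proof -
    have "gradient (?T n) z = (gn n (snd z) *\<^sub>R gradient (fn n) (fst z), fn n (fst z) * gradient (gn n) (snd z))"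
      using gradient_tensor[OF test_function_smooth[OF fn(1)] test_function_smooth[OF gn(1)],
          of n n "fst z" "snd z"] by simp
    then show ?thesis by (simp add: norm_Pair_sq mult.commute)
  qed
  have lim1: "(\<lambda>n. LINT z|?M. (norm (gradient (?T n) z - (g (snd z) *\<^sub>R Df (fst z), f (fst z) * Dg (snd z))))\<^sup>2) \<longlonglongrightarrow> 0"
    unfolding split Bochner_Integration.integral_add[OF ix iy] using tendsto_add[OF limx limy] by simp
  show ?thesis
    unfolding H10_grad_def
    by (intro conjI exI[of _ ?T] allI H1_grad_tensor[OF A B f1 g1] test_function_tensor fn gn lim0 lim1)
qed

text \<open>Fubini splits the form into an integral over \<open>x\<close>, where the equation of
  \<open>f\<close> produces \<open>c m f g\<close>, and an integral over \<open>y\<close>, where the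
  weak derivative of the flux produces \<open>- (c m g - lam g) f\<close>; the terms with
  \<open>m\<close> cancel.\<close>

lemma dirichlet_op_tensor:
  fixes f :: "'a::euclidean_space \<Rightarrow> real" and g c :: "real \<Rightarrow> real"
  assumes A: "A \<in> sets borel" "A \<in> lmeasurable" and B: "B \<in> sets borel" "B \<in> lmeasurable"
    and f: "dirichlet_op A (\<lambda>_. 1) f (\<lambda>x. m * f x)"
    and g: "H10_grad B g Dg"
    and flux: "H1_grad B (\<lambda>y. c y * Dg y) (\<lambda>y. c y * m * g y - lam * g y)"
    and cg: "integrable (lebesgue_on B) (\<lambda>y. c y * g y)"
  shows "dirichlet_op (A \<times> B) (\<lambda>z. c (snd z)) (\<lambda>z. f (fst z) * g (snd z)) (\<lambda>z. lam * (f (fst z) * g (snd z)))"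
proof -
  obtain Df where Df: "H10_grad A f Df"
    and weak: "\<And>\<psi>. test_function A \<psi> \<Longrightarrow>
      (LINT x|lebesgue_on A. Df x \<bullet> gradient \<psi> x) = (LINT x|lebesgue_on A. m * f x * \<psi> x)"
    using f by (auto simp: dirichlet_op_def)
  let ?q = "\<lambda>y. c y * m * g y - lam * g y"
  have L2s: "L2 A f" "L2 A Df" "L2 B g" "L2 B (\<lambda>y. c y * Dg y)" "L2 B ?q"
    using Df g flux by (auto simp: H10_grad_def H1_grad_def)
  note ints = L2s(1)[THEN L2_integrable, OF A(2)] L2s(2)[THEN L2_integrable, OF A(2)]
    L2s(4)[THEN L2_integrable, OF B(2)] L2s(5)[THEN L2_integrable, OF B(2)]
  have "L2 (A \<times> B) (\<lambda>z. f (fst z) * g (snd z))"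
    using L2_tensor[OF A(1) B(1) L2s(1,3)] by (simp add: mult.commute)
  then have L: "L2 (A \<times> B) (\<lambda>z. lam * (f (fst z) * g (snd z)))" by (rule L2_cmult)
  have "(LINT z|lebesgue_on (A \<times> B). (c (snd z) *\<^sub>R (g (snd z) *\<^sub>R Df (fst z), f (fst z) * Dg (snd z))) \<bullet> gradient \<psi> z)
      = (LINT z|lebesgue_on (A \<times> B). lam * (f (fst z) * g (snd z)) * \<psi> z)"
    if \<psi>: "test_function (A \<times> B) \<psi>" for \<psi>
  proof -
    let ?M = "lebesgue_on (A \<times> B)"
    let ?D1 = "\<lambda>z. fst (gradient \<psi> z)" and ?D2 = "\<lambda>z. snd (gradient \<psi> z)"
    obtain C where C: "continuous_on UNIV \<psi>" "continuous_on UNIV ?D1" "continuous_on UNIV ?D2"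
      "\<And>z. norm (\<psi> z) \<le> C" "\<And>z. norm (?D1 z) \<le> C" "\<And>z. norm (?D2 z) \<le> C"
      by (rule test_function_partials_bounded[OF \<psi>]) blast
    have D1: "?D1 (x, y) = gradient (\<lambda>x. \<psi> (x, y)) x" and D2: "?D2 (x, y) = gradient (\<lambda>y. \<psi> (x, y)) y" for x y
      by (simp_all add: gradient_Pair[OF test_function_smooth[OF \<psi>]])
    have mf: "integrable (lebesgue_on A) (\<lambda>x. m * f x)" using ints(1) by simp
    note bb = bounded_bilinear_inner bounded_bilinear_mult
    note i1 = integrable_tensor[OF A(1) B(1) ints(2) cg bb(1) C(2,5)]
    note i2 = integrable_tensor[OF A(1) B(1) ints(1,3) bb(2) C(3,6)]
    note i3 = integrable_tensor[OF A(1) B(1) mf cg bb(2) C(1,4)]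
    note i4 = integrable_tensor[OF A(1) B(1) ints(1,4) bb(2) C(1,4)]
    have 1: "(LINT z|?M. (c (snd z) * g (snd z)) *\<^sub>R (Df (fst z) \<bullet> ?D1 z))
        = (LINT z|?M. (c (snd z) * g (snd z)) *\<^sub>R (m * f (fst z) * \<psi> z))"
      unfolding integral_tensor_fst[OF A(1) B(1) ints(2) cg bb(1) C(2,5)]
        integral_tensor_fst[OF A(1) B(1) mf cg bb(2) C(1,4)] D1
      using weak[OF test_function_slice_fst[OF \<psi>]] by simp
    have 2: "(LINT z|?M. (c (snd z) * Dg (snd z)) *\<^sub>R (f (fst z) * ?D2 z))
        = - (LINT z|?M. ?q (snd z) *\<^sub>R (f (fst z) * \<psi> z))"
    proof -
      have "(LINT y|lebesgue_on B. (c y * Dg y) *\<^sub>R ?D2 (x, y)) = - (LINT y|lebesgue_on B. ?q y *\<^sub>R \<psi> (x, y))" for x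
      proof -
        have "(LINT y|lebesgue_on B. (c y * Dg y) *\<^sub>R gradient (\<lambda>y. \<psi> (x, y)) y)
            = - (LINT y|lebesgue_on B. \<psi> (x, y) *\<^sub>R ?q y)"
          using flux test_function_slice_snd[OF \<psi>] unfolding H1_grad_def by blast
        then show ?thesis unfolding D2 by (simp only: real_scaleR_def mult.commute[of "\<psi> _"])
      qed
      then show ?thesis
        unfolding integral_tensor_snd[OF A(1) B(1) ints(1,3) bb(2) C(3,6)]
          integral_tensor_snd[OF A(1) B(1) ints(1,4) bb(2) C(1,4)] by simp
    qed
    have "(LINT z|?M. (c (snd z) *\<^sub>R (g (snd z) *\<^sub>R Df (fst z), f (fst z) * Dg (snd z))) \<bullet> gradient \<psi> z)
        = (LINT z|?M. (c (snd z) * g (snd z)) *\<^sub>R (Df (fst z) \<bullet> ?D1 z)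
            + (c (snd z) * Dg (snd z)) *\<^sub>R (f (fst z) * ?D2 z))"
      by (intro Bochner_Integration.integral_cong) (auto simp: inner_prod_def)
    also have "\<dots> = (LINT z|?M. (c (snd z) * g (snd z)) *\<^sub>R (m * f (fst z) * \<psi> z))
        - (LINT z|?M. ?q (snd z) *\<^sub>R (f (fst z) * \<psi> z))"
      unfolding Bochner_Integration.integral_add[OF i1 i2] 1 2 by simp
    also have "\<dots> = (LINT z|?M. (c (snd z) * g (snd z)) *\<^sub>R (m * f (fst z) * \<psi> z) - ?q (snd z) *\<^sub>R (f (fst z) * \<psi> z))"
      by (rule Bochner_Integration.integral_diff[OF i3 i4, symmetric])
    also have "\<dots> = (LINT z|?M. lam * (f (fst z) * g (snd z)) * \<psi> z)"
      by (intro Bochner_Integration.integral_cong) (auto simp: algebra_simps)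
    finally show ?thesis .
  qed
  then show ?thesis
    unfolding dirichlet_op_def using H10_grad_tensor[OF A B Df g] L by blast
qed

section \<open>Eigenfunctions\<close>

lemma coeff_class_bounds:
  assumes c: "c \<in> coeff_class H c\<^sub>m c\<^sub>M"
  shows "AE y in lebesgue_on {0<..<H}. c\<^sub>m \<le> c y \<and> c y \<le> c\<^sub>M"
    and "c \<in> borel_measurable (lebesgue_on {0<..<H})"
proof -
  have m: "c \<in> borel_measurable (lebesgue_on {0..H})"
    and lo: "- esssup (lebesgue_on {0..H}) (\<lambda>y. - ereal (c y)) = ereal c\<^sub>m"
    and up: "esssup (lebesgue_on {0..H}) (\<lambda>y. ereal (c y)) = ereal c\<^sub>M"
    using c by (auto simp: coeff_class_def)
  have lo': "esssup (lebesgue_on {0..H}) (\<lambda>y. - ereal (c y)) = ereal (- c\<^sub>m)"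
    using lo by (metis ereal_uminus_uminus uminus_ereal.simps(1))
  have "AE y in lebesgue_on {0..H}. c\<^sub>m \<le> c y \<and> c y \<le> c\<^sub>M"
    using esssup_AE[of "\<lambda>y. - ereal (c y)" "lebesgue_on {0..H}"]
      esssup_AE[of "\<lambda>y. ereal (c y)" "lebesgue_on {0..H}"]
    unfolding lo' up by eventually_elim simp
  then have "AE y in lebesgue. y \<in> {0..H} \<longrightarrow> c\<^sub>m \<le> c y \<and> c y \<le> c\<^sub>M"
    by (rule AE_restrict_space_iff[THEN iffD1, rotated]) simp
  then have "AE y in lebesgue. y \<in> {0<..<H} \<longrightarrow> c\<^sub>m \<le> c y \<and> c y \<le> c\<^sub>M"
    by eventually_elim auto
  then show "AE y in lebesgue_on {0<..<H}. c\<^sub>m \<le> c y \<and> c y \<le> c\<^sub>M"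
    by (rule AE_restrict_space_iff[THEN iffD2, rotated]) simp
  show "c \<in> borel_measurable (lebesgue_on {0<..<H})"
    using m by (rule measurable_restrict_mono) auto
qed

lemma minimal_amplitude_le:
  assumes r: "minimal_amplitude H c c\<^sub>M \<epsilon> \<mu> \<beta> u = r" "0 < r"
    and k: "k \<ge> 1" "(\<mu> k, lam) \<in> spec_set \<mu> \<beta> c\<^sub>M \<epsilon>" and y: "y \<in> {0..H}"
  shows "r\<^sup>2 \<le> (u lam k y)\<^sup>2 + (flux H c (u lam k) y)\<^sup>2"
proof -
  let ?S = "{(u lam k y)\<^sup>2 + (flux H c (u lam k) y)\<^sup>2 | y k lam.
       y \<in> {0..H} \<and> k \<ge> 1 \<and> (\<mu> k, lam) \<in> spec_set \<mu> \<beta> c\<^sub>M \<epsilon>}"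
  have root: "r = sqrt (Inf ?S)" using r(1) unfolding minimal_amplitude_def by (rule sym)
  have "0 < sqrt (Inf ?S)" using r(2) unfolding root .
  then have "0 \<le> Inf ?S" by (simp only: real_sqrt_gt_0_iff less_imp_le)
  then have "r\<^sup>2 = Inf ?S" unfolding root by (rule real_sqrt_pow2)
  also have "\<dots> \<le> (u lam k y)\<^sup>2 + (flux H c (u lam k) y)\<^sup>2"
  proof (rule cInf_lower)
    show "bdd_below ?S" by (rule bdd_belowI[of _ 0]) auto
  qed (use k y in blast)
  finally show ?thesis .
qed

text \<open>A repeated value of \<open>\<mu>\<close> may put \<open>lam\<close> into the set through
  another index \<open>j\<close>; but equal \<open>\<mu>\<close> means the same operator, hence the
  same eigenvalues.\<close>

lemma spec_set_eigenvalue: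
  assumes seq: "\<forall>k\<ge>1. A_eigenvalue_seq H c (\<mu> k) (\<beta> k)"
    and k: "k \<ge> 1" "(\<mu> k, lam) \<in> spec_set \<mu> \<beta> c\<^sub>M \<epsilon>"
  obtains l where "l \<ge> 1" "lam = \<beta> k l" "(c\<^sub>M + \<epsilon>) * (\<mu> k)\<^sup>2 \<le> lam"
proof -
  obtain j l where j: "j \<ge> 1" "\<mu> j = \<mu> k" "l \<ge> 1" "lam = \<beta> j l" "(c\<^sub>M + \<epsilon>) * (\<mu> k)\<^sup>2 \<le> lam"
    using k(2) by (auto simp: spec_set_def)
  have "\<beta> j ` {1..} = \<beta> k ` {1..}"
    using seq j(1,2) k(1) by (auto simp: A_eigenvalue_seq_def)
  then have "lam \<in> \<beta> k ` {1..}" using j(3,4) by auto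
  then show thesis using j(5) that by auto
qed

text \<open>The eigenvalue equation as a first order system for \<open>u\<close> and its flux, in
  integrated form. The choice made in \<open>flux\<close> is harmless: weak derivatives are unique
  almost everywhere and continuous representatives are unique on the closed interval.\<close>

lemma normalized_eigenfunction_system:
  assumes u: "normalized_A_eigenfunction H c m lam u" and "0 < H"
  obtains U q where "H10_grad {0<..<H} u U" "H1_grad {0<..<H} (\<lambda>y. c y * U y) q"
    "AE y in lebesgue_on {0<..<H}. lam * u y = c y * m\<^sup>2 * u y - q y"
    "U integrable_on {0..H}" "q integrable_on {0..H}"
    "\<And>x y. 0 \<le> x \<Longrightarrow> x \<le> y \<Longrightarrow> y \<le> H \<Longrightarrow> u y - u x = integral {x..y} U"
    "continuous_on {0..H} (flux H c u)"
    "AE y in lebesgue_on {0<..<H}. flux H c u y = c y * U y"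
    "\<And>x y. 0 \<le> x \<Longrightarrow> x \<le> y \<Longrightarrow> y \<le> H \<Longrightarrow> flux H c u y - flux H c u x = integral {x..y} q"
proof -
  let ?M = "lebesgue_on {0<..<H}"
  obtain U q where Uq: "H10_grad {0<..<H} u U" "H1_grad {0<..<H} (\<lambda>y. c y * U y) q"
    "AE y in ?M. lam * u y = c y * m\<^sup>2 * u y - q y"
    using u by (auto simp: normalized_A_eigenfunction_def A_eigenfunction_def A_op_def)
  have uc: "continuous_on {0..H} u" using u by (simp add: normalized_A_eigenfunction_def)
  have uU: "H1_grad {0<..<H} u U" using Uq(1) by (simp add: H10_grad_def)
  have HK: "g integrable_on {0..H}" if "L2 {0<..<H} g" for g :: "real \<Rightarrow> real"
  proof -
    have "integrable ?M g" using that by (rule L2_integrable) simp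
    then show ?thesis using integrable_interval_HK absolutely_integrable_on_def by blast
  qed
  have Ui: "U integrable_on {0..H}" and qi: "q integrable_on {0..H}"
    using uU Uq(2) by (auto simp: H1_grad_def intro: HK)
  have increments: "v y - v x = integral {x..y} g"
    if v: "continuous_on {0..H} v" and g: "g integrable_on {0..H}"
      and AE: "AE y in ?M. v y = C + integral {0..y} g" and xy: "0 \<le> x" "x \<le> y" "y \<le> H"
    for v g :: "real \<Rightarrow> real" and C x y
  proof -
    have "v z = C + integral {0..z} g" if "z \<in> {0..H}" for z
      by (rule continuous_AE_eq[OF v _ \<open>0 < H\<close> AE that])
        (intro continuous_intros indefinite_integral_continuous_1 g)
    moreover have "integral {0..x} g + integral {x..y} g = integral {0..y} g"
      using xy g by (intro Henstock_Kurzweil_Integration.integral_combine)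
        (auto intro: integrable_on_subinterval)
    ultimately show ?thesis using xy by auto
  qed
  obtain C where C: "AE y in ?M. u y = C + integral {0..y} U"
    by (rule H1_grad_absolutely_continuous[OF uU \<open>0 < H\<close>])
  obtain C' where C': "AE y in ?M. c y * U y = C' + integral {0..y} q"
    by (rule H1_grad_absolutely_continuous[OF Uq(2) \<open>0 < H\<close>])
  let ?P = "\<lambda>y. C' + integral {0..y} q"
  have "continuous_on {0..H} ?P"
    by (intro continuous_intros indefinite_integral_continuous_1 qi)
  moreover have "AE y in ?M. ?P y = c y * U y"
    using C' by eventually_elim simp
  ultimately have "\<exists>p. continuous_on {0..H} p \<and> (\<exists>U. H1_grad {0<..<H} u U \<and> (AE y in ?M. p y = c y * U y))"
    using uU by blast
  then have "continuous_on {0..H} (flux H c u) \<and>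
      (\<exists>U. H1_grad {0<..<H} u U \<and> (AE y in ?M. flux H c u y = c y * U y))"
    unfolding flux_def by (rule someI_ex)
  then obtain U' where fl: "continuous_on {0..H} (flux H c u)" "H1_grad {0<..<H} u U'"
    "AE y in ?M. flux H c u y = c y * U' y" by blast
  have fU: "AE y in ?M. flux H c u y = c y * U y"
    using fl(3) weak_derivative_unique[OF uU fl(2)] by eventually_elim simp
  have fP: "AE y in ?M. flux H c u y = ?P y"
    using fU C' by eventually_elim simp
  show thesis
    by (rule that[OF Uq Ui qi increments[OF uc Ui C] fl(1) fU increments[OF fl(1) qi fP]])
qed

lemma normalized_eigenfunction_mass:
  assumes pos: "0 < c\<^sub>m" "c\<^sub>m \<le> c\<^sub>M" "0 < \<epsilon>" "0 < lam" "0 < H"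
    and lam: "(c\<^sub>M + \<epsilon>) * m\<^sup>2 \<le> lam" and c: "c \<in> coeff_class H c\<^sub>m c\<^sub>M"
    and u: "normalized_A_eigenfunction H c m lam u"
    and amp: "\<And>y. y \<in> {0..H} \<Longrightarrow> r\<^sup>2 \<le> (u y)\<^sup>2 + (flux H c u y)\<^sup>2"
    and ab: "0 \<le> a" "a < b" "b \<le> H"
    and \<theta>: "\<theta> = 16 * c\<^sub>M * (c\<^sub>M + \<epsilon>) / \<epsilon>" and large: "\<theta> / (b - a)\<^sup>2 < lam"
  shows "r\<^sup>2 * (b - a) / (2 + 32 * \<theta>\<^sup>2 / c\<^sub>m\<^sup>2) \<le> (LINT y|lebesgue_on {a<..<b}. (u y)\<^sup>2)"
proof -
  have uc: "continuous_on {0..H} u" using u by (simp add: normalized_A_eigenfunction_def)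
  obtain U q where sys: "H10_grad {0<..<H} u U" "H1_grad {0<..<H} (\<lambda>y. c y * U y) q"
    "AE y in lebesgue_on {0<..<H}. lam * u y = c y * m\<^sup>2 * u y - q y"
    "U integrable_on {0..H}" "q integrable_on {0..H}"
    "\<And>x y. 0 \<le> x \<Longrightarrow> x \<le> y \<Longrightarrow> y \<le> H \<Longrightarrow> u y - u x = integral {x..y} U"
    "continuous_on {0..H} (flux H c u)"
    "AE y in lebesgue_on {0<..<H}. flux H c u y = c y * U y"
    "\<And>x y. 0 \<le> x \<Longrightarrow> x \<le> y \<Longrightarrow> y \<le> H \<Longrightarrow> flux H c u y - flux H c u x = integral {x..y} q"
    by (rule normalized_eigenfunction_system[OF u \<open>0 < H\<close>]) blast
  have "r\<^sup>2 * (b - a) / (2 + 32 * \<theta>\<^sup>2 / c\<^sub>m\<^sup>2) \<le> integral {a..b} (\<lambda>y. (u y)\<^sup>2)"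
    by (rule eigenfunction_mass[OF pos(1-4) lam coeff_class_bounds(1)[OF c] sys(4,8,5,3) uc sys(6,7,9)
        amp ab \<theta> large])
  also have "continuous_on {a..b} u" using uc ab by (auto intro: continuous_on_subset)
  then have "integral {a..b} (\<lambda>y. (u y)\<^sup>2) = (LINT y|lebesgue_on {a<..<b}. (u y)\<^sup>2)"
    by (intro Lebesgue_integral_continuous_interval(1)[symmetric] continuous_intros)
  finally show ?thesis .
qed

text \<open>The weak derivative \<open>q\<close> of the flux is given by the equation only almost
  everywhere; replacing it by \<open>c m\<^sup>2 u - lam u\<close> makes the cancellation in
  \<open>dirichlet_op_tensor\<close> a pointwise one. The product does not vanish because its square
  has integral 1.\<close>

lemma product_eigenfunction:
  assumes \<Omega>: "A \<in> sets borel" "A \<in> lmeasurable" and "0 < H" and c: "c \<in> coeff_class H c\<^sub>m c\<^sub>M" and "0 < c\<^sub>m"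
    and \<phi>: "dirichlet_eigenfunction A (\<lambda>_. 1) (m\<^sup>2) \<phi>" "(LINT x|lebesgue_on A. (\<phi> x)\<^sup>2) = 1"
    and u: "normalized_A_eigenfunction H c m lam u"
  shows "dirichlet_eigenfunction (A \<times> {0<..<H}) (\<lambda>x. c (snd x)) lam (\<lambda>x. \<phi> (fst x) * u (snd x))"
proof -
  let ?M = "lebesgue_on {0<..<H}"
  obtain U q where U: "H10_grad {0<..<H} u U" and q: "H1_grad {0<..<H} (\<lambda>y. c y * U y) q"
    and eq: "AE y in ?M. lam * u y = c y * m\<^sup>2 * u y - q y"
    using u by (auto simp: normalized_A_eigenfunction_def A_eigenfunction_def A_op_def)
  have L2u: "L2 {0<..<H} u" using U by (simp add: H10_grad_def H1_grad_def)
  have um: "u \<in> borel_measurable ?M" using L2u by (simp add: L2_def)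
  note cm = coeff_class_bounds(2)[OF c]
  let ?q = "\<lambda>y. c y * m\<^sup>2 * u y - lam * u y"
  have qm: "?q \<in> borel_measurable ?M" using um cm by auto
  have qq: "AE y in ?M. q y = ?q y" using eq by eventually_elim simp
  have q0: "q \<in> borel_measurable ?M" "integrable ?M (\<lambda>y. (norm (q y))\<^sup>2)"
    using q by (auto simp: H1_grad_def L2_def)
  have L2q: "L2 {0<..<H} ?q"
  proof -
    have "integrable ?M (\<lambda>y. (norm (?q y))\<^sup>2)"
      by (rule integrable_cong_AE_imp[OF q0(2)]) (use qm qq in \<open>auto elim!: eventually_mono\<close>)
    then show ?thesis using qm by (simp add: L2_def)
  qed
  have flux: "H1_grad {0<..<H} (\<lambda>y. c y * U y) ?q"
  proof -
    have "(LINT y|?M. \<psi> y *\<^sub>R q y) = (LINT y|?M. \<psi> y *\<^sub>R ?q y)" if "test_function {0<..<H} \<psi>" for \<psi>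
    proof (rule integral_cong_AE)
      have "\<psi> \<in> borel_measurable ?M"
        using that by (intro continuous_measurable_lebesgue_on smooth_on_continuous test_function_smooth)
      then show "(\<lambda>y. \<psi> y *\<^sub>R q y) \<in> borel_measurable ?M" "(\<lambda>y. \<psi> y *\<^sub>R ?q y) \<in> borel_measurable ?M"
        using q0(1) qm by auto
      show "AE y in ?M. \<psi> y *\<^sub>R q y = \<psi> y *\<^sub>R ?q y"
        using qq by eventually_elim simp
    qed
    with q L2q show ?thesis by (simp add: H1_grad_def)
  qed
  have "integrable ?M (\<lambda>y. c y * u y)"
  proof (rule Bochner_Integration.integrable_bound[where f = "\<lambda>y. c\<^sub>M * u y"])
    have "integrable ?M u" using L2u by (rule L2_integrable) simp
    then show "integrable ?M (\<lambda>y. c\<^sub>M * u y)" by simp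
    show "AE y in ?M. norm (c y * u y) \<le> norm (c\<^sub>M * u y)"
      using coeff_class_bounds(1)[OF c]
    proof eventually_elim
      case (elim y)
      then have "\<bar>c y\<bar> \<le> \<bar>c\<^sub>M\<bar>" using \<open>0 < c\<^sub>m\<close> by auto
      then show ?case by (simp add: abs_mult mult_right_mono)
    qed
  qed (use um cm in auto)
  moreover have "dirichlet_op A (\<lambda>_. 1) \<phi> (\<lambda>x. m\<^sup>2 * \<phi> x)"
    using \<phi>(1) by (simp add: dirichlet_eigenfunction_def)
  ultimately have op: "dirichlet_op (A \<times> {0<..<H}) (\<lambda>z. c (snd z)) (\<lambda>z. \<phi> (fst z) * u (snd z))
      (\<lambda>z. lam * (\<phi> (fst z) * u (snd z)))"
    using \<Omega> U flux by (intro dirichlet_op_tensor) auto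
  have L2\<phi>: "L2 A \<phi>"
    using \<phi>(1) by (auto simp: dirichlet_eigenfunction_def dirichlet_op_def H10_grad_def H1_grad_def)
  have "(LINT z|lebesgue_on (A \<times> {0<..<H}). (norm (u (snd z) *\<^sub>R \<phi> (fst z)))\<^sup>2) = 1"
    using L2_tensor_norm[OF \<Omega>(1) _ L2\<phi> L2u] \<phi>(2) u
    by (simp add: normalized_A_eigenfunction_def)
  moreover have "(LINT z|lebesgue_on (A \<times> {0<..<H}). (norm (u (snd z) *\<^sub>R \<phi> (fst z)))\<^sup>2) = 0"
    if "AE z in lebesgue_on (A \<times> {0<..<H}). \<phi> (fst z) * u (snd z) = 0"
    using that by (intro integral_eq_zero_AE) (auto elim!: eventually_mono)
  ultimately show ?thesis using op unfolding dirichlet_eigenfunction_def by auto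
qed

lemma product_mass:
  fixes \<phi> :: "'a::euclidean_space \<Rightarrow> real" and a b :: real
  assumes "A \<in> sets borel" and \<phi>: "L2 A \<phi>" "(LINT x|lebesgue_on A. (\<phi> x)\<^sup>2) = 1"
    and u: "continuous_on {a..b} u"
  shows "(LINT x|lebesgue_on (A \<times> {a<..<b}). (\<phi> (fst x) * u (snd x))\<^sup>2) = (LINT y|lebesgue_on {a<..<b}. (u y)\<^sup>2)"
proof -
  have "integrable (lebesgue_on {a<..<b}) u" "integrable (lebesgue_on {a<..<b}) (\<lambda>y. (u y)\<^sup>2)"
    by (intro Lebesgue_integral_continuous_interval(2) continuous_intros u)+
  then have "L2 {a<..<b} u" by (auto simp: L2_def)
  from L2_tensor_norm[OF assms(1) _ \<phi>(1) this] \<phi>(2) show ?thesis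
    by (simp add: power_mult_distrib mult.commute)
qed

theorem theorem5p2:
  fixes \<epsilon> c\<^sub>m c\<^sub>M L :: real
  assumes "0 < \<epsilon>" and "0 < c\<^sub>m" and "c\<^sub>m < c\<^sub>M" and "0 < L"
  shows "\<exists>lam\<^sub>0>0. \<forall>r>0. \<exists>\<delta>>0.
    \<forall>(\<Omega>' :: (real ^ 'n) set) H \<mu> \<phi> c \<beta> u a b.
      smooth_bounded_domain \<Omega>' \<and> 0 < H \<and>
      dirichlet_eigen_seq \<Omega>' \<mu> \<phi> \<and>
      c \<in> coeff_class H c\<^sub>m c\<^sub>M \<and>
      (\<forall>k\<ge>1. A_eigenvalue_seq H c (\<mu> k) (\<beta> k)) \<and>
      (\<forall>k\<ge>1. \<forall>l\<ge>1. normalized_A_eigenfunction H c (\<mu> k) (\<beta> k l) (u (\<beta> k l) k)) \<and>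
      minimal_amplitude H c c\<^sub>M \<epsilon> \<mu> \<beta> u = r \<and>
      a < b \<and> {a<..<b} \<subseteq> {0<..<H} \<and> b - a = L \<longrightarrow>
      (\<forall>k\<ge>1. \<forall>lam. (\<mu> k, lam) \<in> spec_set \<mu> \<beta> c\<^sub>M \<epsilon> \<longrightarrow>
         (lam\<^sub>0 < lam \<longrightarrow> \<delta> \<le> (LINT y|lebesgue_on {a<..<b}. (u lam k y)\<^sup>2)) \<and>
         (let v = (\<lambda>x. \<phi> k (fst x) * u lam k (snd x)) in
            dirichlet_eigenfunction (\<Omega>' \<times> {0<..<H}) (\<lambda>x. c (snd x)) lam v \<and>
            (\<forall>d>0. d \<le> (LINT y|lebesgue_on {a<..<b}. (u lam k y)\<^sup>2) \<longleftrightarrow>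
                   d \<le> (LINT x|lebesgue_on (\<Omega>' \<times> {a<..<b}). (v x)\<^sup>2))))"
proof -
  define \<theta> where "\<theta> = 16 * c\<^sub>M * (c\<^sub>M + \<epsilon>) / \<epsilon>"
  have "0 < \<theta>" using assms by (simp add: \<theta>_def)
  define \<delta> where "\<delta> r = r\<^sup>2 * L / (2 + 32 * \<theta>\<^sup>2 / c\<^sub>m\<^sup>2)" for r
  have \<delta>: "0 < \<delta> r" if "0 < r" for r
    unfolding \<delta>_def using that assms by (intro divide_pos_pos mult_pos_pos add_pos_nonneg) auto
  have main: "(\<theta> / L\<^sup>2 < lam \<longrightarrow> \<delta> r \<le> (LINT y|lebesgue_on {a<..<b}. (u lam k y)\<^sup>2)) \<and>
      dirichlet_eigenfunction (\<Omega>' \<times> {0<..<H}) (\<lambda>x. c (snd x)) lam (\<lambda>x. \<phi> k (fst x) * u lam k (snd x)) \<and>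
      (LINT x|lebesgue_on (\<Omega>' \<times> {a<..<b}). (\<phi> k (fst x) * u lam k (snd x))\<^sup>2)
        = (LINT y|lebesgue_on {a<..<b}. (u lam k y)\<^sup>2)"
    if \<Omega>: "smooth_bounded_domain \<Omega>'" and H: "0 < H" and \<phi>: "dirichlet_eigen_seq \<Omega>' \<mu> \<phi>"
      and c: "c \<in> coeff_class H c\<^sub>m c\<^sub>M" and \<beta>: "\<forall>k\<ge>1. A_eigenvalue_seq H c (\<mu> k) (\<beta> k)"
      and u: "\<forall>k\<ge>1. \<forall>l\<ge>1. normalized_A_eigenfunction H c (\<mu> k) (\<beta> k l) (u (\<beta> k l) k)"
      and r: "minimal_amplitude H c c\<^sub>M \<epsilon> \<mu> \<beta> u = r" "0 < r"
      and ab: "a < b" "{a<..<b} \<subseteq> {0<..<H}" "b - a = L"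
      and k: "k \<ge> 1" "(\<mu> k, lam) \<in> spec_set \<mu> \<beta> c\<^sub>M \<epsilon>"
    for r H a b lam :: real and \<Omega>' :: "(real ^ 'n) set" and \<mu> \<phi> c \<beta> u and k :: nat
  proof (intro conjI impI)
    obtain l where l: "l \<ge> 1" "lam = \<beta> k l" and lam: "(c\<^sub>M + \<epsilon>) * (\<mu> k)\<^sup>2 \<le> lam"
      by (rule spec_set_eigenvalue[OF \<beta> k])
    have uk: "normalized_A_eigenfunction H c (\<mu> k) lam (u lam k)"
      using u k(1) l by simp
    have ab': "0 \<le> a" "b \<le> H"
      using ab(1,2) by (auto simp: greaterThanLessThan_subseteq_greaterThanLessThan)
    have \<Omega>': "\<Omega>' \<in> sets borel" "\<Omega>' \<in> lmeasurable"
      using \<Omega> by (auto simp: smooth_bounded_domain_def lmeasurable_open)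
    have \<phi>k: "dirichlet_eigenfunction \<Omega>' (\<lambda>_. 1) ((\<mu> k)\<^sup>2) (\<phi> k)"
      "(LINT x|lebesgue_on \<Omega>'. (\<phi> k x)\<^sup>2) = 1"
      using \<phi> k(1) unfolding dirichlet_eigen_seq_def by blast+
    then have L2\<phi>: "L2 \<Omega>' (\<phi> k)"
      by (auto simp: dirichlet_eigenfunction_def dirichlet_op_def H10_grad_def H1_grad_def)
    have cont: "continuous_on {a..b} (u lam k)"
      using uk ab' by (auto simp: normalized_A_eigenfunction_def intro: continuous_on_subset)
    show "dirichlet_eigenfunction (\<Omega>' \<times> {0<..<H}) (\<lambda>x. c (snd x)) lam (\<lambda>x. \<phi> k (fst x) * u lam k (snd x))"
      by (rule product_eigenfunction[OF \<Omega>' H c \<open>0 < c\<^sub>m\<close> \<phi>k uk])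
    show "(LINT x|lebesgue_on (\<Omega>' \<times> {a<..<b}). (\<phi> k (fst x) * u lam k (snd x))\<^sup>2)
        = (LINT y|lebesgue_on {a<..<b}. (u lam k y)\<^sup>2)"
      by (rule product_mass[OF \<Omega>'(1) L2\<phi> \<phi>k(2) cont])
    assume large: "\<theta> / L\<^sup>2 < lam"
    then have "0 < lam" using \<open>0 < \<theta>\<close> \<open>0 < L\<close> by (smt (verit) divide_pos_pos zero_less_power)
    show "\<delta> r \<le> (LINT y|lebesgue_on {a<..<b}. (u lam k y)\<^sup>2)"
      using normalized_eigenfunction_mass[OF \<open>0 < c\<^sub>m\<close> less_imp_le[OF \<open>c\<^sub>m < c\<^sub>M\<close>] \<open>0 < \<epsilon>\<close> \<open>0 < lam\<close> H lam c uk
          minimal_amplitude_le[OF r k] ab'(1) ab(1) ab'(2) \<theta>_def] large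
      by (simp add: ab(3) \<delta>_def)
  qed
  show ?thesis
  proof (rule exI[of _ "\<theta> / L\<^sup>2"], intro conjI allI impI, goal_cases)
    case 1
    show ?case using \<open>0 < \<theta>\<close> \<open>0 < L\<close> by simp
  next
    case (2 r)
    show ?case
    proof (rule exI[of _ "\<delta> r"], intro conjI[OF \<delta>[OF 2]] allI impI, elim conjE, goal_cases)
      case (1 \<Omega>' H \<mu> \<phi> c \<beta> u a b k lam)
      from main[OF 1(3-9) 2 1(10-12,1,2)] show ?case unfolding Let_def by simp
    qed
  qed
qed

end
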